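(* Assume the setting and Assumptions A1–A6 described in the context. Fix $\lambda>0$. As $N,m\to\infty$ with $N/m\to c$ for some $c\in(0,\infty)$, \[ \sqrt{N}\,\bigl(\hat\beta(\lambda)-\beta\bigr)\xrightarrow{\ \mathcal D\ }\mathcal N\bigl(0,\Xi(\lambda)\bigr), \] where \[ \Xi(\lambda)=(1+\beta^TD\beta)\,\Delta_1^{-1}(\lambda)\Big\{\Delta_2(\lambda)+K(\lambda)\,(D^{-1}+\beta\beta^T)^{-1}\Big\}\Delta_1^{-1}(\lambda). \]
   Context: Setting. Let $p\ge1$ and $n_1,\dots,n_p\ge1$ be fixed integers and $\beta=(\beta_1,\dots,\beta_p)^T\in\mathbb R^p$ fixed. For each $N$, let $X=(X_1,\dots,X_p)\in\mathbb R^{N\times p}$ be a deterministic matrix and $\Sigma$ an $N\times N$ symmetric positive definite matrix. The data are: $Y=\sum_{i=1}^pX_i\beta_i+\epsilon$ with $\epsilon\sim\mathcal N(0,\Sigma)$; for $i=1,\dots,p$ and $k=1,\dots,n_i$, $\tilde X_{ik}=X_i+\eta_{ik}$ with $\eta_{ik}\stackrel{iid}{\sim}\mathcal N(0,\Sigma)$; and $Z_1,\dots,Z_m\stackrel{iid}{\sim}\mathcal N(0,\Sigma)$. The vectors $\epsilon$, all $\eta_{ik}$ and all $Z_j$ are mutually independent. Let $\tilde X_i=n_i^{-1}\sum_{k=1}^{n_i}\tilde X_{ik}$, $\tilde X=(\tilde X_1,\dots,\tilde X_p)$, $D=\mathrm{diag}(1/n_1,\dots,1/n_p)$, $S=m^{-1}\sum_{j=1}^mZ_jZ_j^T$,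 and for $\lambda>0$, $\hat\Sigma(\lambda)=S+\lambda I_N$. The estimator is $\hat\beta(\lambda)=\arg\min_{\beta\in\mathbb R^p}\|\hat\Sigma^{-1/2}(\lambda)(Y-\tilde X\beta)\|_2^2/(1+\beta^TD\beta)$. Asymptotics are as $N,m\to\infty$ with $N/m\to c\in(0,\infty)$; limits of random quantities below are in probability. Assumptions. (A1) There exist constants $0<\underline\alpha<\overline\alpha$ with $\underline\alpha<\liminf_N\ell_{\min}(\Sigma)\le\limsup_N\ell_{\max}(\Sigma)<\overline\alpha$ ($\ell_{\min},\ell_{\max}$ the smallest/largest eigenvalues). (A2) $\lim_N X^TX/N$ exists and is positive definite. (A3) For each fixed $\lambda>0$, $X^T\hat\Sigma^{-1}(\lambda)X/N\to\Delta_1(\lambda)$, a nonsingular matrix. (A4) For each fixed $\lambda>0$, $X^T\hat\Sigma^{-1}(\lambda)\Sigma\hat\Sigma^{-1}(\lambda)X/N\to\Delta_2(\lambda)$, a nonsingular matrix. (A5) For each fixed $\lambda>0$, $\mathrm{tr}[\hat\Sigma^{-1}(\lambda)\Sigma]/N$ converges to a positive constant. (A6) For each fixed $\lambda>0$, $\mathrm{tr}[\hat\Sigma^{-1}(\lambda)\Sigma\hat\Sigma^{-1}(\lambda)\Sigma]/N\to K(\lambda)>0$. *)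

theory Defs
  imports "HOL-Probability.Probability"
begin

text \<open>N-vectors are functions nat => real, N x N matrices are functions
 nat => nat => real; only the entries with indices below N are relevant.\<close>

definition bform :: "nat \<Rightarrow> (nat \<Rightarrow> nat \<Rightarrow> real) \<Rightarrow> (nat \<Rightarrow> real) \<Rightarrow> (nat \<Rightarrow> real) \<Rightarrow> real" where
  "bform N A u v = (\<Sum>a<N. \<Sum>b<N. u a * A a b * v b)"

definition mmul :: "nat \<Rightarrow> (nat \<Rightarrow> nat \<Rightarrow> real) \<Rightarrow> (nat \<Rightarrow> nat \<Rightarrow> real) \<Rightarrow> (nat \<Rightarrow> nat \<Rightarrow> real)" where
  "mmul N A B = (\<lambda>i j. \<Sum>l<N. A i l * B l j)"

definition idm :: "nat \<Rightarrow> nat \<Rightarrow> real" where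
  "idm i j = (if i = j then 1 else 0)"

definition mtrace :: "nat \<Rightarrow> (nat \<Rightarrow> nat \<Rightarrow> real) \<Rightarrow> real" where
  "mtrace N A = (\<Sum>i<N. A i i)"

text \<open>Inverse of an N x N matrix (well defined when the matrix is invertible).\<close>
definition minv :: "nat \<Rightarrow> (nat \<Rightarrow> nat \<Rightarrow> real) \<Rightarrow> (nat \<Rightarrow> nat \<Rightarrow> real)" where
  "minv N A = (SOME B. (\<forall>i<N. \<forall>j<N. mmul N A B i j = idm i j \<and> mmul N B A i j = idm i j)
                     \<and> (\<forall>i j. (N \<le> i \<or> N \<le> j) \<longrightarrow> B i j = 0))"

definition sym_pd :: "nat \<Rightarrow> (nat \<Rightarrow> nat \<Rightarrow> real) \<Rightarrow> bool" where
  "sym_pd N A \<longleftrightarrow> (\<forall>a<N. \<forall>b<N. A a b = A b a)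
      \<and> (\<forall>c. (\<exists>a<N. c a \<noteq> 0) \<longrightarrow> bform N A c c > 0)"

definition is_eigenvalue :: "nat \<Rightarrow> (nat \<Rightarrow> nat \<Rightarrow> real) \<Rightarrow> real \<Rightarrow> bool" where
  "is_eigenvalue N A l \<longleftrightarrow>
     (\<exists>v. (\<exists>a<N. v a \<noteq> 0) \<and> (\<forall>a<N. (\<Sum>b<N. A a b * v b) = l * v a))"

definition lmin :: "nat \<Rightarrow> (nat \<Rightarrow> nat \<Rightarrow> real) \<Rightarrow> real" where
  "lmin N A = Min {l. is_eigenvalue N A l}"

definition lmax :: "nat \<Rightarrow> (nat \<Rightarrow> nat \<Rightarrow> real) \<Rightarrow> real" where
  "lmax N A = Max {l. is_eigenvalue N A l}"

definition pd_p :: "real^'p^'p \<Rightarrow> bool" where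
  "pd_p A \<longleftrightarrow> (\<forall>x. x \<noteq> 0 \<longrightarrow> x \<bullet> (A *v x) > 0)"

text \<open>X^T A X / N for X given by its columns (X i) :: nat => real, i :: 'p.\<close>
definition gram :: "nat \<Rightarrow> ('p::finite \<Rightarrow> nat \<Rightarrow> real) \<Rightarrow> (nat \<Rightarrow> nat \<Rightarrow> real) \<Rightarrow> real^'p^'p" where
  "gram N X A = (\<chi> i j. bform N A (X i) (X j) / real N)"

definition gauss_vec :: "'a measure \<Rightarrow> nat \<Rightarrow> (nat \<Rightarrow> nat \<Rightarrow> real) \<Rightarrow> ('a \<Rightarrow> nat \<Rightarrow> real) \<Rightarrow> bool" where
  "gauss_vec M N S V \<longleftrightarrow>
     (\<forall>c. (bform N S c c > 0 \<longrightarrow>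
             distributed M lborel (\<lambda>\<omega>. \<Sum>a<N. c a * V \<omega> a) (normal_density 0 (sqrt (bform N S c c))))
        \<and> (bform N S c c \<le> 0 \<longrightarrow>
             (\<lambda>\<omega>. \<Sum>a<N. c a * V \<omega> a) \<in> borel_measurable M \<and> (AE \<omega> in M. (\<Sum>a<N. c a * V \<omega> a) = 0)))"

definition gauss_p :: "'a measure \<Rightarrow> ('a \<Rightarrow> real^'p) \<Rightarrow> real^'p^'p \<Rightarrow> bool" where
  "gauss_p Q G Xi \<longleftrightarrow> prob_space Q \<and> G \<in> borel_measurable Q \<and>
     (\<forall>a. (a \<bullet> (Xi *v a) > 0 \<longrightarrow>
             distributed Q lborel (\<lambda>\<omega>. a \<bullet> G \<omega>) (normal_density 0 (sqrt (a \<bullet> (Xi *v a)))))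
        \<and> (a \<bullet> (Xi *v a) \<le> 0 \<longrightarrow> (AE \<omega> in Q. a \<bullet> G \<omega> = 0)))"

definition conv_prob :: "(nat \<Rightarrow> 'a measure) \<Rightarrow> (nat \<Rightarrow> 'a \<Rightarrow> 'b::metric_space) \<Rightarrow> 'b \<Rightarrow> bool" where
  "conv_prob M Z L \<longleftrightarrow>
     (\<forall>e>0. (\<lambda>t. measure (M t) {\<omega> \<in> space (M t). dist (Z t \<omega>) L > e}) \<longlonglongrightarrow> 0)"

definition conv_distr :: "(nat \<Rightarrow> 'a measure) \<Rightarrow> (nat \<Rightarrow> 'a \<Rightarrow> real^'p) \<Rightarrow> 'b measure \<Rightarrow> ('b \<Rightarrow> real^'p) \<Rightarrow> bool" where
  "conv_distr M Y Q G \<longleftrightarrow> (\<forall>t. Y t \<in> borel_measurable (M t)) \<and>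
     (\<forall>f :: real^'p \<Rightarrow> real. continuous_on UNIV f \<longrightarrow> bounded (range f) \<longrightarrow>
        (\<lambda>t. integral\<^sup>L (M t) (\<lambda>\<omega>. f (Y t \<omega>))) \<longlonglongrightarrow> integral\<^sup>L Q (\<lambda>\<omega>. f (G \<omega>)))"

datatype 'p lab = Eps | Eta 'p nat | Zl nat

definition labels :: "('p \<Rightarrow> nat) \<Rightarrow> nat \<Rightarrow> 'p lab set" where
  "labels n m = {Eps} \<union> {Eta i k | i k. k < n i} \<union> {Zl j | j. j < m}"

definition noise :: "('a \<Rightarrow> nat \<Rightarrow> real) \<Rightarrow> ('p \<Rightarrow> nat \<Rightarrow> 'a \<Rightarrow> nat \<Rightarrow> real) \<Rightarrow> (nat \<Rightarrow> 'a \<Rightarrow> nat \<Rightarrow> real)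
    \<Rightarrow> 'p lab \<Rightarrow> 'a \<Rightarrow> nat \<Rightarrow> real" where
  "noise eps eta Z l = (case l of Eps \<Rightarrow> eps | Eta i k \<Rightarrow> eta i k | Zl j \<Rightarrow> Z j)"

definition resp :: "('p::finite \<Rightarrow> nat \<Rightarrow> real) \<Rightarrow> real^'p \<Rightarrow> ('a \<Rightarrow> nat \<Rightarrow> real) \<Rightarrow> 'a \<Rightarrow> nat \<Rightarrow> real" where
  "resp X beta eps \<omega> a = (\<Sum>i\<in>UNIV. X i a * beta $ i) + eps \<omega> a"

definition xtil :: "('p \<Rightarrow> nat \<Rightarrow> real) \<Rightarrow> ('p \<Rightarrow> nat) \<Rightarrow> ('p \<Rightarrow> nat \<Rightarrow> 'a \<Rightarrow> nat \<Rightarrow> real) \<Rightarrow> 'a \<Rightarrow> 'p \<Rightarrow> nat \<Rightarrow> real" where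
  "xtil X n eta \<omega> i a = (\<Sum>k<n i. X i a + eta i k \<omega> a) / real (n i)"

definition scov :: "nat \<Rightarrow> (nat \<Rightarrow> 'a \<Rightarrow> nat \<Rightarrow> real) \<Rightarrow> 'a \<Rightarrow> nat \<Rightarrow> nat \<Rightarrow> real" where
  "scov m Z \<omega> a b = (\<Sum>j<m. Z j \<omega> a * Z j \<omega> b) / real m"

definition sighat :: "nat \<Rightarrow> (nat \<Rightarrow> 'a \<Rightarrow> nat \<Rightarrow> real) \<Rightarrow> real \<Rightarrow> 'a \<Rightarrow> nat \<Rightarrow> nat \<Rightarrow> real" where
  "sighat m Z lam \<omega> a b = scov m Z \<omega> a b + lam * idm a b"

text \<open>beta^T D beta with D = diag(1/n_1,...,1/n_p).\<close>
definition bDb :: "('p::finite \<Rightarrow> nat) \<Rightarrow> real^'p \<Rightarrow> real" where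
  "bDb n b = (\<Sum>i\<in>UNIV. (b $ i)^2 / real (n i))"

text \<open>Objective || hat Sigma^{-1/2} (Y - tilde X b) ||^2 / (1 + b^T D b), with the squared norm
  written as the quadratic form r^T hat Sigma^{-1} r.\<close>
definition objective :: "nat \<Rightarrow> nat \<Rightarrow> real \<Rightarrow> ('p::finite \<Rightarrow> nat) \<Rightarrow> ('a \<Rightarrow> nat \<Rightarrow> real)
    \<Rightarrow> ('a \<Rightarrow> 'p \<Rightarrow> nat \<Rightarrow> real) \<Rightarrow> (nat \<Rightarrow> 'a \<Rightarrow> nat \<Rightarrow> real) \<Rightarrow> 'a \<Rightarrow> real^'p \<Rightarrow> real" where
  "objective N m lam n Y Xt Z \<omega> b =
     (let r = (\<lambda>a. Y \<omega> a - (\<Sum>i\<in>UNIV. Xt \<omega> i a * b $ i))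
      in bform N (minv N (sighat m Z lam \<omega>)) r r / (1 + bDb n b))"

definition Dinv_bb :: "('p::finite \<Rightarrow> nat) \<Rightarrow> real^'p \<Rightarrow> real^'p^'p" where
  "Dinv_bb n b = (\<chi> i j. (if i = j then real (n i) else 0) + b $ i * b $ j)"

end

theory Submission
  imports Defs
begin

text \<open>
  Write \<open>W\<close> for the inverse of the regularised sample covariance, \<open>r = eps - etabar beta\<close> for the
  residual at the true parameter and \<open>g = 1 + beta\<^sup>T D beta\<close>. The criterion is a ratio of two quadratic
  functions of the parameter. Its minimiser is consistent because, after division by \<open>N\<close>, the criterion
  tends to \<open>kap + d\<^sup>T Delta1 d / (1 + b\<^sup>T D b)\<close> with \<open>d = b - beta\<close>, and its first-order condition then
  gives \<open>sqrt N (bhat - beta) = Delta1\<^sup>-\<^sup>1 S + o(1)\<close> in probability, with the score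
  \<open>S = (X\<^sup>T W r + etatil\<^sup>T W r) / sqrt N\<close>, where \<open>etatil\<^sub>i = etabar\<^sub>i + r (D beta)\<^sub>i / g\<close>. The point is that
  \<open>etatil\<close> is uncorrelated with, hence independent of, \<open>r\<close>, and has row covariance \<open>(D\<^sup>-\<^sup>1 + beta beta\<^sup>T)\<^sup>-\<^sup>1\<close>.
  Conditionally on \<open>W\<close> and \<open>r\<close> the score is therefore Gaussian with covariance proportional to
  \<open>r\<^sup>T W Sigma W r / N\<close>, which concentrates at \<open>g K\<close>; integrating out \<open>r\<close> given \<open>W\<close> as well yields the limit of
  the characteristic function of \<open>S\<close>. Quadratic forms concentrate because the conditional variance of
  \<open>V\<^sup>T A V\<close> is \<open>2 tr (A Sigma A Sigma)\<close>.
\<close>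

section \<open>Convergence in probability as a filter limit\<close>

text \<open>The criterion is a ratio, so its first-order condition contains the unknown minimal
  value as a multiplier. This value does double work. Multiplied by \<open>D\<close>, it cancels the
  bias \<open>kap D\<close> that measurement error adds to the Gram matrix of the observed
  regressors, leaving \<open>Delta1\<close>. Replaced by the value \<open>f / g\<close> at
  \<open>beta\<close>, it centres the score: \<open>etabar\<^sup>T W r / sqrt N\<close> alone has a
  mean of order \<open>sqrt N\<close> in general, and the random correction \<open>f / g\<close>, in
  place of a deterministic one, is what turns \<open>etabar\<close> into \<open>etatil\<close>. All
  noise is Gaussian, so characteristic functions are computed exactly at each sample size, before
  any limit is taken. The law of \<open>W\<close> is not tractable, but \<open>W\<close> enters only
  through traces and quadratic forms whose limits are assumed or derived. The sample spaces
  \<open>M t\<close> change with \<open>t\<close>; convergence in probability is therefore encoded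
  as a limit along a filter on pairs \<open>(t, \<omega>)\<close>, which makes the usual rules for
  limits and eventual inequalities available for random quantities.\<close>

definition prob_filter :: "(nat \<Rightarrow> 'a measure) \<Rightarrow> (nat \<times> 'a) filter" where
  "prob_filter M = Abs_filter (\<lambda>P. \<forall>e>0. \<forall>\<^sub>F t in sequentially. \<exists>B\<in>sets (M t).
      emeasure (M t) B \<le> ennreal e \<and> (\<forall>\<omega>\<in>space (M t) - B. P (t, \<omega>)))"

text \<open>The failure set is only asked to lie inside a measurable \<open>B\<close> of small mass,
  which admits predicates that are not measurable themselves. The events form a filter because a
  conjunction costs \<open>e/2 + e/2\<close>.\<close>

lemma eventually_prob_filter:
  "eventually P (prob_filter M) \<longleftrightarrow> (\<forall>e>0. \<forall>\<^sub>F t in sequentially. \<exists>B\<in>sets (M t).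
      emeasure (M t) B \<le> ennreal e \<and> (\<forall>\<omega>\<in>space (M t) - B. P (t, \<omega>)))"
  unfolding prob_filter_def
proof (rule eventually_Abs_filter, rule is_filter.intro, goal_cases)
  case 1
  show ?case by (auto intro!: always_eventually bexI[of _ "{}"])
next
  case (2 P Q)
  show ?case
  proof (intro allI impI)
    fix e :: real assume "e > 0"
    then have "e/2 > 0" by simp
    with 2 have
      "\<forall>\<^sub>F t in sequentially. \<exists>B\<in>sets (M t). emeasure (M t) B \<le> ennreal (e/2) \<and> (\<forall>\<omega>\<in>space (M t) - B. P (t, \<omega>))"
      "\<forall>\<^sub>F t in sequentially. \<exists>B\<in>sets (M t). emeasure (M t) B \<le> ennreal (e/2) \<and> (\<forall>\<omega>\<in>space (M t) - B. Q (t, \<omega>))"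
      by blast+
    then show "\<forall>\<^sub>F t in sequentially. \<exists>B\<in>sets (M t). emeasure (M t) B \<le> ennreal e \<and> (\<forall>\<omega>\<in>space (M t) - B. P (t, \<omega>) \<and> Q (t, \<omega>))"
    proof eventually_elim
      case (elim t)
      then obtain B C where B: "B \<in> sets (M t)" "emeasure (M t) B \<le> ennreal (e/2)" "\<forall>\<omega>\<in>space (M t) - B. P (t, \<omega>)"
        and C: "C \<in> sets (M t)" "emeasure (M t) C \<le> ennreal (e/2)" "\<forall>\<omega>\<in>space (M t) - C. Q (t, \<omega>)" by blast
      have "emeasure (M t) (B \<union> C) \<le> emeasure (M t) B + emeasure (M t) C"
        by (rule emeasure_subadditive) (use B C in auto)
      also have "\<dots> \<le> ennreal (e/2) + ennreal (e/2)" by (intro add_mono B C)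
      also have "\<dots> = ennreal e" using \<open>e > 0\<close> by (subst ennreal_plus[symmetric]) auto
      finally show ?case using B C by (intro bexI[of _ "B \<union> C"]) auto
    qed
  qed
next
  case (3 P Q)
  show ?case
  proof (intro allI impI)
    fix e :: real assume "e > 0"
    with 3(2) have "\<forall>\<^sub>F t in sequentially. \<exists>B\<in>sets (M t). emeasure (M t) B \<le> ennreal e \<and> (\<forall>\<omega>\<in>space (M t) - B. P (t, \<omega>))"
      by blast
    then show "\<forall>\<^sub>F t in sequentially. \<exists>B\<in>sets (M t). emeasure (M t) B \<le> ennreal e \<and> (\<forall>\<omega>\<in>space (M t) - B. Q (t, \<omega>))"
      by eventually_elim (use 3(1) in blast)
  qed
qed

text \<open>Nontriviality of the filter makes limits unique and lets random matrices pass symmetry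
  and positive semidefiniteness on to their limits.\<close>

lemma prob_filter_neq_bot:
  assumes "\<And>t. prob_space (M t)"
  shows "prob_filter M \<noteq> bot"
proof
  assume "prob_filter M = bot"
  then have "eventually (\<lambda>_. False) (prob_filter M)" by simp
  then have "\<forall>\<^sub>F t in sequentially. \<exists>B\<in>sets (M t). emeasure (M t) B \<le> ennreal (1/2) \<and> (\<forall>\<omega>\<in>space (M t) - B. False)"
    unfolding eventually_prob_filter by (rule allE[of _ "1/2"]) simp
  then obtain t B where B: "B \<in> sets (M t)" "emeasure (M t) B \<le> ennreal (1/2)" "space (M t) \<subseteq> B"
    unfolding eventually_sequentially by blast
  then have "B = space (M t)" using sets.sets_into_space by blast
  then have "emeasure (M t) B = 1" using prob_space.emeasure_space_1 assms by blast
  with B(2) have "ennreal 1 \<le> ennreal (1/2)" by simp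
  then show False by (subst (asm) ennreal_le_iff) auto
qed

lemma eventually_prob_filter_seq:
  assumes "\<forall>\<^sub>F t in sequentially. \<forall>\<omega>\<in>space (M t). P (t, \<omega>)"
  shows "eventually P (prob_filter M)"
  unfolding eventually_prob_filter
proof (intro allI impI)
  fix e :: real assume "e > 0"
  show "\<forall>\<^sub>F t in sequentially. \<exists>B\<in>sets (M t). emeasure (M t) B \<le> ennreal e \<and> (\<forall>\<omega>\<in>space (M t) - B. P (t, \<omega>))"
    using assms by eventually_elim (auto intro!: bexI[of _ "{}"])
qed

lemma eventually_prob_filter_AE:
  assumes "\<forall>\<^sub>F t in sequentially. AE \<omega> in M t. P (t, \<omega>)"
  shows "eventually P (prob_filter M)"
  unfolding eventually_prob_filter
proof (intro allI impI)
  fix e :: real assume "e > 0"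
  show "\<forall>\<^sub>F t in sequentially. \<exists>B\<in>sets (M t). emeasure (M t) B \<le> ennreal e \<and> (\<forall>\<omega>\<in>space (M t) - B. P (t, \<omega>))"
    using assms
  proof eventually_elim
    case (elim t)
    then obtain B where "{\<omega>\<in>space (M t). \<not> P (t, \<omega>)} \<subseteq> B" "emeasure (M t) B = 0" "B \<in> sets (M t)"
      by (elim AE_E)
    then show ?case using \<open>e > 0\<close> by (intro bexI[of _ B]) auto
  qed
qed

lemma tendsto_prob_filter_seq:
  assumes "f \<longlonglongrightarrow> l"
  shows "((\<lambda>x. f (fst x)) \<longlongrightarrow> l) (prob_filter M)"
proof (rule topological_tendstoI)
  fix S assume "open S" "l \<in> S"
  with assms have "\<forall>\<^sub>F t in sequentially. f t \<in> S" by (rule topological_tendstoD)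
  then have "\<forall>\<^sub>F t in sequentially. \<forall>\<omega>\<in>space (M t). f (fst (t, \<omega>)) \<in> S"
    by eventually_elim simp
  then show "\<forall>\<^sub>F x in prob_filter M. f (fst x) \<in> S"
    by (intro eventually_prob_filter_seq)
qed

lemma eventually_prob_filterI_measure:
  assumes "\<And>t. prob_space (M t)"
    and "\<And>t. {\<omega>\<in>space (M t). \<not> P (t, \<omega>)} \<in> sets (M t)"
    and "(\<lambda>t. measure (M t) {\<omega>\<in>space (M t). \<not> P (t, \<omega>)}) \<longlonglongrightarrow> 0"
  shows "eventually P (prob_filter M)"
  unfolding eventually_prob_filter
proof (intro allI impI)
  fix e :: real assume "e > 0"
  with assms(3) have "\<forall>\<^sub>F t in sequentially. measure (M t) {\<omega>\<in>space (M t). \<not> P (t, \<omega>)} < e"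
    by (rule order_tendstoD)
  then show "\<forall>\<^sub>F t in sequentially. \<exists>B\<in>sets (M t). emeasure (M t) B \<le> ennreal e \<and> (\<forall>\<omega>\<in>space (M t) - B. P (t, \<omega>))"
  proof eventually_elim
    case (elim t)
    interpret prob_space "M t" by fact
    show ?case using elim assms(2)[of t]
      by (intro bexI[of _ "{\<omega>\<in>space (M t). \<not> P (t, \<omega>)}"]) (auto simp: emeasure_eq_measure intro!: ennreal_leI)
  qed
qed

text \<open>\<open>conv_prob\<close> is phrased with \<open>measure\<close>, which is 0 on
  non-measurable sets; measurability of \<open>Z\<close> is what gives the hypothesis its intended
  content.\<close>

lemma tendsto_prob_filterI:
  fixes Z :: "nat \<Rightarrow> 'a \<Rightarrow> 'b::{metric_space, second_countable_topology}"
  assumes "conv_prob M Z L" and "\<And>t. prob_space (M t)" and [measurable]: "\<And>t. Z t \<in> borel_measurable (M t)"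
  shows "((\<lambda>x. Z (fst x) (snd x)) \<longlongrightarrow> L) (prob_filter M)"
proof (rule tendstoI)
  fix e :: real assume "e > 0"
  then have "(\<lambda>t. measure (M t) {\<omega> \<in> space (M t). dist (Z t \<omega>) L > e/2}) \<longlonglongrightarrow> 0"
    using assms(1) unfolding conv_prob_def by (elim allE[of _ "e/2"]) simp
  then have "\<forall>\<^sub>F x in prob_filter M. dist (Z (fst x) (snd x)) L \<le> e/2"
    by (intro eventually_prob_filterI_measure assms(2)) (auto simp: not_le)
  then show "\<forall>\<^sub>F x in prob_filter M. dist (Z (fst x) (snd x)) L < e"
    by eventually_elim (use \<open>e > 0\<close> in auto)
qed

lemma prob_filter_measure_tendsto_0:
  assumes "eventually P (prob_filter M)" "\<And>t. prob_space (M t)"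
    and "\<And>t. {\<omega>\<in>space (M t). \<not> P (t, \<omega>)} \<in> sets (M t)"
  shows "(\<lambda>t. measure (M t) {\<omega>\<in>space (M t). \<not> P (t, \<omega>)}) \<longlonglongrightarrow> 0"
proof (rule LIMSEQ_I)
  fix e :: real assume "e > 0"
  then have "\<forall>\<^sub>F t in sequentially. \<exists>B\<in>sets (M t).
      emeasure (M t) B \<le> ennreal (e/2) \<and> (\<forall>\<omega>\<in>space (M t) - B. P (t, \<omega>))"
    using assms(1) unfolding eventually_prob_filter by (elim allE[of _ "e/2"]) simp
  then have "\<forall>\<^sub>F t in sequentially. norm (measure (M t) {\<omega>\<in>space (M t). \<not> P (t, \<omega>)} - 0) < e"
  proof eventually_elim
    case (elim t)
    interpret prob_space "M t" by fact
    from elim obtain B where B: "B\<in>sets (M t)" "emeasure (M t) B \<le> ennreal (e/2)" "\<forall>\<omega>\<in>space (M t) - B. P (t, \<omega>)" by blast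
    have "measure (M t) {\<omega>\<in>space (M t). \<not> P (t, \<omega>)} \<le> measure (M t) B"
      by (rule finite_measure_mono) (use B in auto)
    also have "\<dots> \<le> e/2" using B(2) \<open>e > 0\<close> by (simp add: emeasure_eq_measure)
    finally show ?case using \<open>e > 0\<close> by simp
  qed
  then show "\<exists>no. \<forall>t\<ge>no. norm (measure (M t) {\<omega>\<in>space (M t). \<not> P (t, \<omega>)} - 0) < e"
    by (simp add: eventually_sequentially)
qed

lemma expectation_tendsto_prob_filter_0:
  fixes f :: "nat \<Rightarrow> 'a \<Rightarrow> 'b::{banach, second_countable_topology}"
  assumes "\<And>t. prob_space (M t)" and [measurable]: "\<And>t. f t \<in> borel_measurable (M t)"
    and bd: "\<And>t \<omega>. \<omega> \<in> space (M t) \<Longrightarrow> norm (f t \<omega>) \<le> B"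
    and lim: "((\<lambda>x. f (fst x) (snd x)) \<longlongrightarrow> 0) (prob_filter M)"
  shows "(\<lambda>t. \<integral>\<omega>. f t \<omega> \<partial>M t) \<longlonglongrightarrow> 0"
proof (rule LIMSEQ_I)
  fix e :: real assume e: "e > 0"
  have B: "B \<ge> 0"
    using bd[of _ 0] prob_space.not_empty[OF assms(1)[of 0]] norm_ge_zero order_trans by blast
  have "\<forall>\<^sub>F x in prob_filter M. norm (f (fst x) (snd x)) < e/2"
    using tendstoD[OF lim, of "e/2"] e by simp
  then have "(\<lambda>t. measure (M t) {\<omega>\<in>space (M t). \<not> norm (f t \<omega>) < e/2}) \<longlonglongrightarrow> 0"
    using prob_filter_measure_tendsto_0[of "\<lambda>x. norm (f (fst x) (snd x)) < e/2" M] assms(1) by simp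
  \<comment> \<open>Dividing by \<open>B + 1\<close> instead of \<open>B\<close> covers the case
    \<open>B = 0\<close>.\<close>
  then have "\<forall>\<^sub>F t in sequentially. measure (M t) {\<omega>\<in>space (M t). \<not> norm (f t \<omega>) < e/2} < e / (2 * (B+1))"
    by (rule order_tendstoD) (use e B in auto)
  then have "\<forall>\<^sub>F t in sequentially. norm ((\<integral>\<omega>. f t \<omega> \<partial>M t) - 0) < e"
  proof eventually_elim
    case (elim t)
    interpret prob_space "M t" by fact
    let ?A = "{\<omega>\<in>space (M t). \<not> norm (f t \<omega>) < e/2}"
    have int: "integrable (M t) (f t)"
      by (rule integrable_const_bound[of _ B]) (use bd in auto)
    have iA: "integrable (M t) (\<lambda>\<omega>. e/2 + B * indicator ?A \<omega>)"
      by (rule integrable_const_bound[of _ "e/2 + B"]) (use e B in \<open>auto simp: indicator_def\<close>)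
    have iI: "integrable (M t) (indicat_real ?A)"
      by (rule integrable_const_bound[of _ 1]) (auto simp: indicator_def)
    have "norm (\<integral>\<omega>. f t \<omega> \<partial>M t) \<le> (\<integral>\<omega>. norm (f t \<omega>) \<partial>M t)" by simp
    also have "\<dots> \<le> (\<integral>\<omega>. e/2 + B * indicator ?A \<omega> \<partial>M t)"
      by (rule integral_mono) (use bd int iA B e in \<open>auto simp: indicator_def not_less intro: add_increasing\<close>)
    also have "\<dots> = e/2 + B * measure (M t) ?A"
      using iI by (subst Bochner_Integration.integral_add) (auto simp: prob_space)
    also have "\<dots> \<le> e/2 + B * (e / (2 * (B+1)))"
      using elim B by (intro add_left_mono mult_left_mono) auto
    also have "\<dots> < e/2 + (B+1) * (e / (2 * (B+1)))"
      using e B by (intro add_strict_left_mono mult_strict_right_mono) auto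
    also have "\<dots> = e" using B by (simp add: field_simps)
    finally show ?case by simp
  qed
  then show "\<exists>no. \<forall>t\<ge>no. norm ((\<integral>\<omega>. f t \<omega> \<partial>M t) - 0) < e"
    by (simp add: eventually_sequentially)
qed

section \<open>Multivariate characteristic functions\<close>

text \<open>The offset is 2 rather than 1 so that the normalising constant is at least 1 for every
  \<open>g\<close> with values in [-1,1], even for \<open>g = -1\<close> throughout.\<close>

definition tilt :: "'a measure \<Rightarrow> ('a \<Rightarrow> real) \<Rightarrow> ('a \<Rightarrow> real) \<Rightarrow> real measure" where
  "tilt M X g = distr (density M (\<lambda>\<omega>. ennreal ((2 + g \<omega>) / (2 + (\<integral>\<omega>. g \<omega> \<partial>M))))) borel X"

context prob_space
begin

lemma tilt_norm_pos:
  assumes [measurable]: "g \<in> borel_measurable M" and "\<And>\<omega>. \<bar>g \<omega>\<bar> \<le> (1::real)"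
  shows "2 + expectation g > 0"
proof -
  have "\<bar>expectation g\<bar> \<le> expectation (\<lambda>\<omega>. \<bar>g \<omega>\<bar>)" by (rule integral_abs_bound)
  also have "\<dots> \<le> expectation (\<lambda>_. 1)"
    by (rule integral_mono) (auto intro!: integrable_const_bound[of _ 1] simp: assms)
  finally show ?thesis by (simp add: prob_space)
qed

lemma tilt_real_distribution:
  assumes [measurable]: "g \<in> borel_measurable M" "X \<in> borel_measurable M" and g: "\<And>\<omega>. \<bar>g \<omega>\<bar> \<le> (1::real)"
  shows "real_distribution (tilt M X g)"
proof -
  let ?c = "2 + expectation g"
  have c: "?c > 0" by (rule tilt_norm_pos) (use assms in auto)
  have pos: "0 \<le> (2 + g \<omega>) / ?c" for \<omega> using c g[of \<omega>] by simp
  have ig: "integrable M g" by (rule integrable_const_bound[of _ 1]) (auto simp: g)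
  have "(\<integral>\<^sup>+\<omega>. ennreal ((2 + g \<omega>) / ?c) \<partial>M) = ennreal (\<integral>\<omega>. (2 + g \<omega>) / ?c \<partial>M)"
    by (rule nn_integral_eq_integral) (use pos ig in auto)
  also have "(\<integral>\<omega>. (2 + g \<omega>) / ?c \<partial>M) = 1"
    using c ig by (simp add: prob_space)
  finally have "prob_space (density M (\<lambda>\<omega>. ennreal ((2 + g \<omega>) / ?c)))"
    by (intro prob_spaceI) (simp add: emeasure_density cong: nn_integral_cong)
  then show ?thesis
    unfolding tilt_def by (intro prob_space.real_distribution_distr) auto
qed

lemma tilt_integral:
  fixes h :: "real \<Rightarrow> 'b::{banach, second_countable_topology}"
  assumes [measurable]: "g \<in> borel_measurable M" "X \<in> borel_measurable M" "h \<in> borel_measurable borel"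
    and g: "\<And>\<omega>. \<bar>g \<omega>\<bar> \<le> (1::real)" and h: "\<And>x. norm (h x) \<le> B"
  shows "(2 + expectation g) *\<^sub>R (\<integral>x. h x \<partial>tilt M X g)
     = 2 *\<^sub>R (\<integral>\<omega>. h (X \<omega>) \<partial>M) + (\<integral>\<omega>. g \<omega> *\<^sub>R h (X \<omega>) \<partial>M)"
proof -
  let ?c = "2 + expectation g"
  have c: "?c > 0" by (rule tilt_norm_pos) (use assms in auto)
  have pos: "0 \<le> (2 + g \<omega>) / ?c" for \<omega> using c g[of \<omega>] by simp
  have i1: "integrable M (\<lambda>\<omega>. h (X \<omega>))" by (rule integrable_const_bound[of _ B]) (auto simp: h)
  have "\<bar>g \<omega>\<bar> * norm (h (X \<omega>)) \<le> 1 * B" for \<omega> by (intro mult_mono g h) auto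
  then have i2: "integrable M (\<lambda>\<omega>. g \<omega> *\<^sub>R h (X \<omega>))"
    by (intro integrable_const_bound[of _ B]) auto
  have "(\<integral>x. h x \<partial>tilt M X g) = (\<integral>\<omega>. ((2 + g \<omega>) / ?c) *\<^sub>R h (X \<omega>) \<partial>M)"
    unfolding tilt_def using pos by (subst integral_distr) (auto simp: integral_density)
  also have "\<dots> = (\<integral>\<omega>. (1 / ?c) *\<^sub>R (2 *\<^sub>R h (X \<omega>) + g \<omega> *\<^sub>R h (X \<omega>)) \<partial>M)"
    by (intro Bochner_Integration.integral_cong refl) (simp add: algebra_simps add_divide_distrib)
  also have "\<dots> = (1 / ?c) *\<^sub>R (2 *\<^sub>R (\<integral>\<omega>. h (X \<omega>) \<partial>M) + (\<integral>\<omega>. g \<omega> *\<^sub>R h (X \<omega>) \<partial>M))"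
    using i1 i2 by simp
  finally show ?thesis using c by simp
qed

lemma char_tilt:
  assumes [measurable]: "g \<in> borel_measurable M" "X \<in> borel_measurable M"
    and g: "\<And>\<omega>. \<bar>g \<omega>\<bar> \<le> (1::real)"
  shows "char (tilt M X g) a = (2 * (\<integral>\<omega>. iexp (a * X \<omega>) \<partial>M) + (\<integral>\<omega>. g \<omega> * iexp (a * X \<omega>) \<partial>M)) / (2 + expectation g)"
proof -
  have c: "2 + expectation g > 0" by (rule tilt_norm_pos) (use assms in auto)
  have "(2 + expectation g) *\<^sub>R char (tilt M X g) a
    = 2 *\<^sub>R (\<integral>\<omega>. iexp (a * X \<omega>) \<partial>M) + (\<integral>\<omega>. g \<omega> *\<^sub>R iexp (a * X \<omega>) \<partial>M)"
    unfolding char_def by (rule tilt_integral[of g X "\<lambda>x. iexp (a * x)" 1]) (use assms in auto)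
  moreover have "complex_of_real (2 + expectation g) \<noteq> 0" using c by (metis less_irrefl of_real_eq_0_iff)
  ultimately show ?thesis
    by (simp add: scaleR_conv_of_real eq_divide_eq mult.commute)
qed

end

text \<open>A weight \<open>g\<close> with values in \<open>[-1,1]\<close> is absorbed into the probability measure with density
  proportional to \<open>2 + g\<close>, to which the theorems on real distributions apply.\<close>

lemma tilt_levy_unique:
  fixes M :: "'a measure" and M' :: "'b measure"
  assumes "prob_space M" "prob_space M'"
    and [measurable]: "g \<in> borel_measurable M" "X \<in> borel_measurable M" "g' \<in> borel_measurable M'" "X' \<in> borel_measurable M'"
    and g: "\<And>\<omega>. \<bar>g \<omega>\<bar> \<le> (1::real)" "\<And>\<omega>. \<bar>g' \<omega>\<bar> \<le> (1::real)"
    and c1: "\<And>a. (\<integral>\<omega>. iexp (a * X \<omega>) \<partial>M) = (\<integral>\<omega>. iexp (a * X' \<omega>) \<partial>M')"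
    and c2: "\<And>a. (\<integral>\<omega>. g \<omega> * iexp (a * X \<omega>) \<partial>M) = (\<integral>\<omega>. g' \<omega> * iexp (a * X' \<omega>) \<partial>M')"
    and [measurable]: "h \<in> borel_measurable borel" and h: "\<And>x. \<bar>h x :: real\<bar> \<le> 1"
  shows "(\<integral>\<omega>. g \<omega> * h (X \<omega>) \<partial>M) = (\<integral>\<omega>. g' \<omega> * h (X' \<omega>) \<partial>M')"
proof -
  interpret M: prob_space M by fact
  interpret M': prob_space M' by fact
  have "complex_of_real (M.expectation g) = complex_of_real (M'.expectation g')"
    using c2[of 0] by simp
  then have eg: "M.expectation g = M'.expectation g'" by simp
  have "tilt M X g = tilt M' X' g'"
    by (rule Levy_uniqueness)
       (use g c1 c2 eg in \<open>auto simp: M.char_tilt M'.char_tilt fun_eq_iff intro!: M.tilt_real_distribution M'.tilt_real_distribution\<close>)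
  \<comment> \<open>The weight 0 yields the untilted law. Subtracting its integral removes the
    contribution of the constant 2 and leaves the integral weighted by \<open>g\<close>.\<close>
  moreover have "tilt M X (\<lambda>_. 0) = tilt M' X' (\<lambda>_. 0)"
    by (rule Levy_uniqueness)
       (use c1 in \<open>auto simp: M.char_tilt M'.char_tilt fun_eq_iff intro!: M.tilt_real_distribution M'.tilt_real_distribution\<close>)
  ultimately show ?thesis
    using M.tilt_integral[of g X h 1] M'.tilt_integral[of g' X' h 1]
      M.tilt_integral[of "\<lambda>_. 0" X h 1] M'.tilt_integral[of "\<lambda>_. 0" X' h 1] g h eg by simp
qed

lemma tilt_levy_continuity:
  fixes M :: "nat \<Rightarrow> 'a measure" and M' :: "'b measure"
  assumes ps: "\<And>t. prob_space (M t)" "prob_space M'"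
    and [measurable]: "\<And>t. g t \<in> borel_measurable (M t)" "\<And>t. X t \<in> borel_measurable (M t)" "g' \<in> borel_measurable M'" "X' \<in> borel_measurable M'"
    and g: "\<And>t \<omega>. \<bar>g t \<omega>\<bar> \<le> (1::real)" "\<And>\<omega>. \<bar>g' \<omega>\<bar> \<le> (1::real)"
    and c1: "\<And>a. (\<lambda>t. \<integral>\<omega>. iexp (a * X t \<omega>) \<partial>M t) \<longlonglongrightarrow> (\<integral>\<omega>. iexp (a * X' \<omega>) \<partial>M')"
    and c2: "\<And>a. (\<lambda>t. \<integral>\<omega>. g t \<omega> * iexp (a * X t \<omega>) \<partial>M t) \<longlonglongrightarrow> (\<integral>\<omega>. g' \<omega> * iexp (a * X' \<omega>) \<partial>M')"
    and hc: "\<And>x. isCont h x" and h: "\<And>x. \<bar>h x :: real\<bar> \<le> 1"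
  shows "(\<lambda>t. \<integral>\<omega>. g t \<omega> * h (X t \<omega>) \<partial>M t) \<longlonglongrightarrow> (\<integral>\<omega>. g' \<omega> * h (X' \<omega>) \<partial>M')"
proof -
  interpret M: prob_space "M t" for t by fact
  interpret M': prob_space M' by fact
  have [measurable]: "h \<in> borel_measurable borel"
    using hc by (intro borel_measurable_continuous_onI) (simp add: continuous_at_imp_continuous_on)
  \<comment> \<open>Stated for a general weight \<open>k\<close> because it is applied twice, to
    \<open>g\<close> and to 0; the difference isolates the weighted integral.\<close>
  have key: "(\<lambda>t. 2 * (\<integral>\<omega>. h (X t \<omega>) \<partial>M t) + (\<integral>\<omega>. k t \<omega> * h (X t \<omega>) \<partial>M t)) \<longlonglongrightarrow>
       2 * (\<integral>\<omega>. h (X' \<omega>) \<partial>M') + (\<integral>\<omega>. k' \<omega> * h (X' \<omega>) \<partial>M')"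
    if [measurable]: "\<And>t. k t \<in> borel_measurable (M t)" "k' \<in> borel_measurable M'"
     and k: "\<And>t \<omega>. \<bar>k t \<omega>\<bar> \<le> (1::real)" "\<And>\<omega>. \<bar>k' \<omega>\<bar> \<le> (1::real)"
     and c: "\<And>a. (\<lambda>t. \<integral>\<omega>. k t \<omega> * iexp (a * X t \<omega>) \<partial>M t) \<longlonglongrightarrow> (\<integral>\<omega>. k' \<omega> * iexp (a * X' \<omega>) \<partial>M')" for k k'
  proof -
    have "(\<lambda>t. complex_of_real (M.expectation t (k t))) \<longlonglongrightarrow> complex_of_real (M'.expectation k')"
      using c[of 0] by simp
    then have e: "(\<lambda>t. M.expectation t (k t)) \<longlonglongrightarrow> M'.expectation k'"
      using tendsto_Re by fastforce
    have pos: "2 + M'.expectation k' > 0" by (rule M'.tilt_norm_pos) (use k in auto)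
    then have pos': "complex_of_real (2 + M'.expectation k') \<noteq> 0" by (metis less_irrefl of_real_eq_0_iff)
    have "weak_conv_m (\<lambda>t. tilt (M t) (X t) (k t)) (tilt M' X' k')"
    proof (rule levy_continuity)
      fix a
      show "(\<lambda>t. char (tilt (M t) (X t) (k t)) a) \<longlonglongrightarrow> char (tilt M' X' k') a"
        using pos' by (simp add: M.char_tilt M'.char_tilt k del: of_real_mult)
          (intro tendsto_divide tendsto_add tendsto_mult tendsto_const tendsto_of_real e c1 c)
    qed (use k in \<open>auto intro!: M.tilt_real_distribution M'.tilt_real_distribution\<close>)
    then have "(\<lambda>t. \<integral>x. h x \<partial>tilt (M t) (X t) (k t)) \<longlonglongrightarrow> (\<integral>x. h x \<partial>tilt M' X' k')"
      by (intro weak_conv_imp_integral_bdd_continuous_conv[where B = 1])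
         (use k hc h in \<open>auto intro!: M.tilt_real_distribution M'.tilt_real_distribution\<close>)
    then have "(\<lambda>t. (2 + M.expectation t (k t)) *\<^sub>R (\<integral>x. h x \<partial>tilt (M t) (X t) (k t))) \<longlonglongrightarrow>
       (2 + M'.expectation k') *\<^sub>R (\<integral>x. h x \<partial>tilt M' X' k')"
      by (intro tendsto_intros e)
    moreover have "(2 + M.expectation t (k t)) *\<^sub>R (\<integral>x. h x \<partial>tilt (M t) (X t) (k t)) =
       2 *\<^sub>R (\<integral>\<omega>. h (X t \<omega>) \<partial>M t) + (\<integral>\<omega>. k t \<omega> *\<^sub>R h (X t \<omega>) \<partial>M t)" for t
      by (rule M.tilt_integral[of _ _ _ _ 1]) (use k h in auto)
    moreover have "(2 + M'.expectation k') *\<^sub>R (\<integral>x. h x \<partial>tilt M' X' k') =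
       2 *\<^sub>R (\<integral>\<omega>. h (X' \<omega>) \<partial>M') + (\<integral>\<omega>. k' \<omega> *\<^sub>R h (X' \<omega>) \<partial>M')"
      by (rule M'.tilt_integral[of _ _ _ 1]) (use k h in auto)
    ultimately show ?thesis by simp
  qed
  have "(\<lambda>t. 2 * (\<integral>\<omega>. h (X t \<omega>) \<partial>M t) + (\<integral>\<omega>. 0 * h (X t \<omega>) \<partial>M t)) \<longlonglongrightarrow>
       2 * (\<integral>\<omega>. h (X' \<omega>) \<partial>M') + (\<integral>\<omega>. 0 * h (X' \<omega>) \<partial>M')"
    by (rule key) auto
  from tendsto_diff[OF key[of g g'] this] show ?thesis
    using g c2 by simp
qed

text \<open>One coordinate at a time, the exponential factor is replaced by a test function. The filter
  \<open>F\<close> covers both the uniqueness theorem (trivial filter) and the continuity theorem.\<close>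

lemma char_conv_product:
  fixes M :: "'i \<Rightarrow> 'a measure" and M' :: "'b measure" and X :: "'i \<Rightarrow> 'j \<Rightarrow> 'a \<Rightarrow> real"
  assumes ps: "\<And>t. prob_space (M t)" "prob_space M'" and I: "finite I"
    and [measurable]: "\<And>t i. i \<in> I \<Longrightarrow> X t i \<in> borel_measurable (M t)" "\<And>i. i \<in> I \<Longrightarrow> X' i \<in> borel_measurable M'"
    and [measurable]: "\<And>i. h i \<in> borel_measurable borel" and h: "\<And>i x. \<bar>h i x :: real\<bar> \<le> 1"
    and step: "\<And>j g g'. j \<in> I \<Longrightarrow> (\<And>t. g t \<in> borel_measurable (M t)) \<Longrightarrow> g' \<in> borel_measurable M'
      \<Longrightarrow> (\<And>t \<omega>. \<bar>g t \<omega> :: real\<bar> \<le> 1) \<Longrightarrow> (\<And>\<omega>. \<bar>g' \<omega> :: real\<bar> \<le> 1)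
      \<Longrightarrow> (\<And>a. ((\<lambda>t. \<integral>\<omega>. iexp (a * X t j \<omega>) \<partial>M t) \<longlongrightarrow> (\<integral>\<omega>. iexp (a * X' j \<omega>) \<partial>M')) F)
      \<Longrightarrow> (\<And>a. ((\<lambda>t. \<integral>\<omega>. g t \<omega> * iexp (a * X t j \<omega>) \<partial>M t) \<longlongrightarrow> (\<integral>\<omega>. g' \<omega> * iexp (a * X' j \<omega>) \<partial>M')) F)
      \<Longrightarrow> ((\<lambda>t. \<integral>\<omega>. g t \<omega> * h j (X t j \<omega>) \<partial>M t) \<longlongrightarrow> (\<integral>\<omega>. g' \<omega> * h j (X' j \<omega>) \<partial>M')) F"
    and char: "\<And>a. ((\<lambda>t. \<integral>\<omega>. iexp (\<Sum>i\<in>I. a i * X t i \<omega>) \<partial>M t) \<longlongrightarrow> (\<integral>\<omega>. iexp (\<Sum>i\<in>I. a i * X' i \<omega>) \<partial>M')) F"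
  shows "((\<lambda>t. \<integral>\<omega>. (\<Prod>i\<in>I. h i (X t i \<omega>)) \<partial>M t) \<longlongrightarrow> (\<integral>\<omega>. (\<Prod>i\<in>I. h i (X' i \<omega>)) \<partial>M')) F"
proof -
  interpret M: prob_space "M t" for t by fact
  interpret M': prob_space M' by fact
  have char1: "((\<lambda>t. \<integral>\<omega>. iexp (a * X t j \<omega>) \<partial>M t) \<longlongrightarrow> (\<integral>\<omega>. iexp (a * X' j \<omega>) \<partial>M')) F" if j: "j \<in> I" for j a
  proof -
    have "(\<Sum>i\<in>I. (if i = j then a else 0) * x i) = a * x j" for x :: "'j \<Rightarrow> real"
      using j I by (simp add: if_distrib[of "\<lambda>z. z * _"] cong: if_cong)
    then show ?thesis using char[of "\<lambda>i. if i = j then a else 0"] by simp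
  qed
  \<comment> \<open>\<open>step\<close> accepts real weights only. The real and imaginary parts of a
    complex weight \<open>g\<close> are combinations of \<open>g\<close> and \<open>cnj g\<close>,
    hence the second hypothesis, on the conjugate.\<close>
  have cstep: "((\<lambda>t. \<integral>\<omega>. g t \<omega> * complex_of_real (h j (X t j \<omega>)) \<partial>M t) \<longlongrightarrow> (\<integral>\<omega>. g' \<omega> * complex_of_real (h j (X' j \<omega>)) \<partial>M')) F"
    if j: "j \<in> I" and gm[measurable]: "\<And>t. g t \<in> borel_measurable (M t)" "g' \<in> borel_measurable M'"
      and g: "\<And>t \<omega>. cmod (g t \<omega>) \<le> 1" "\<And>\<omega>. cmod (g' \<omega>) \<le> 1"
      and c: "\<And>a. ((\<lambda>t. \<integral>\<omega>. g t \<omega> * iexp (a * X t j \<omega>) \<partial>M t) \<longlongrightarrow> (\<integral>\<omega>. g' \<omega> * iexp (a * X' j \<omega>) \<partial>M')) F"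
         "\<And>a. ((\<lambda>t. \<integral>\<omega>. cnj (g t \<omega>) * iexp (a * X t j \<omega>) \<partial>M t) \<longlongrightarrow> (\<integral>\<omega>. cnj (g' \<omega>) * iexp (a * X' j \<omega>) \<partial>M')) F"
    for j g g'
  proof -
    note [measurable] = assms(4)[OF j] assms(5)[OF j]
    have [measurable]: "cnj \<in> borel_measurable borel"
      by (intro borel_measurable_continuous_onI continuous_intros)
    have iM: "integrable (M t) (\<lambda>\<omega>. f \<omega> * k \<omega>)" 
      if "\<And>\<omega>. cmod (f \<omega>) \<le> 1" "\<And>\<omega>. cmod (k \<omega>) \<le> 1" "f \<in> borel_measurable (M t)" "k \<in> borel_measurable (M t)" for t f k
      using that by (intro M.integrable_const_bound[of _ 1]) (auto simp: norm_mult intro!: mult_le_one)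
    have iM': "integrable M' (\<lambda>\<omega>. f \<omega> * k \<omega>)" 
      if "\<And>\<omega>. cmod (f \<omega>) \<le> 1" "\<And>\<omega>. cmod (k \<omega>) \<le> 1" "f \<in> borel_measurable M'" "k \<in> borel_measurable M'" for f k
      using that by (intro M'.integrable_const_bound[of _ 1]) (auto simp: norm_mult intro!: mult_le_one)
    have re: "complex_of_real (Re z) = (z + cnj z) / 2" and im: "complex_of_real (Im z) = (z - cnj z) / (2 * \<i>)" for z
      by (auto simp: complex_eq_iff)
    have eR: "(\<integral>\<omega>. Re (g t \<omega>) * iexp (a * X t j \<omega>) \<partial>M t) =
       ((\<integral>\<omega>. g t \<omega> * iexp (a * X t j \<omega>) \<partial>M t) + (\<integral>\<omega>. cnj (g t \<omega>) * iexp (a * X t j \<omega>) \<partial>M t)) / 2" for a t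
      unfolding re
      by (subst Bochner_Integration.integral_add[symmetric])
         (auto intro!: iM g simp: field_simps simp flip: Bochner_Integration.integral_divide_zero)
    have eR': "(\<integral>\<omega>. Re (g' \<omega>) * iexp (a * X' j \<omega>) \<partial>M') =
       ((\<integral>\<omega>. g' \<omega> * iexp (a * X' j \<omega>) \<partial>M') + (\<integral>\<omega>. cnj (g' \<omega>) * iexp (a * X' j \<omega>) \<partial>M')) / 2" for a
      unfolding re
      by (subst Bochner_Integration.integral_add[symmetric])
         (auto intro!: iM' g simp: field_simps simp flip: Bochner_Integration.integral_divide_zero)
    have R: "((\<lambda>t. \<integral>\<omega>. Re (g t \<omega>) * h j (X t j \<omega>) \<partial>M t) \<longlongrightarrow> (\<integral>\<omega>. Re (g' \<omega>) * h j (X' j \<omega>) \<partial>M')) F"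
    proof (rule step[OF j])
      show "((\<lambda>t. \<integral>\<omega>. Re (g t \<omega>) * iexp (a * X t j \<omega>) \<partial>M t) \<longlongrightarrow> (\<integral>\<omega>. Re (g' \<omega>) * iexp (a * X' j \<omega>) \<partial>M')) F" for a
        unfolding eR eR' by (intro tendsto_divide tendsto_add tendsto_const c) simp
    qed (auto intro: char1[OF j] order_trans[OF abs_Re_le_cmod] g simp del: of_real_mult)
    have eI: "(\<integral>\<omega>. Im (g t \<omega>) * iexp (a * X t j \<omega>) \<partial>M t) =
       ((\<integral>\<omega>. g t \<omega> * iexp (a * X t j \<omega>) \<partial>M t) - (\<integral>\<omega>. cnj (g t \<omega>) * iexp (a * X t j \<omega>) \<partial>M t)) / (2 * \<i>)" for a t
      unfolding im
      by (subst Bochner_Integration.integral_diff[symmetric])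
         (auto intro!: iM g simp: field_simps simp flip: Bochner_Integration.integral_divide_zero)
    have eI': "(\<integral>\<omega>. Im (g' \<omega>) * iexp (a * X' j \<omega>) \<partial>M') =
       ((\<integral>\<omega>. g' \<omega> * iexp (a * X' j \<omega>) \<partial>M') - (\<integral>\<omega>. cnj (g' \<omega>) * iexp (a * X' j \<omega>) \<partial>M')) / (2 * \<i>)" for a
      unfolding im
      by (subst Bochner_Integration.integral_diff[symmetric])
         (auto intro!: iM' g simp: field_simps simp flip: Bochner_Integration.integral_divide_zero)
    have I: "((\<lambda>t. \<integral>\<omega>. Im (g t \<omega>) * h j (X t j \<omega>) \<partial>M t) \<longlongrightarrow> (\<integral>\<omega>. Im (g' \<omega>) * h j (X' j \<omega>) \<partial>M')) F"
    proof (rule step[OF j])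
      show "((\<lambda>t. \<integral>\<omega>. Im (g t \<omega>) * iexp (a * X t j \<omega>) \<partial>M t) \<longlongrightarrow> (\<integral>\<omega>. Im (g' \<omega>) * iexp (a * X' j \<omega>) \<partial>M')) F" for a
        unfolding eI eI' by (intro tendsto_divide tendsto_diff tendsto_const c) simp
    qed (auto intro: char1[OF j] order_trans[OF abs_Im_le_cmod] g simp del: of_real_mult)
    have 1: "(\<integral>\<omega>. g t \<omega> * complex_of_real (h j (X t j \<omega>)) \<partial>M t)
      = complex_of_real (\<integral>\<omega>. Re (g t \<omega>) * h j (X t j \<omega>) \<partial>M t) + \<i> * complex_of_real (\<integral>\<omega>. Im (g t \<omega>) * h j (X t j \<omega>) \<partial>M t)" for t
    proof -
      have "integrable (M t) (\<lambda>\<omega>. g t \<omega> * complex_of_real (h j (X t j \<omega>)))" by (intro iM) (auto simp: g h)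
      from integral_Re[OF this] integral_Im[OF this] show ?thesis
        by (auto simp: complex_eq_iff)
    qed
    have 2: "(\<integral>\<omega>. g' \<omega> * complex_of_real (h j (X' j \<omega>)) \<partial>M')
       = complex_of_real (\<integral>\<omega>. Re (g' \<omega>) * h j (X' j \<omega>) \<partial>M') + \<i> * complex_of_real (\<integral>\<omega>. Im (g' \<omega>) * h j (X' j \<omega>) \<partial>M')"
    proof -
      have "integrable M' (\<lambda>\<omega>. g' \<omega> * complex_of_real (h j (X' j \<omega>)))" by (intro iM') (auto simp: g h)
      from integral_Re[OF this] integral_Im[OF this] show ?thesis
        by (auto simp: complex_eq_iff)
    qed
    show ?thesis unfolding 1 2 by (intro tendsto_intros R I)
  qed
  \<comment> \<open>Coordinates in \<open>J\<close> already carry test functions, the others still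
    carry exponentials. Quantifying over all frequencies \<open>a\<close> in the induction
    hypothesis gives access to the negated ones below.\<close>
  have "\<forall>a. ((\<lambda>t. \<integral>\<omega>. complex_of_real (\<Prod>i\<in>J. h i (X t i \<omega>)) * iexp (\<Sum>i\<in>I-J. a i * X t i \<omega>) \<partial>M t) \<longlongrightarrow>
      (\<integral>\<omega>. complex_of_real (\<Prod>i\<in>J. h i (X' i \<omega>)) * iexp (\<Sum>i\<in>I-J. a i * X' i \<omega>) \<partial>M')) F"
    if "finite J" "J \<subseteq> I" for J using that
  proof (induction J rule: finite_induct)
    case empty
    then show ?case using char by simp
  next
    case (insert j J)
    then have j: "j \<in> I" "J \<subseteq> I" by auto
    note IH = insert.IH[OF j(2), rule_format]
    have [measurable]: "\<And>i t. i \<in> J \<Longrightarrow> X t i \<in> borel_measurable (M t)" "\<And>i. i \<in> J \<Longrightarrow> X' i \<in> borel_measurable M'"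
      using j by auto
    have split: "I - J = insert j (I - insert j J)" "j \<notin> I - insert j J" "finite (I - insert j J)" using insert j I by auto
    show ?case
    proof
      fix a
      define g where "g t \<omega> = complex_of_real (\<Prod>i\<in>J. h i (X t i \<omega>)) * iexp (\<Sum>i\<in>I-insert j J. a i * X t i \<omega>)" for t \<omega>
      define g' where "g' \<omega> = complex_of_real (\<Prod>i\<in>J. h i (X' i \<omega>)) * iexp (\<Sum>i\<in>I-insert j J. a i * X' i \<omega>)" for \<omega>
      have bd: "\<bar>\<Prod>i\<in>J. h i (x i)\<bar> \<le> 1" for x
        unfolding abs_prod by (rule prod_le_1) (auto simp: h)
      have e: "iexp (x + b) = iexp b * iexp x" for x b by (simp add: algebra_simps exp_add)
      have cn: "cnj (iexp x) = iexp (- x)" for x by (simp add: exp_cnj)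
      have "((\<lambda>t. \<integral>\<omega>. g t \<omega> * complex_of_real (h j (X t j \<omega>)) \<partial>M t) \<longlongrightarrow> (\<integral>\<omega>. g' \<omega> * complex_of_real (h j (X' j \<omega>)) \<partial>M')) F"
      proof (rule cstep[OF j(1)])
        show "g t \<in> borel_measurable (M t)" for t unfolding g_def by measurable
        show "g' \<in> borel_measurable M'" unfolding g'_def by measurable
        show "cmod (g t \<omega>) \<le> 1" for t \<omega> using bd by (simp add: g_def norm_mult del: of_real_prod of_real_sum)
        show "cmod (g' \<omega>) \<le> 1" for \<omega> using bd by (simp add: g'_def norm_mult del: of_real_prod of_real_sum)
        fix b
        have eq: "(\<Sum>i\<in>I-J. (a(j:=b)) i * x i) = b * x j + (\<Sum>i\<in>I-insert j J. a i * x i)" for x :: "'j \<Rightarrow> real"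
          unfolding split(1) using split(2,3) by (auto intro!: sum.cong)
        \<comment> \<open>The test functions are real, so conjugating \<open>g\<close> only negates
          the frequencies of the coordinates still to be treated.\<close>
        have eq2: "(\<Sum>i\<in>I-J. ((\<lambda>i. - a i)(j:=b)) i * x i) = b * x j + - (\<Sum>i\<in>I-insert j J. a i * x i)" for x :: "'j \<Rightarrow> real"
          unfolding split(1) using split(2,3) by (auto intro!: sum.cong simp flip: sum_negf)
        show "((\<lambda>t. \<integral>\<omega>. g t \<omega> * iexp (b * X t j \<omega>) \<partial>M t) \<longlongrightarrow> (\<integral>\<omega>. g' \<omega> * iexp (b * X' j \<omega>) \<partial>M')) F"
          using IH[of "a(j:=b)"] unfolding eq e g_def g'_def by (simp add: mult.assoc)
        show "((\<lambda>t. \<integral>\<omega>. cnj (g t \<omega>) * iexp (b * X t j \<omega>) \<partial>M t) \<longlongrightarrow> (\<integral>\<omega>. cnj (g' \<omega>) * iexp (b * X' j \<omega>) \<partial>M')) F"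
          using IH[of "(\<lambda>i. - a i)(j:=b)"] unfolding eq2 e g_def g'_def complex_cnj_mult cn by (simp add: mult.assoc)
      qed
      then show "((\<lambda>t. \<integral>\<omega>. complex_of_real (\<Prod>i\<in>insert j J. h i (X t i \<omega>)) * iexp (\<Sum>i\<in>I-insert j J. a i * X t i \<omega>) \<partial>M t) \<longlongrightarrow>
      (\<integral>\<omega>. complex_of_real (\<Prod>i\<in>insert j J. h i (X' i \<omega>)) * iexp (\<Sum>i\<in>I-insert j J. a i * X' i \<omega>) \<partial>M')) F"
        using insert.hyps by (simp add: g_def g'_def mult_ac)
    qed
  qed
  from this[of I] I have "((\<lambda>t. complex_of_real (\<integral>\<omega>. (\<Prod>i\<in>I. h i (X t i \<omega>)) \<partial>M t)) \<longlongrightarrow>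
      complex_of_real (\<integral>\<omega>. (\<Prod>i\<in>I. h i (X' i \<omega>)) \<partial>M')) F"
    by (simp del: of_real_prod)
  from tendsto_Re[OF this] show ?thesis by (simp del: of_real_prod)
qed

text \<open>A constant family over \<open>unit\<close> with a principal filter turns limits into
  equalities, so that \<open>char_conv_product\<close> compares the integrals of indicator functions
  of boxes, and boxes determine a measure on a finite product.\<close>

theorem char_unique_PiM:
  fixes M :: "'a measure" and M' :: "'b measure" and X :: "'j \<Rightarrow> 'a \<Rightarrow> real"
  assumes ps: "prob_space M" "prob_space M'" and I: "finite I"
    and X: "\<And>i. i \<in> I \<Longrightarrow> X i \<in> borel_measurable M" "\<And>i. i \<in> I \<Longrightarrow> X' i \<in> borel_measurable M'"
    and char: "\<And>a. (\<integral>\<omega>. iexp (\<Sum>i\<in>I. a i * X i \<omega>) \<partial>M) = (\<integral>\<omega>. iexp (\<Sum>i\<in>I. a i * X' i \<omega>) \<partial>M')"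
  shows "distr M (Pi\<^sub>M I (\<lambda>_. borel)) (\<lambda>\<omega>. \<lambda>i\<in>I. X i \<omega>) = distr M' (Pi\<^sub>M I (\<lambda>_. borel)) (\<lambda>\<omega>. \<lambda>i\<in>I. X' i \<omega>)"
    (is "?P = ?Q")
proof (rule measure_eqI_PiM_finite[OF I])
  interpret M: prob_space M by fact
  interpret M': prob_space M' by fact
  note [measurable] = X
  fix A :: "'j \<Rightarrow> real set" assume A: "\<And>i. i \<in> I \<Longrightarrow> A i \<in> sets borel"
  \<comment> \<open>Set to 0 outside \<open>I\<close> because test functions must be measurable for
    every index, while \<open>A i\<close> is measurable only for \<open>i \<in> I\<close>.\<close>
  define h :: "'j \<Rightarrow> real \<Rightarrow> real" where "h i = (if i \<in> I then indicator (A i) else (\<lambda>_. 0))" for i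
  have hm: "h i \<in> borel_measurable borel" for i using A by (auto simp: h_def)
  have "((\<lambda>t::unit. \<integral>\<omega>. (\<Prod>i\<in>I. h i (X i \<omega>)) \<partial>M) \<longlongrightarrow> (\<integral>\<omega>. (\<Prod>i\<in>I. h i (X' i \<omega>)) \<partial>M')) (principal {()})"
  proof (rule char_conv_product[of "\<lambda>_. M" M' I "\<lambda>_. X" X' h])
    fix j and g :: "unit \<Rightarrow> 'a \<Rightarrow> real" and g' :: "'b \<Rightarrow> real"
    assume *: "j \<in> I" "\<And>t. g t \<in> borel_measurable M" "g' \<in> borel_measurable M'"
      "\<And>t \<omega>. \<bar>g t \<omega>\<bar> \<le> 1" "\<And>\<omega>. \<bar>g' \<omega>\<bar> \<le> 1"
      "\<And>a. ((\<lambda>t::unit. \<integral>\<omega>. iexp (a * X j \<omega>) \<partial>M) \<longlongrightarrow> (\<integral>\<omega>. iexp (a * X' j \<omega>) \<partial>M')) (principal {()})"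
      "\<And>a. ((\<lambda>t::unit. \<integral>\<omega>. g t \<omega> * iexp (a * X j \<omega>) \<partial>M) \<longlongrightarrow> (\<integral>\<omega>. g' \<omega> * iexp (a * X' j \<omega>) \<partial>M')) (principal {()})"
    have "(\<integral>\<omega>. g () \<omega> * h j (X j \<omega>) \<partial>M) = (\<integral>\<omega>. g' \<omega> * h j (X' j \<omega>) \<partial>M')"
    proof (rule tilt_levy_unique[OF ps, where h = "h j" and g = "g ()" and X = "X j" and X' = "X' j" and g' = g'])
      show "(\<integral>\<omega>. iexp (a * X j \<omega>) \<partial>M) = (\<integral>\<omega>. iexp (a * X' j \<omega>) \<partial>M')" for a
        by (rule tendsto_unique[OF _ tendsto_principal_singleton *(6)]) (simp add: principal_eq_bot_iff)
      show "(\<integral>\<omega>. g () \<omega> * iexp (a * X j \<omega>) \<partial>M) = (\<integral>\<omega>. g' \<omega> * iexp (a * X' j \<omega>) \<partial>M')" for a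
        by (rule tendsto_unique[OF _ tendsto_principal_singleton *(7)]) (simp add: principal_eq_bot_iff)
      show "h j \<in> borel_measurable borel" by (rule hm)
    qed (use * X in \<open>auto simp: h_def\<close>)
    then show "((\<lambda>t. \<integral>\<omega>. g t \<omega> * h j (X j \<omega>) \<partial>M) \<longlongrightarrow> (\<integral>\<omega>. g' \<omega> * h j (X' j \<omega>) \<partial>M')) (principal {()})"
      using tendsto_principal_singleton[of "\<lambda>t. \<integral>\<omega>. g t \<omega> * h j (X j \<omega>) \<partial>M" "()"] by simp
  qed (use ps I X hm char in \<open>auto simp: h_def\<close>)
  then have eq: "(\<integral>\<omega>. (\<Prod>i\<in>I. h i (X i \<omega>)) \<partial>M) = (\<integral>\<omega>. (\<Prod>i\<in>I. h i (X' i \<omega>)) \<partial>M')"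
    by (intro tendsto_unique[OF _ tendsto_principal_singleton]) (simp_all add: principal_eq_bot_iff)
  have ind: "(\<Prod>i\<in>I. h i (x i)) = (indicator (Pi\<^sub>E I A) (restrict x I) :: real)" for x
  proof (cases "restrict x I \<in> Pi\<^sub>E I A")
    case False
    then obtain i where "i \<in> I" "x i \<notin> A i" by (auto simp: PiE_iff)
    then have "(\<Prod>i\<in>I. h i (x i)) = 0" using I by (intro prod_zero bexI[of _ i]) (auto simp: h_def)
    with False show ?thesis by simp
  qed (auto simp: h_def PiE_iff)
  have PA: "Pi\<^sub>E I A \<in> sets (Pi\<^sub>M I (\<lambda>_. borel))" using A I by (intro sets_PiM_I_finite) auto
  have "measure ?P (Pi\<^sub>E I A) = (\<integral>\<omega>. (\<Prod>i\<in>I. h i (X i \<omega>)) \<partial>M)"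
    unfolding ind using PA
    by (subst integral_distr[symmetric, where N = "Pi\<^sub>M I (\<lambda>_. borel)" and g = "\<lambda>\<omega>. restrict (\<lambda>i. X i \<omega>) I" and f = "indicator (Pi\<^sub>E I A)"])
       (auto intro!: measurable_restrict)
  also have "\<dots> = measure ?Q (Pi\<^sub>E I A)"
    unfolding eq unfolding ind using PA
    by (subst integral_distr[symmetric, where N = "Pi\<^sub>M I (\<lambda>_. borel)" and g = "\<lambda>\<omega>. restrict (\<lambda>i. X' i \<omega>) I" and f = "indicator (Pi\<^sub>E I A)"])
       (auto intro!: measurable_restrict)
  finally have meq: "measure ?P (Pi\<^sub>E I A) = measure ?Q (Pi\<^sub>E I A)" .
  interpret P: prob_space ?P by (rule M.prob_space_distr) (auto intro!: measurable_restrict)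
  interpret Q: prob_space ?Q by (rule M'.prob_space_distr) (auto intro!: measurable_restrict)
  show "emeasure ?P (Pi\<^sub>E I A) = emeasure ?Q (Pi\<^sub>E I A)"
    using meq by (simp add: P.emeasure_eq_measure Q.emeasure_eq_measure)
next
  interpret M: prob_space M by fact
  interpret P: prob_space ?P by (rule M.prob_space_distr) (auto intro!: measurable_restrict X)
  show "range (\<lambda>n::nat. Pi\<^sub>E I (\<lambda>_. UNIV)) \<subseteq> prod_algebra I (\<lambda>_. borel)"
    using I by (auto intro!: prod_algebraI_finite)
  show "(\<Union>i::nat. Pi\<^sub>E I (\<lambda>_. UNIV)) = space (Pi\<^sub>M I (\<lambda>_. borel))" by (simp add: space_PiM)
  show "emeasure ?P (Pi\<^sub>E I (\<lambda>_. UNIV)) \<noteq> \<infinity>" by (simp add: P.emeasure_eq_measure)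
qed auto

section \<open>Sums of products of one-variable functions, and cutoffs\<close>

inductive product_span :: "(real^'p::finite \<Rightarrow> real) \<Rightarrow> bool" where
  product: "(\<And>i. continuous_on UNIV (h i)) \<Longrightarrow> product_span (\<lambda>x. \<Prod>i\<in>UNIV. h i (x $ i))"
| add: "product_span f \<Longrightarrow> product_span g \<Longrightarrow> product_span (\<lambda>x. f x + g x)"

lemma product_span_continuous: "product_span f \<Longrightarrow> continuous_on S f"
proof (induction rule: product_span.induct)
  case (product h)
  show ?case
    by (intro continuous_on_prod continuous_on_compose2[OF product] continuous_intros) auto
qed (intro continuous_intros)

text \<open>Closure under multiplication makes the span an algebra, as Stone-Weierstrass requires.
  Scalar multiples are covered as well, a constant being itself a product.\<close>

lemma product_span_mult:
  assumes "product_span f" "product_span g"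
  shows "product_span (\<lambda>x. f x * g x)"
  using assms
proof (induction arbitrary: g rule: product_span.induct)
  case (product h)
  from product(2) product(1) show ?case
  proof (induction rule: product_span.induct)
    case (product k)
    then show ?case
      by (auto simp flip: prod.distrib intro!: product_span.product[of "\<lambda>i x. h i x * k i x"] continuous_intros)
  next
    case (add f g)
    have "product_span (\<lambda>x. (\<Prod>i\<in>UNIV. h i (x $ i)) * f x + (\<Prod>i\<in>UNIV. h i (x $ i)) * g x)"
      by (rule product_span.add) (use add in blast)+
    then show ?case by (simp add: distrib_left)
  qed
next
  case (add f1 f2)
  have "product_span (\<lambda>x. f1 x * g x + f2 x * g x)"
    by (rule product_span.add) (use add in blast)+
  then show ?case by (simp add: distrib_right)
qed

lemma product_span_coord: 
  assumes "continuous_on UNIV k"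
  shows "product_span (\<lambda>x. k (x $ i))"
proof -
  have "product_span (\<lambda>x. \<Prod>j\<in>UNIV. (if j = i then k else (\<lambda>_. 1)) (x $ j))"
    by (rule product_span.product) (use assms in auto)
  also have "(\<lambda>x. \<Prod>j\<in>UNIV. (if j = i then k else (\<lambda>_. 1)) (x $ j)) = (\<lambda>x. k (x $ i))"
    by (simp add: if_distrib[of "\<lambda>f. f _"] cong: if_cong)
  finally show ?thesis .
qed

definition cutoff :: "real \<Rightarrow> real \<Rightarrow> real" where
  "cutoff R s = max 0 (min 1 (R + 1 - \<bar>s\<bar>))"

text \<open>A product over the coordinates rather than a function of the norm, so that a product
  test function times the cutoff is again a product of one-variable functions.\<close>

definition cutoff_vec :: "real \<Rightarrow> real^'p::finite \<Rightarrow> real" where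
  "cutoff_vec R x = (\<Prod>i\<in>UNIV. cutoff R (x $ i))"

lemma continuous_cutoff: "continuous_on S (cutoff R)"
  unfolding cutoff_def by (intro continuous_intros)

lemma continuous_cutoff_vec: "continuous_on S (cutoff_vec R)"
  unfolding cutoff_vec_def
  by (intro continuous_on_prod continuous_on_compose2[OF continuous_cutoff[of UNIV]] continuous_intros) auto

lemma cutoff_vec_bounds: "0 \<le> cutoff_vec R x" "cutoff_vec R x \<le> 1"
  unfolding cutoff_vec_def cutoff_def by (auto intro!: prod_nonneg prod_le_1)

lemma cutoff_vec_eq_1: "(\<And>i. \<bar>x $ i\<bar> \<le> R) \<Longrightarrow> cutoff_vec R x = 1"
  unfolding cutoff_vec_def cutoff_def by (intro prod.neutral) (auto simp: algebra_simps min_def max_def)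

lemma cutoff_vec_eq_0: "\<bar>x $ i\<bar> > R + 1 \<Longrightarrow> cutoff_vec R x = 0"
  unfolding cutoff_vec_def cutoff_def by (intro prod_zero) (auto intro!: exI[of _ i])

text \<open>The mass lost by truncation is bounded through the expectation of the cutoff, itself a
  compactly supported continuous test function; this is how tightness is obtained below.\<close>

lemma (in prob_space) cutoff_vec_approx:
  fixes f :: "real^'p::finite \<Rightarrow> real"
  assumes fm: "f \<in> borel_measurable borel" and B: "\<And>x. \<bar>f x\<bar> \<le> B" and [measurable]: "V \<in> borel_measurable M"
  shows "\<bar>(\<integral>\<omega>. f (V \<omega>) \<partial>M) - (\<integral>\<omega>. f (V \<omega>) * cutoff_vec R (V \<omega>) \<partial>M)\<bar> \<le> B * (1 - (\<integral>\<omega>. cutoff_vec R (V \<omega>) \<partial>M))"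
proof -
  note [measurable] = fm borel_measurable_continuous_onI[OF continuous_cutoff_vec[of UNIV]]
  have B0: "B \<ge> 0" using B abs_ge_zero order_trans by blast
  have i1: "integrable M (\<lambda>\<omega>. f (V \<omega>))" by (rule integrable_const_bound[of _ B]) (auto simp: B)
  have i2: "integrable M (\<lambda>\<omega>. cutoff_vec R (V \<omega>))" 
    by (rule integrable_const_bound[of _ 1]) (auto simp: cutoff_vec_bounds)
  have i3: "integrable M (\<lambda>\<omega>. f (V \<omega>) * cutoff_vec R (V \<omega>))" 
    using mult_mono[OF B cutoff_vec_bounds(2)] B0
    by (intro integrable_const_bound[of _ B] AE_I2) (simp_all add: cutoff_vec_bounds abs_mult)
  have "\<bar>(\<integral>\<omega>. f (V \<omega>) \<partial>M) - (\<integral>\<omega>. f (V \<omega>) * cutoff_vec R (V \<omega>) \<partial>M)\<bar>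
    = \<bar>\<integral>\<omega>. f (V \<omega>) * (1 - cutoff_vec R (V \<omega>)) \<partial>M\<bar>"
    using i1 i3 by (simp add: algebra_simps)
  also have "\<dots> \<le> (\<integral>\<omega>. \<bar>f (V \<omega>) * (1 - cutoff_vec R (V \<omega>))\<bar> \<partial>M)" by (rule integral_abs_bound)
  also have "\<dots> \<le> (\<integral>\<omega>. B * (1 - cutoff_vec R (V \<omega>)) \<partial>M)"
  proof (rule integral_mono)
    have "(\<lambda>\<omega>. f (V \<omega>) * (1 - cutoff_vec R (V \<omega>))) = (\<lambda>\<omega>. f (V \<omega>) - f (V \<omega>) * cutoff_vec R (V \<omega>))"
      by (simp add: right_diff_distrib)
    then show "integrable M (\<lambda>\<omega>. \<bar>f (V \<omega>) * (1 - cutoff_vec R (V \<omega>))\<bar>)" using i1 i3 by simp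
    show "integrable M (\<lambda>\<omega>. B * (1 - cutoff_vec R (V \<omega>)))" using i2 by simp
    show "\<bar>f (V \<omega>) * (1 - cutoff_vec R (V \<omega>))\<bar> \<le> B * (1 - cutoff_vec R (V \<omega>))" for \<omega>
      unfolding abs_mult by (intro mult_mono) (use B B0 cutoff_vec_bounds[of R "V \<omega>"] in auto)
  qed
  also have "\<dots> = B * (1 - (\<integral>\<omega>. cutoff_vec R (V \<omega>) \<partial>M))"
    using i2 by (simp add: prob_space)
  finally show ?thesis .
qed

lemma (in prob_space) expectation_uniform_approx:
  fixes f g :: "'b::topological_space \<Rightarrow> real"
  assumes [measurable]: "f \<in> borel_measurable borel" "g \<in> borel_measurable borel" "V \<in> borel_measurable M"
    and B: "\<And>x. \<bar>f x\<bar> \<le> B" "\<And>x. \<bar>g x\<bar> \<le> B'" and close: "\<And>x. \<bar>f x - g x\<bar> \<le> e"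
  shows "\<bar>(\<integral>\<omega>. f (V \<omega>) \<partial>M) - (\<integral>\<omega>. g (V \<omega>) \<partial>M)\<bar> \<le> e"
proof -
  have i: "integrable M (\<lambda>\<omega>. f (V \<omega>))" "integrable M (\<lambda>\<omega>. g (V \<omega>))"
    using B by (auto intro: integrable_const_bound[of _ B] integrable_const_bound[of _ B'])
  have "\<bar>\<integral>\<omega>. f (V \<omega>) - g (V \<omega>) \<partial>M\<bar> \<le> (\<integral>\<omega>. \<bar>f (V \<omega>) - g (V \<omega>)\<bar> \<partial>M)"
    by (rule integral_abs_bound)
  also have "\<dots> \<le> (\<integral>\<omega>. e \<partial>M)" using i close by (intro integral_mono integrable_abs) auto
  finally show ?thesis using i by (simp add: prob_space)
qed

text \<open>Tightness is extracted from the test functions themselves: the expectations of the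
  cutoff at \<open>Y t\<close> converge to that at \<open>G\<close>, which is close to 1 for large
  \<open>R\<close>. A bounded \<open>f\<close> may then be replaced by \<open>f\<close> times the
  cutoff on both sides.\<close>

lemma conv_distrI_compact_support:
  fixes Y :: "nat \<Rightarrow> 'a \<Rightarrow> real^'p::finite" and G :: "'b \<Rightarrow> real^'p"
  assumes ps: "\<And>t. prob_space (M t)" "prob_space Q"
    and [measurable]: "\<And>t. Y t \<in> borel_measurable (M t)" "G \<in> borel_measurable Q"
    and conv: "\<And>(f :: real^'p \<Rightarrow> real) R. continuous_on UNIV f \<Longrightarrow> (\<And>x i. \<bar>x $ i\<bar> > R \<Longrightarrow> f x = 0)
      \<Longrightarrow> (\<lambda>t. \<integral>\<omega>. f (Y t \<omega>) \<partial>M t) \<longlonglongrightarrow> (\<integral>\<omega>. f (G \<omega>) \<partial>Q)"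
  shows "conv_distr M Y Q G"
  unfolding conv_distr_def
proof (intro conjI allI impI)
  fix f :: "real^'p \<Rightarrow> real" assume f: "continuous_on UNIV f" "bounded (range f)"
  interpret M: prob_space "M t" for t by fact
  interpret Q: prob_space Q by fact
  note [measurable] = borel_measurable_continuous_onI[OF f(1)] borel_measurable_continuous_onI[OF continuous_cutoff_vec[of UNIV]]
  obtain B0 where "\<And>x. \<bar>f x\<bar> \<le> B0" using f(2) by (auto simp: bounded_iff)
  then obtain B where B: "B > 0" "\<And>x. \<bar>f x\<bar> \<le> B" by (meson linorder_not_le order_trans less_le zero_less_one)
  have lim1: "(\<lambda>R. \<integral>\<omega>. cutoff_vec (real R) (G \<omega>) \<partial>Q) \<longlonglongrightarrow> (\<integral>\<omega>. 1 \<partial>Q)"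
  proof (rule integral_dominated_convergence[where w = "\<lambda>_. 1"])
    show "AE \<omega> in Q. (\<lambda>R. cutoff_vec (real R) (G \<omega>)) \<longlonglongrightarrow> 1"
    proof (intro AE_I2 tendsto_eventually)
      fix \<omega>
      obtain n :: nat where n: "norm (G \<omega>) \<le> real n" using real_arch_simple by blast
      show "\<forall>\<^sub>F R in sequentially. cutoff_vec (real R) (G \<omega>) = 1"
        using eventually_ge_at_top[of n]
      proof eventually_elim
        case (elim R)
        have "\<bar>G \<omega> $ i\<bar> \<le> real R" for i
          using component_le_norm_cart[of "G \<omega>" i] n elim by linarith
        then show ?case by (rule cutoff_vec_eq_1)
      qed
    qed
  qed (auto simp: cutoff_vec_bounds)
  show "(\<lambda>t. \<integral>\<omega>. f (Y t \<omega>) \<partial>M t) \<longlonglongrightarrow> (\<integral>\<omega>. f (G \<omega>) \<partial>Q)"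
  proof (rule LIMSEQ_I)
    fix e :: real assume e: "e > 0"
    have "\<forall>\<^sub>F R in sequentially. (\<integral>\<omega>. cutoff_vec (real R) (G \<omega>) \<partial>Q) > 1 - e / (4 * B)"
      by (rule order_tendstoD[OF lim1]) (use e B in \<open>simp add: Q.prob_space\<close>)
    then obtain R :: nat where "(\<integral>\<omega>. cutoff_vec (real R) (G \<omega>) \<partial>Q) > 1 - e / (4 * B)"
      by (auto simp: eventually_sequentially)
    then have R: "B * (1 - (\<integral>\<omega>. cutoff_vec (real R) (G \<omega>) \<partial>Q)) < e / 4"
      using B by (simp add: field_simps)
    \<comment> \<open>The cutoff equals 1 up to \<open>R\<close> and vanishes beyond
      \<open>R + 1\<close>, so the product is supported in the larger cube.\<close>
    have "(\<lambda>t. \<integral>\<omega>. f (Y t \<omega>) * cutoff_vec R (Y t \<omega>) \<partial>M t) \<longlonglongrightarrow> (\<integral>\<omega>. f (G \<omega>) * cutoff_vec R (G \<omega>) \<partial>Q)"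
      by (rule conv[of "\<lambda>x. f x * cutoff_vec R x" "R + 1"]) (auto intro!: continuous_intros f continuous_cutoff_vec simp: cutoff_vec_eq_0 add.commute)
    from tendstoD[OF this, of "e/4"] e have 1: "\<forall>\<^sub>F t in sequentially. \<bar>(\<integral>\<omega>. f (Y t \<omega>) * cutoff_vec R (Y t \<omega>) \<partial>M t) - (\<integral>\<omega>. f (G \<omega>) * cutoff_vec R (G \<omega>) \<partial>Q)\<bar> < e/4"
      by (simp add: dist_real_def)
    have "(\<lambda>t. \<integral>\<omega>. cutoff_vec R (Y t \<omega>) \<partial>M t) \<longlonglongrightarrow> (\<integral>\<omega>. cutoff_vec R (G \<omega>) \<partial>Q)"
      by (rule conv[of "cutoff_vec R" "R + 1"]) (auto intro!: continuous_cutoff_vec simp: cutoff_vec_eq_0 add.commute)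
    then have "(\<lambda>t. B * (1 - (\<integral>\<omega>. cutoff_vec R (Y t \<omega>) \<partial>M t))) \<longlonglongrightarrow> B * (1 - (\<integral>\<omega>. cutoff_vec R (G \<omega>) \<partial>Q))"
      by (intro tendsto_intros)
    then have 2: "\<forall>\<^sub>F t in sequentially. B * (1 - (\<integral>\<omega>. cutoff_vec R (Y t \<omega>) \<partial>M t)) < e/4"
      by (rule order_tendstoD) (use R in simp)
    from 1 2 have "\<forall>\<^sub>F t in sequentially. norm ((\<integral>\<omega>. f (Y t \<omega>) \<partial>M t) - (\<integral>\<omega>. f (G \<omega>) \<partial>Q)) < e"
    proof eventually_elim
      case (elim t)
      have "\<bar>(\<integral>\<omega>. f (Y t \<omega>) \<partial>M t) - (\<integral>\<omega>. f (Y t \<omega>) * cutoff_vec R (Y t \<omega>) \<partial>M t)\<bar> \<le> B * (1 - (\<integral>\<omega>. cutoff_vec R (Y t \<omega>) \<partial>M t))"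
        by (rule M.cutoff_vec_approx) (use B in auto)
      moreover have "\<bar>(\<integral>\<omega>. f (G \<omega>) \<partial>Q) - (\<integral>\<omega>. f (G \<omega>) * cutoff_vec R (G \<omega>) \<partial>Q)\<bar> \<le> B * (1 - (\<integral>\<omega>. cutoff_vec R (G \<omega>) \<partial>Q))"
        by (rule Q.cutoff_vec_approx) (use B in auto)
      ultimately show ?case using elim R unfolding real_norm_def by linarith
    qed
    then show "\<exists>no. \<forall>t\<ge>no. norm ((\<integral>\<omega>. f (Y t \<omega>) \<partial>M t) - (\<integral>\<omega>. f (G \<omega>) \<partial>Q)) < e"
      by (simp add: eventually_sequentially)
  qed
qed (use assms in auto)

text \<open>Products of one-variable functions are handled by \<open>char_conv_product\<close>, with
  one-variable Levy continuity supplying each coordinate. Sums of products approximate a compactly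
  supported \<open>f\<close> uniformly on a cube by Stone-Weierstrass, and the cutoff carries the
  approximation to the whole space.\<close>

theorem multivariate_levy_continuity:
  fixes Y :: "nat \<Rightarrow> 'a \<Rightarrow> real^'p::finite" and G :: "'b \<Rightarrow> real^'p"
  assumes ps: "\<And>t. prob_space (M t)" "prob_space Q"
    and [measurable]: "\<And>t. Y t \<in> borel_measurable (M t)" "G \<in> borel_measurable Q"
    and char: "\<And>a. (\<lambda>t. \<integral>\<omega>. iexp (a \<bullet> Y t \<omega>) \<partial>M t) \<longlonglongrightarrow> (\<integral>\<omega>. iexp (a \<bullet> G \<omega>) \<partial>Q)"
  shows "conv_distr M Y Q G"
proof (rule conv_distrI_compact_support[OF ps])
  interpret M: prob_space "M t" for t by fact
  interpret Q: prob_space Q by fact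
  have Gm: "(\<lambda>\<omega>. G \<omega> $ i) \<in> borel_measurable Q" for i
    by (rule borel_measurable_continuous_on[of "\<lambda>x. x $ i"]) (auto intro: continuous_intros)
  have Ym: "(\<lambda>\<omega>. Y t \<omega> $ i) \<in> borel_measurable (M t)" for t i
    by (rule borel_measurable_continuous_on[of "\<lambda>x. x $ i"]) (auto intro: continuous_intros)
  have prod: "(\<lambda>t. \<integral>\<omega>. (\<Prod>i\<in>UNIV. h i (Y t \<omega> $ i)) * cutoff_vec R (Y t \<omega>) \<partial>M t) \<longlonglongrightarrow> (\<integral>\<omega>. (\<Prod>i\<in>UNIV. h i (G \<omega> $ i)) * cutoff_vec R (G \<omega>) \<partial>Q)"
    if h: "\<And>i. continuous_on UNIV (h i)" for h R
  proof -
    have "\<exists>B>0. \<forall>x. \<bar>h i x * cutoff R x\<bar> \<le> B" for i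
    proof -
      have "bounded (h i ` {-(\<bar>R\<bar>+1)..\<bar>R\<bar>+1})"
        by (intro compact_imp_bounded compact_continuous_image continuous_on_subset[OF h]) auto
      then obtain B where B: "B > 0" "\<And>x. x \<in> {-(\<bar>R\<bar>+1)..\<bar>R\<bar>+1} \<Longrightarrow> \<bar>h i x\<bar> \<le> B"
        by (auto simp: bounded_pos)
      have "\<bar>h i x * cutoff R x\<bar> \<le> B" for x
      proof (cases "x \<in> {-(\<bar>R\<bar>+1)..\<bar>R\<bar>+1}")
        case True
        have "\<bar>h i x\<bar> * \<bar>cutoff R x\<bar> \<le> B * 1"
          by (intro mult_mono B True) (use B in \<open>auto simp: cutoff_def\<close>)
        then show ?thesis by (simp add: abs_mult)
      next
        case False
        then have "cutoff R x = 0" by (auto simp: cutoff_def)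
        then show ?thesis using B by simp
      qed
      then show ?thesis using B by blast
    qed
    then obtain B where B: "\<And>i. B i > 0" "\<And>i x. \<bar>h i x * cutoff R x\<bar> \<le> B i" by metis
    \<comment> \<open>Division by the bound \<open>B i\<close> is forced by the requirement that
      test functions take values in [-1,1]; the factors are restored by multiplying with their
      product.\<close>
    define k where "k i x = h i x * cutoff R x / B i" for i x
    have kc: "continuous_on UNIV (k i)" for i
      unfolding k_def using B(1)[of i] by (intro continuous_intros h continuous_cutoff) simp
    have "(\<lambda>t. \<integral>\<omega>. (\<Prod>i\<in>UNIV. k i (Y t \<omega> $ i)) \<partial>M t) \<longlonglongrightarrow> (\<integral>\<omega>. (\<Prod>i\<in>UNIV. k i (G \<omega> $ i)) \<partial>Q)"
    proof (rule char_conv_product[where h = k and X = "\<lambda>t i \<omega>. Y t \<omega> $ i" and X' = "\<lambda>i \<omega>. G \<omega> $ i"])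
      show "\<bar>k i x\<bar> \<le> 1" for i x using B(1)[of i] B(2)[of i x] by (simp add: k_def)
      show "k i \<in> borel_measurable borel" for i by (rule borel_measurable_continuous_onI[OF kc])
      show "(\<lambda>t. \<integral>\<omega>. iexp (\<Sum>i\<in>UNIV. a i * Y t \<omega> $ i) \<partial>M t) \<longlonglongrightarrow> (\<integral>\<omega>. iexp (\<Sum>i\<in>UNIV. a i * G \<omega> $ i) \<partial>Q)" for a
        using char[of "\<chi> i. a i"] by (simp add: inner_vec_def)
    next
      fix j and g :: "nat \<Rightarrow> 'a \<Rightarrow> real" and g' :: "'b \<Rightarrow> real"
      assume *: "\<And>t. g t \<in> borel_measurable (M t)" "g' \<in> borel_measurable Q"
        "\<And>t \<omega>. \<bar>g t \<omega>\<bar> \<le> 1" "\<And>\<omega>. \<bar>g' \<omega>\<bar> \<le> 1"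
        "\<And>a. (\<lambda>t. \<integral>\<omega>. iexp (a * Y t \<omega> $ j) \<partial>M t) \<longlonglongrightarrow> (\<integral>\<omega>. iexp (a * G \<omega> $ j) \<partial>Q)"
        "\<And>a. (\<lambda>t. \<integral>\<omega>. g t \<omega> * iexp (a * Y t \<omega> $ j) \<partial>M t) \<longlonglongrightarrow> (\<integral>\<omega>. g' \<omega> * iexp (a * G \<omega> $ j) \<partial>Q)"
      show "(\<lambda>t. \<integral>\<omega>. g t \<omega> * k j (Y t \<omega> $ j) \<partial>M t) \<longlonglongrightarrow> (\<integral>\<omega>. g' \<omega> * k j (G \<omega> $ j) \<partial>Q)"
      proof (rule tilt_levy_continuity[where h = "k j" and X = "\<lambda>t \<omega>. Y t \<omega> $ j" and X' = "\<lambda>\<omega>. G \<omega> $ j"])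
        show "isCont (k j) x" for x using kc by (simp add: continuous_on_eq_continuous_at)
        show "\<bar>k j x\<bar> \<le> 1" for x using B(1)[of j] B(2)[of j x] by (simp add: k_def)
      qed (rule * ps Ym Gm)+
    qed (rule ps Ym Gm finite_class.finite_UNIV)+
    then have "(\<lambda>t. (\<Prod>i\<in>UNIV. B i) * (\<integral>\<omega>. (\<Prod>i\<in>UNIV. k i (Y t \<omega> $ i)) \<partial>M t)) \<longlonglongrightarrow> (\<Prod>i\<in>UNIV. B i) * (\<integral>\<omega>. (\<Prod>i\<in>UNIV. k i (G \<omega> $ i)) \<partial>Q)"
      by (intro tendsto_intros)
    moreover have "(\<Prod>i\<in>UNIV. B i) * (\<Prod>i\<in>UNIV. k i (x $ i)) = (\<Prod>i\<in>UNIV. h i (x $ i)) * cutoff_vec R x" for x :: "real^'p"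
      unfolding cutoff_vec_def prod.distrib[symmetric] using B(1) by (intro prod.cong refl) (simp add: k_def less_imp_neq[symmetric])
    ultimately show ?thesis by (simp flip: Bochner_Integration.integral_mult_right_zero)
  qed
  fix f :: "real^'p \<Rightarrow> real" and R :: real
  assume f: "continuous_on UNIV f" and f0: "\<And>x i. \<bar>x $ i\<bar> > R \<Longrightarrow> f x = 0"
  note [measurable] = borel_measurable_continuous_onI[OF f] borel_measurable_continuous_onI[OF continuous_cutoff_vec[of UNIV]]
  \<comment> \<open>Outside this cube both \<open>f\<close> and the cutoff vanish.
    \<open>\<bar>R\<bar>\<close> guards against a negative \<open>R\<close>.\<close>
  define S :: "(real^'p) set" where "S = cbox (\<chi> i. -(\<bar>R\<bar>+1)) (\<chi> i. \<bar>R\<bar>+1)"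
  have S: "x \<in> S \<longleftrightarrow> (\<forall>i. \<bar>x $ i\<bar> \<le> \<bar>R\<bar>+1)" for x
  proof -
    have "-(\<bar>R\<bar>+1) \<le> s \<and> s \<le> \<bar>R\<bar>+1 \<longleftrightarrow> \<bar>s\<bar> \<le> \<bar>R\<bar>+1" for s by linarith
    then show ?thesis by (simp add: S_def mem_box_cart)
  qed
  have cS: "compact S" by (simp add: S_def)
  have bdS: "\<exists>B. \<forall>x. \<bar>f' x * cutoff_vec \<bar>R\<bar> x\<bar> \<le> B" if f': "continuous_on UNIV f'" for f' :: "real^'p \<Rightarrow> real"
  proof -
    have "bounded (f' ` S)"
      by (intro compact_imp_bounded compact_continuous_image continuous_on_subset[OF f'] cS) auto
    then obtain B where B: "B > 0" "\<And>x. x \<in> S \<Longrightarrow> \<bar>f' x\<bar> \<le> B" by (auto simp: bounded_pos)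
    have "\<bar>f' x * cutoff_vec \<bar>R\<bar> x\<bar> \<le> B" for x
    proof (cases "x \<in> S")
      case True
      have "\<bar>f' x\<bar> * \<bar>cutoff_vec \<bar>R\<bar> x\<bar> \<le> B * 1"
        by (intro mult_mono B True) (use B in \<open>auto simp: cutoff_vec_bounds\<close>)
      then show ?thesis by (simp add: abs_mult)
    next
      case False
      then obtain i where "\<bar>x $ i\<bar> > \<bar>R\<bar>+1" by (auto simp: S not_le)
      then show ?thesis using cutoff_vec_eq_0[of "\<bar>R\<bar>" x i] B by simp
    qed
    then show ?thesis by blast
  qed
  have span: "(\<lambda>t. \<integral>\<omega>. g (Y t \<omega>) * cutoff_vec \<bar>R\<bar> (Y t \<omega>) \<partial>M t) \<longlonglongrightarrow> (\<integral>\<omega>. g (G \<omega>) * cutoff_vec \<bar>R\<bar> (G \<omega>) \<partial>Q)"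
    if "product_span g" for g using that
  proof induction
    case (product h)
    then show ?case by (rule prod)
  next
    case (add g1 g2)
    note [measurable] = borel_measurable_continuous_onI[OF product_span_continuous[OF add.hyps(1)]]
      borel_measurable_continuous_onI[OF product_span_continuous[OF add.hyps(2)]]
    obtain B1 where B1: "\<And>x. \<bar>g1 x * cutoff_vec \<bar>R\<bar> x\<bar> \<le> B1" using bdS[OF product_span_continuous[OF add.hyps(1)]] by blast
    obtain B2 where B2: "\<And>x. \<bar>g2 x * cutoff_vec \<bar>R\<bar> x\<bar> \<le> B2" using bdS[OF product_span_continuous[OF add.hyps(2)]] by blast
    have i: "integrable (M t) (\<lambda>\<omega>. g1 (Y t \<omega>) * cutoff_vec \<bar>R\<bar> (Y t \<omega>))"
      "integrable (M t) (\<lambda>\<omega>. g2 (Y t \<omega>) * cutoff_vec \<bar>R\<bar> (Y t \<omega>))"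
      "integrable Q (\<lambda>\<omega>. g1 (G \<omega>) * cutoff_vec \<bar>R\<bar> (G \<omega>))"
      "integrable Q (\<lambda>\<omega>. g2 (G \<omega>) * cutoff_vec \<bar>R\<bar> (G \<omega>))" for t
      using B1 B2 by (auto intro: M.integrable_const_bound[of _ B1] M.integrable_const_bound[of _ B2]
          Q.integrable_const_bound[of _ B1] Q.integrable_const_bound[of _ B2])
    from tendsto_add[OF add.IH] show ?case using i by (simp add: distrib_right)
  qed
  show "(\<lambda>t. \<integral>\<omega>. f (Y t \<omega>) \<partial>M t) \<longlonglongrightarrow> (\<integral>\<omega>. f (G \<omega>) \<partial>Q)"
  proof (rule LIMSEQ_I)
    fix e :: real assume e: "e > 0"
    have "\<exists>g. product_span g \<and> (\<forall>x\<in>S. \<bar>f x - g x\<bar> < e/4)"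
    proof (rule Stone_Weierstrass_HOL[OF cS])
      show "product_span (\<lambda>x. c)" for c by (rule product_span_coord[of "\<lambda>_. c" undefined]) auto
      show "\<exists>f. product_span f \<and> f x \<noteq> f y" if "x \<in> S \<and> y \<in> S \<and> x \<noteq> y" for x y
        using that product_span_coord[of "\<lambda>s. s"] by (auto simp: vec_eq_iff)
      show "product_span (\<lambda>x. f x + g x)" if "product_span f \<and> product_span g" for f g
        using that by (intro product_span.add) auto
      show "product_span (\<lambda>x. f x * g x)" if "product_span f \<and> product_span g" for f g
        using that by (intro product_span_mult) auto
      show "continuous_on S f" by (rule continuous_on_subset[OF f]) auto
    qed (use e product_span_continuous in auto)
    then obtain g where g: "product_span g" "\<And>x. x \<in> S \<Longrightarrow> \<bar>f x - g x\<bar> < e/4" by blast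
    note [measurable] = borel_measurable_continuous_onI[OF product_span_continuous[OF g(1)]]
    obtain B1 where B1: "\<And>x. \<bar>g x * cutoff_vec \<bar>R\<bar> x\<bar> \<le> B1" using bdS[OF product_span_continuous[OF g(1)]] by blast
    have fc: "f x * cutoff_vec \<bar>R\<bar> x = f x" for x
    proof (cases "\<forall>i. \<bar>x $ i\<bar> \<le> \<bar>R\<bar>")
      case True
      then show ?thesis using cutoff_vec_eq_1[of x "\<bar>R\<bar>"] by simp
    next
      case False
      then obtain i where "\<bar>x $ i\<bar> > \<bar>R\<bar>" by (auto simp: not_le)
      then have "\<bar>x $ i\<bar> > R" by linarith
      then show ?thesis using f0 by simp
    qed
    obtain B2 where B2: "\<And>x. \<bar>f x\<bar> \<le> B2" using bdS[OF f] fc by auto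
    have close: "\<bar>f x - g x * cutoff_vec \<bar>R\<bar> x\<bar> \<le> e/4" for x
    proof (cases "x \<in> S")
      case True
      have "\<bar>(f x - g x) * cutoff_vec \<bar>R\<bar> x\<bar> \<le> (e/4) * 1"
        unfolding abs_mult using g(2)[OF True] e by (intro mult_mono) (auto simp: cutoff_vec_bounds)
      then show ?thesis using fc by (simp add: algebra_simps)
    next
      case False
      then obtain i where i: "\<bar>x $ i\<bar> > \<bar>R\<bar>+1" by (auto simp: S not_le)
      then have "\<bar>x $ i\<bar> > R" by linarith
      from f0[OF this] show ?thesis using cutoff_vec_eq_0[of "\<bar>R\<bar>" x i] i e by simp
    qed
    have "\<forall>\<^sub>F t in sequentially. \<bar>(\<integral>\<omega>. g (Y t \<omega>) * cutoff_vec \<bar>R\<bar> (Y t \<omega>) \<partial>M t) - (\<integral>\<omega>. g (G \<omega>) * cutoff_vec \<bar>R\<bar> (G \<omega>) \<partial>Q)\<bar> < e/4"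
      using tendstoD[OF span[OF g(1)], of "e/4"] e by (simp add: dist_real_def)
    then have "\<forall>\<^sub>F t in sequentially. norm ((\<integral>\<omega>. f (Y t \<omega>) \<partial>M t) - (\<integral>\<omega>. f (G \<omega>) \<partial>Q)) < e"
    proof eventually_elim
      case (elim t)
      note ap = B2 B1 close
      have "\<bar>(\<integral>\<omega>. f (Y t \<omega>) \<partial>M t) - (\<integral>\<omega>. g (Y t \<omega>) * cutoff_vec \<bar>R\<bar> (Y t \<omega>) \<partial>M t)\<bar> \<le> e/4"
        by (rule M.expectation_uniform_approx[OF _ _ _ ap]) auto
      moreover have "\<bar>(\<integral>\<omega>. f (G \<omega>) \<partial>Q) - (\<integral>\<omega>. g (G \<omega>) * cutoff_vec \<bar>R\<bar> (G \<omega>) \<partial>Q)\<bar> \<le> e/4"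
        by (rule Q.expectation_uniform_approx[OF _ _ _ ap]) auto
      ultimately show ?case using elim e unfolding real_norm_def by linarith
    qed
    then show "\<exists>no. \<forall>t\<ge>no. norm ((\<integral>\<omega>. f (Y t \<omega>) \<partial>M t) - (\<integral>\<omega>. f (G \<omega>) \<partial>Q)) < e"
      by (simp add: eventually_sequentially)
  qed
qed (use assms in auto)


section \<open>Tightness and Slutsky's lemma\<close>

lemma conv_distr_tight:
  fixes Y :: "nat \<Rightarrow> 'a \<Rightarrow> real^'p::finite" and G :: "'b \<Rightarrow> real^'p"
  assumes ps: "\<And>t. prob_space (M t)" "prob_space Q" and "conv_distr M Y Q G" and [measurable]: "G \<in> borel_measurable Q"
    and e: "e > 0"
  obtains L where "L > 0" "\<forall>\<^sub>F t in sequentially. measure (M t) {\<omega>\<in>space (M t). \<not> norm (Y t \<omega>) \<le> L} < e"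
proof -
  interpret M: prob_space "M t" for t by fact
  interpret Q: prob_space Q by fact
  note [measurable] = assms(3)[unfolded conv_distr_def, THEN conjunct1, rule_format]
  \<comment> \<open>A continuous ramp from 0 at norm \<open>L\<close> to 1 at norm
    \<open>L + 1\<close>. It dominates the indicator of norms above \<open>L + 1\<close>, whence the
    bound \<open>L + 1\<close> in the conclusion.\<close>
  define f where "f L x = max 0 (min 1 (norm x - L))" for L and x :: "real^'p"
  have fc: "continuous_on UNIV (f L)" for L unfolding f_def by (intro continuous_intros)
  note [measurable] = borel_measurable_continuous_onI[OF fc]
  have fb: "bounded (range (f L))" for L
    by (rule boundedI[of _ 1]) (auto simp: f_def)
  have "(\<lambda>L. \<integral>\<omega>. f (real L) (G \<omega>) \<partial>Q) \<longlonglongrightarrow> (\<integral>\<omega>. 0 \<partial>Q)"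
  proof (rule integral_dominated_convergence[where w = "\<lambda>_. 1"])
    show "AE \<omega> in Q. (\<lambda>L. f (real L) (G \<omega>)) \<longlonglongrightarrow> 0"
    proof (intro AE_I2 tendsto_eventually)
      fix \<omega>
      obtain n :: nat where n: "norm (G \<omega>) \<le> real n" using real_arch_simple by blast
      show "\<forall>\<^sub>F L in sequentially. f (real L) (G \<omega>) = 0"
        using eventually_ge_at_top[of n] by eventually_elim (use n in \<open>auto simp: f_def\<close>)
    qed
  qed (auto simp: f_def)
  then have "\<forall>\<^sub>F L in sequentially. (\<integral>\<omega>. f (real L) (G \<omega>) \<partial>Q) < e"
    by (rule order_tendstoD) (use e in auto)
  then obtain L :: nat where L: "(\<integral>\<omega>. f (real L) (G \<omega>) \<partial>Q) < e" by (auto simp: eventually_sequentially)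
  have "(\<lambda>t. \<integral>\<omega>. f L (Y t \<omega>) \<partial>M t) \<longlonglongrightarrow> (\<integral>\<omega>. f L (G \<omega>) \<partial>Q)"
    using assms(3) fc fb unfolding conv_distr_def by blast
  then have "\<forall>\<^sub>F t in sequentially. (\<integral>\<omega>. f L (Y t \<omega>) \<partial>M t) < e"
    by (rule order_tendstoD) (use L in simp)
  then have "\<forall>\<^sub>F t in sequentially. measure (M t) {\<omega>\<in>space (M t). \<not> norm (Y t \<omega>) \<le> real L + 1} < e"
  proof eventually_elim
    case (elim t)
    have "measure (M t) {\<omega>\<in>space (M t). \<not> norm (Y t \<omega>) \<le> real L + 1} = (\<integral>\<omega>. indicator {\<omega>\<in>space (M t). \<not> norm (Y t \<omega>) \<le> real L + 1} \<omega> \<partial>M t)"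
      by simp
    also have "\<dots> \<le> (\<integral>\<omega>. f L (Y t \<omega>) \<partial>M t)"
    proof (rule integral_mono)
      show "integrable (M t) (indicat_real {\<omega>\<in>space (M t). \<not> norm (Y t \<omega>) \<le> real L + 1})"
        by (rule M.integrable_const_bound[of _ 1]) (auto simp: indicator_def)
      show "integrable (M t) (\<lambda>\<omega>. f L (Y t \<omega>))"
        by (rule M.integrable_const_bound[of _ 1]) (auto simp: f_def)
    qed (auto simp: indicator_def f_def)
    finally show ?case using elim by simp
  qed
  then show ?thesis by (intro that[of "real L + 1"]) auto
qed

text \<open>Against a compactly supported \<open>f\<close>, which is uniformly continuous, closeness
  of \<open>Y'\<close> and \<open>Y\<close> in probability gives closeness of their images under
  \<open>f\<close> in probability and hence, \<open>f\<close> being bounded, in mean.\<close>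

lemma conv_distr_slutsky:
  fixes Y :: "nat \<Rightarrow> 'a \<Rightarrow> real^'p::finite" and G :: "'b \<Rightarrow> real^'p"
  assumes ps: "\<And>t. prob_space (M t)" "prob_space Q" and cd: "conv_distr M Y Q G" and [measurable]: "G \<in> borel_measurable Q"
    and [measurable]: "\<And>t. Y' t \<in> borel_measurable (M t)"
    and close: "((\<lambda>x. Y' (fst x) (snd x) - Y (fst x) (snd x)) \<longlongrightarrow> 0) (prob_filter M)"
  shows "conv_distr M Y' Q G"
proof (rule conv_distrI_compact_support[OF ps])
  interpret M: prob_space "M t" for t by fact
  note [measurable] = cd[unfolded conv_distr_def, THEN conjunct1, rule_format]
  fix f :: "real^'p \<Rightarrow> real" and R :: real
  assume f: "continuous_on UNIV f" and f0: "\<And>x i. \<bar>x $ i\<bar> > R \<Longrightarrow> f x = 0"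
  note [measurable] = borel_measurable_continuous_onI[OF f]
  define S :: "(real^'p) set" where "S = cbox (\<chi> i. -(R+1)) (\<chi> i. R+1)"
  have S: "x \<in> S \<longleftrightarrow> (\<forall>i. \<bar>x $ i\<bar> \<le> R+1)" for x
  proof -
    have "-(R+1) \<le> s \<and> s \<le> R+1 \<longleftrightarrow> \<bar>s\<bar> \<le> R+1" for s by linarith
    then show ?thesis by (simp add: S_def mem_box_cart)
  qed
  have fS: "continuous_on S f" and cS: "compact S" using f by (auto simp: S_def intro: continuous_on_subset)
  have uc: "uniformly_continuous_on S f" by (rule compact_uniformly_continuous[OF fS cS])
  have "bounded (f ` S)" by (intro compact_imp_bounded compact_continuous_image fS cS)
  then obtain B where B: "B > 0" "\<And>x. x \<in> S \<Longrightarrow> \<bar>f x\<bar> \<le> B" by (auto simp: bounded_pos)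
  have fB: "\<bar>f x\<bar> \<le> B" for x
  proof (cases "x \<in> S")
    case False
    then obtain i where "\<bar>x $ i\<bar> > R+1" by (auto simp: S not_le)
    then show ?thesis using f0[of x i] B by simp
  qed (use B in auto)
  \<comment> \<open>Uniform continuity on the cube extends to the whole space: the cube exceeds the
    support by 1, so if one of two points closer than 1 lies outside the cube, \<open>f\<close>
    vanishes at both.\<close>
  have near: "\<exists>d>0. \<forall>x y. norm (y - x) < d \<longrightarrow> \<bar>f y - f x\<bar> < e" if e: "e > 0" for e
  proof -
    obtain d where d: "d > 0" "\<And>x y. x \<in> S \<Longrightarrow> y \<in> S \<Longrightarrow> dist y x < d \<Longrightarrow> dist (f y) (f x) < e"
      using uc e unfolding uniformly_continuous_on_def by metis
    have out: "f x = 0 \<and> f y = 0" if "x \<notin> S" "norm (y - x) < 1" for x y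
    proof -
      from that obtain i where i: "\<bar>x $ i\<bar> > R+1" by (auto simp: S not_le)
      have "\<bar>(y - x) $ i\<bar> < 1" using component_le_norm_cart[of "y - x" i] that by linarith
      with i have "\<bar>y $ i\<bar> > R" by simp
      then show ?thesis using f0[of x i] f0[of y i] i by simp
    qed
    have "\<bar>f y - f x\<bar> < e" if "norm (y - x) < min d 1" for x y
    proof (cases "x \<in> S \<and> y \<in> S")
      case True
      then show ?thesis using d(2)[of x y] that by (simp add: dist_norm)
    next
      case False
      then have "f x = 0 \<and> f y = 0"
        using out[of x y] out[of y x] that by (auto simp: norm_minus_commute)
      then show ?thesis using e by simp
    qed
    then show ?thesis using d(1) by (intro exI[of _ "min d 1"]) auto
  qed
  have "(\<lambda>t. \<integral>\<omega>. f (Y' t \<omega>) - f (Y t \<omega>) \<partial>M t) \<longlonglongrightarrow> 0"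
  proof (rule expectation_tendsto_prob_filter_0[OF ps(1)])
    show "norm (f (Y' t \<omega>) - f (Y t \<omega>)) \<le> 2 * B" for t \<omega>
      using fB[of "Y' t \<omega>"] fB[of "Y t \<omega>"] by simp
    show "((\<lambda>x. f (Y' (fst x) (snd x)) - f (Y (fst x) (snd x))) \<longlongrightarrow> 0) (prob_filter M)"
    proof (rule tendstoI)
      fix e :: real assume "e > 0"
      then obtain d where d: "d > 0" "\<And>x y. norm (y - x) < d \<Longrightarrow> \<bar>f y - f x\<bar> < e" using near by blast
      show "\<forall>\<^sub>F x in prob_filter M. dist (f (Y' (fst x) (snd x)) - f (Y (fst x) (snd x))) 0 < e"
        using tendstoD[OF close d(1)] by eventually_elim (use d(2) in auto)
    qed
  qed auto
  moreover have "(\<lambda>t. \<integral>\<omega>. f (Y t \<omega>) \<partial>M t) \<longlonglongrightarrow> (\<integral>\<omega>. f (G \<omega>) \<partial>Q)"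
    using cd f fB unfolding conv_distr_def by (auto intro!: boundedI[of _ B])
  ultimately have "(\<lambda>t. (\<integral>\<omega>. f (Y' t \<omega>) - f (Y t \<omega>) \<partial>M t) + (\<integral>\<omega>. f (Y t \<omega>) \<partial>M t)) \<longlonglongrightarrow> 0 + (\<integral>\<omega>. f (G \<omega>) \<partial>Q)"
    by (intro tendsto_add)
  moreover have "integrable (M t) (\<lambda>\<omega>. f (Y' t \<omega>))" "integrable (M t) (\<lambda>\<omega>. f (Y t \<omega>))" for t
    using fB by (auto intro!: M.integrable_const_bound[of _ B])
  ultimately show "(\<lambda>t. \<integral>\<omega>. f (Y' t \<omega>) \<partial>M t) \<longlonglongrightarrow> (\<integral>\<omega>. f (G \<omega>) \<partial>Q)"
    by simp
qed (use assms in auto)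

section \<open>Gaussian random variables\<close>

text \<open>Phrased through the characteristic function so that the degenerate case
  \<open>v = 0\<close> is included and sums of independent variables reduce to products.\<close>

definition gaussian :: "'a measure \<Rightarrow> ('a \<Rightarrow> real) \<Rightarrow> real \<Rightarrow> bool" where
  "gaussian M x v \<longleftrightarrow> x \<in> borel_measurable M \<and> v \<ge> 0 \<and>
     (\<forall>u. (\<integral>\<omega>. iexp (u * x \<omega>) \<partial>M) = complex_of_real (exp (- (u\<^sup>2 * v) / 2)))"

lemma gaussian_measurable: "gaussian M x v \<Longrightarrow> x \<in> borel_measurable M"
  by (simp add: gaussian_def)

lemma gaussian_char: "gaussian M x v \<Longrightarrow> (\<integral>\<omega>. iexp (u * x \<omega>) \<partial>M) = complex_of_real (exp (- (u\<^sup>2 * v) / 2))"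
  by (simp add: gaussian_def)

lemma gaussian_char1: "gaussian M x v \<Longrightarrow> (\<integral>\<omega>. iexp (x \<omega>) \<partial>M) = complex_of_real (exp (- v / 2))"
  using gaussian_char[of M x v 1] by simp

context prob_space
begin

lemma distributed_imp_gaussian:
  assumes v: "v > 0" and x: "distributed M lborel x (normal_density 0 (sqrt v))"
  shows "gaussian M x v"
proof -
  have s: "sqrt v > 0" using v by simp
  have [measurable]: "x \<in> borel_measurable M" using distributed_measurable[OF x] by simp
  have y: "distributed M lborel (\<lambda>\<omega>. (x \<omega> - 0) / sqrt v) std_normal_density"
    using x normal_standard_normal_convert[OF s, of x 0] by simp
  have d: "distr M borel (\<lambda>\<omega>. x \<omega> / sqrt v) = std_normal_distribution"
    using distributed_distr_eq_density[OF y] by (simp cong: distr_cong)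
  have "(\<integral>\<omega>. iexp (u * x \<omega>) \<partial>M) = complex_of_real (exp (- (u\<^sup>2 * v) / 2))" for u
  proof -
    have "(\<integral>\<omega>. iexp (u * x \<omega>) \<partial>M) = (\<integral>\<omega>. iexp (u * sqrt v * (x \<omega> / sqrt v)) \<partial>M)"
      using s by simp
    also have "\<dots> = char (distr M borel (\<lambda>\<omega>. x \<omega> / sqrt v)) (u * sqrt v)"
      unfolding char_def by (subst integral_distr) auto
    finally show ?thesis using v unfolding d char_std_normal_distribution by (simp add: power_mult_distrib)
  qed
  then show ?thesis using v by (simp add: gaussian_def)
qed

lemma gaussian_imp_distributed:
  assumes g: "gaussian M x v" and v: "v > 0"
  shows "distributed M lborel x (normal_density 0 (sqrt v))"
proof -
  have s: "sqrt v > 0" using v by simp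
  note [measurable] = gaussian_measurable[OF g]
  have "distr M borel (\<lambda>\<omega>. x \<omega> / sqrt v) = std_normal_distribution"
  proof (rule Levy_uniqueness)
    show "real_distribution (distr M borel (\<lambda>\<omega>. x \<omega> / sqrt v))" by (rule real_distribution_distr) simp
    show "real_distribution std_normal_distribution" by (rule real_dist_normal_dist)
    show "char (distr M borel (\<lambda>\<omega>. x \<omega> / sqrt v)) = char std_normal_distribution"
    proof
      fix u
      have "char (distr M borel (\<lambda>\<omega>. x \<omega> / sqrt v)) u = (\<integral>\<omega>. iexp (u / sqrt v * x \<omega>) \<partial>M)"
        unfolding char_def by (subst integral_distr) auto
      also have "\<dots> = char std_normal_distribution u"
        using v unfolding gaussian_char[OF g] char_std_normal_distribution by (simp add: power_divide)
      finally show "char (distr M borel (\<lambda>\<omega>. x \<omega> / sqrt v)) u = char std_normal_distribution u" .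
    qed
  qed
  then have "distr M lborel (\<lambda>\<omega>. (x \<omega> - 0) / sqrt v) = std_normal_distribution"
    by (simp cong: distr_cong)
  then have "distributed M lborel (\<lambda>\<omega>. (x \<omega> - 0) / sqrt v) std_normal_density"
    unfolding distributed_def by auto
  then show ?thesis using normal_standard_normal_convert[OF s, of x 0] by simp
qed

lemma gaussian_zero_AE:
  assumes g: "gaussian M x 0"
  shows "AE \<omega> in M. x \<omega> = 0"
proof -
  note [measurable] = gaussian_measurable[OF g]
  have "distr M borel x = distr M borel (\<lambda>_. 0)"
  proof (rule Levy_uniqueness)
    show "char (distr M borel x) = char (distr M borel (\<lambda>_. 0))"
    proof
      fix u
      have "char (distr M borel x) u = (\<integral>\<omega>. iexp (u * x \<omega>) \<partial>M)"
        "char (distr M borel (\<lambda>_. 0)) u = (\<integral>\<omega>. iexp (u * 0) \<partial>M)"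
        unfolding char_def by (subst integral_distr; simp)+
      then show "char (distr M borel x) u = char (distr M borel (\<lambda>_. 0)) u"
        using gaussian_char[OF g, of u] by (simp add: prob_space)
    qed
    show "real_distribution (distr M borel (\<lambda>_. 0))" by (rule real_distribution_distr) simp
    show "real_distribution (distr M borel x)" by (rule real_distribution_distr) simp
  qed
  moreover have "AE y in distr M borel (\<lambda>_. 0::real). y = 0"
    by (subst AE_distr_iff) auto
  ultimately have "AE y in distr M borel x. y = 0" by metis
  then show ?thesis by (subst (asm) AE_distr_iff) auto
qed

lemma gaussian_moments:
  assumes g: "gaussian M x v"
  shows "has_bochner_integral M (\<lambda>\<omega>. (x \<omega>)\<^sup>2) v" "has_bochner_integral M (\<lambda>\<omega>. (x \<omega>)^4) (3 * v\<^sup>2)"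
proof -
  note [measurable] = gaussian_measurable[OF g]
  have "has_bochner_integral M (\<lambda>\<omega>. (x \<omega>)\<^sup>2) v \<and> has_bochner_integral M (\<lambda>\<omega>. (x \<omega>)^4) (3 * v\<^sup>2)"
  proof (cases "v > 0")
    case True
    note d = gaussian_imp_distributed[OF g True]
    have s: "sqrt v > 0" using True by simp
    have m2: "has_bochner_integral lborel (\<lambda>x. normal_density 0 (sqrt v) x * x\<^sup>2) v"
      using normal_moment_even[OF s, of 0 1] True by (simp add: fact_numeral)
    have m4: "has_bochner_integral lborel (\<lambda>x. normal_density 0 (sqrt v) x * x^4) (3 * v\<^sup>2)"
      using normal_moment_even[OF s, of 0 2] True by (simp add: fact_numeral power_divide field_simps)
    have "integrable M (\<lambda>\<omega>. (x \<omega>)\<^sup>2)" 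
      using distributed_integrable[OF d, of "\<lambda>x. x\<^sup>2"] m2 by (auto simp: has_bochner_integral_iff)
    moreover have "integrable M (\<lambda>\<omega>. (x \<omega>)^4)" 
      using distributed_integrable[OF d, of "\<lambda>x. x^4"] m4 by (auto simp: has_bochner_integral_iff)
    ultimately show ?thesis
      using distributed_integral[OF d, of "\<lambda>x. x\<^sup>2"] m2 distributed_integral[OF d, of "\<lambda>x. x^4"] m4 
      by (auto simp: has_bochner_integral_iff)
  next
    case False
    then have v: "v = 0" using g by (simp add: gaussian_def)
    have ae: "AE \<omega> in M. x \<omega> = 0" using gaussian_zero_AE g v by simp
    have "has_bochner_integral M (\<lambda>\<omega>. (x \<omega>)\<^sup>2) 0 \<longleftrightarrow> has_bochner_integral M (\<lambda>_. 0::real) 0"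
      "has_bochner_integral M (\<lambda>\<omega>. (x \<omega>)^4) 0 \<longleftrightarrow> has_bochner_integral M (\<lambda>_. 0::real) 0"
      by (rule has_bochner_integral_cong_AE; use ae in auto)+
    then show ?thesis using v by (simp add: has_bochner_integral_zero)
  qed
  then show "has_bochner_integral M (\<lambda>\<omega>. (x \<omega>)\<^sup>2) v" "has_bochner_integral M (\<lambda>\<omega>. (x \<omega>)^4) (3 * v\<^sup>2)" by auto
qed

text \<open>Polarisation: \<open>12 x\<^sup>2 y\<^sup>2 = (x + y)^4 + (x - y)^4 - 2 x^4 - 2
  y^4\<close> reduces the mixed moment to fourth moments of single Gaussian variables. Here
  \<open>c\<close> is the covariance, and the value is that of Isserlis' formula.\<close>

lemma gaussian_mixed_moment:
  assumes x: "gaussian M x a" and y: "gaussian M y b"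
    and p: "gaussian M (\<lambda>\<omega>. x \<omega> + y \<omega>) (a + 2 * c + b)" and m: "gaussian M (\<lambda>\<omega>. x \<omega> - y \<omega>) (a - 2 * c + b)"
  shows "has_bochner_integral M (\<lambda>\<omega>. (x \<omega>)\<^sup>2 * (y \<omega>)\<^sup>2) (a * b + 2 * c\<^sup>2)"
proof -
  have "has_bochner_integral M (\<lambda>\<omega>. ((x \<omega> + y \<omega>)^4 + (x \<omega> - y \<omega>)^4 - 2 * (x \<omega>)^4 - 2 * (y \<omega>)^4) / 12)
    ((3 * (a + 2 * c + b)\<^sup>2 + 3 * (a - 2 * c + b)\<^sup>2 - 2 * (3 * a\<^sup>2) - 2 * (3 * b\<^sup>2)) / 12)"
    by (intro has_bochner_integral_divide_zero has_bochner_integral_diff has_bochner_integral_add has_bochner_integral_mult_right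
        gaussian_moments x y p m)
  also have "(\<lambda>\<omega>. ((x \<omega> + y \<omega>)^4 + (x \<omega> - y \<omega>)^4 - 2 * (x \<omega>)^4 - 2 * (y \<omega>)^4) / 12) = (\<lambda>\<omega>. (x \<omega>)\<^sup>2 * (y \<omega>)\<^sup>2)"
    by (intro ext) (simp add: power4_eq_xxxx power2_eq_square field_simps)
  also have "(3 * (a + 2 * c + b)\<^sup>2 + 3 * (a - 2 * c + b)\<^sup>2 - 2 * (3 * a\<^sup>2) - 2 * (3 * b\<^sup>2)) / 12 = a * b + 2 * c\<^sup>2"
    by (simp add: power2_eq_square field_simps)
  finally show ?thesis .
qed

lemma gaussian_sum:
  assumes I: "finite I" and ind: "indep_vars (\<lambda>_. borel) X I" and g: "\<And>i. i \<in> I \<Longrightarrow> gaussian M (X i) (v i)"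
  shows "gaussian M (\<lambda>\<omega>. \<Sum>i\<in>I. X i \<omega>) (\<Sum>i\<in>I. v i)"
  unfolding gaussian_def
proof (intro conjI allI)
  show "(\<lambda>\<omega>. \<Sum>i\<in>I. X i \<omega>) \<in> borel_measurable M" using gaussian_measurable[OF g] by simp
  show "0 \<le> (\<Sum>i\<in>I. v i)" using g by (auto simp: gaussian_def intro: sum_nonneg)
  fix u
  have "indep_vars (\<lambda>_. borel) (\<lambda>i \<omega>. iexp (u * X i \<omega>)) I"
    by (rule indep_vars_compose2[OF ind]) simp
  then have "(\<integral>\<omega>. (\<Prod>i\<in>I. iexp (u * X i \<omega>)) \<partial>M) = (\<Prod>i\<in>I. \<integral>\<omega>. iexp (u * X i \<omega>) \<partial>M)"
    using gaussian_measurable[OF g] by (intro indep_vars_lebesgue_integral I integrable_iexp) auto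
  also have "\<dots> = (\<Prod>i\<in>I. complex_of_real (exp (- (u\<^sup>2 * v i) / 2)))"
    by (intro prod.cong refl gaussian_char g)
  also have "\<dots> = complex_of_real (exp (\<Sum>i\<in>I. - (u\<^sup>2 * v i) / 2))"
    using I by (simp add: exp_sum)
  also have "(\<Sum>i\<in>I. - (u\<^sup>2 * v i) / 2) = - (u\<^sup>2 * (\<Sum>i\<in>I. v i)) / 2"
    by (simp add: sum_distrib_left sum_negf sum_divide_distrib)
  finally show "(\<integral>\<omega>. iexp (u * (\<Sum>i\<in>I. X i \<omega>)) \<partial>M) = complex_of_real (exp (- (u\<^sup>2 * (\<Sum>i\<in>I. v i)) / 2))"
    using I by (simp add: sum_distrib_left exp_sum)
qed

end

section \<open>Bilinear forms and Gaussian quadratic forms\<close>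

lemma bform_add_left: "bform N S (\<lambda>a. u a + v a) w = bform N S u w + bform N S v w"
  by (simp add: bform_def algebra_simps sum.distrib)

lemma bform_add_right: "bform N S w (\<lambda>a. u a + v a) = bform N S w u + bform N S w v"
  by (simp add: bform_def algebra_simps sum.distrib)

lemma bform_scale_left: "bform N S (\<lambda>a. k * u a) w = k * bform N S u w"
  by (simp add: bform_def algebra_simps sum_distrib_left)

lemma bform_scale_right: "bform N S w (\<lambda>a. k * u a) = k * bform N S w u"
  by (simp add: bform_def algebra_simps sum_distrib_left)

lemma bform_diff_left: "bform N S (\<lambda>a. u a - v a) w = bform N S u w - bform N S v w"
  by (simp add: bform_def algebra_simps sum_subtractf)

lemma bform_diff_right: "bform N S w (\<lambda>a. u a - v a) = bform N S w u - bform N S w v"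
  by (simp add: bform_def algebra_simps sum_subtractf)

lemma bform_sum_left: "bform N S (\<lambda>a. \<Sum>i\<in>I. u i a) w = (\<Sum>i\<in>I. bform N S (u i) w)"
  unfolding bform_def sum_distrib_right by (subst (2) sum.swap, subst sum.swap) (rule refl)

lemma bform_sum_right: "bform N S w (\<lambda>a. \<Sum>i\<in>I. u i a) = (\<Sum>i\<in>I. bform N S w (u i))"
  unfolding bform_def sum_distrib_left by (subst sum.swap, subst (2) sum.swap) (rule refl)

lemma bform_sym:
  assumes "\<And>a b. a < N \<Longrightarrow> b < N \<Longrightarrow> S a b = S b a"
  shows "bform N S u v = bform N S v u"
proof -
  have "bform N S u v = (\<Sum>a<N. \<Sum>b<N. v b * S b a * u a)"
    unfolding bform_def by (intro sum.cong refl) (simp add: assms mult_ac)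
  also have "\<dots> = bform N S v u" unfolding bform_def by (rule sum.swap)
  finally show ?thesis .
qed

lemma bform_cong:
  assumes "\<And>a b. a < N \<Longrightarrow> b < N \<Longrightarrow> S a b = S' a b" "\<And>a. a < N \<Longrightarrow> u a = u' a" "\<And>a. a < N \<Longrightarrow> v a = v' a"
  shows "bform N S u v = bform N S' u' v'"
  unfolding bform_def using assms by (intro sum.cong refl) auto

text \<open>The Cramer-Wold description of the law \<open>N(0, S)\<close>; vanishing variances are
  included through \<open>gaussian\<close>.\<close>

definition gauss_lin :: "'a measure \<Rightarrow> nat \<Rightarrow> (nat \<Rightarrow> nat \<Rightarrow> real) \<Rightarrow> ('a \<Rightarrow> nat \<Rightarrow> real) \<Rightarrow> bool" where
  "gauss_lin M N S V \<longleftrightarrow> (\<forall>c. gaussian M (\<lambda>\<omega>. \<Sum>a<N. c a * V \<omega> a) (bform N S c c))"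

lemma sym_pd_bform_nonneg:
  assumes "sym_pd N S" shows "bform N S c c \<ge> 0"
proof (cases "\<exists>a<N. c a \<noteq> 0")
  case True
  then show ?thesis using assms unfolding sym_pd_def by (intro less_imp_le) blast
next
  case False
  then show ?thesis by (simp add: bform_def)
qed

lemma (in prob_space) gauss_vec_imp_gauss_lin:
  assumes "gauss_vec M N S V" "sym_pd N S"
  shows "gauss_lin M N S V"
  unfolding gauss_lin_def
proof
  fix c
  show "gaussian M (\<lambda>\<omega>. \<Sum>a<N. c a * V \<omega> a) (bform N S c c)"
  proof (cases "bform N S c c > 0")
    case True
    then show ?thesis using assms(1) unfolding gauss_vec_def by (intro distributed_imp_gaussian) auto
  next
    case False
    then have z: "bform N S c c = 0" using sym_pd_bform_nonneg[OF assms(2), of c] by simp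
    then have ae: "AE \<omega> in M. (\<Sum>a<N. c a * V \<omega> a) = 0"
      and [measurable]: "(\<lambda>\<omega>. \<Sum>a<N. c a * V \<omega> a) \<in> borel_measurable M"
      using assms(1) unfolding gauss_vec_def by auto
    have "(\<integral>\<omega>. iexp (u * (\<Sum>a<N. c a * V \<omega> a)) \<partial>M) = (\<integral>\<omega>. 1 \<partial>M)" for u
    proof (rule integral_cong_AE)
      show "AE \<omega> in M. iexp (u * (\<Sum>a<N. c a * V \<omega> a)) = 1"
        using ae by eventually_elim (simp del: of_real_sum)
    qed (simp_all del: of_real_sum)
    then show ?thesis unfolding gaussian_def z by (simp add: prob_space)
  qed
qed

text \<open>With \<open>A\<close> factored, the form is the sum of the squares of the Gaussian
  variables \<open>x k\<close>, whose covariances are \<open>s k j\<close>. In the second moment the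
  products \<open>s k k * s j j\<close> sum to the squared mean, and only the terms
  \<open>2 (s k j)\<^sup>2\<close> remain as variance.\<close>

lemma (in prob_space) gauss_quadratic_variance:
  assumes V: "gauss_lin M N S V" and S: "\<And>a b. a < N \<Longrightarrow> b < N \<Longrightarrow> S a b = S b a"
    and A: "\<And>a b. a < N \<Longrightarrow> b < N \<Longrightarrow> A a b = (\<Sum>k<N. l k a * l k b)"
  shows "(\<integral>\<^sup>+\<omega>. ennreal ((bform N A (V \<omega>) (V \<omega>) - (\<Sum>k<N. bform N S (l k) (l k)))\<^sup>2) \<partial>M)
     = ennreal (2 * (\<Sum>k<N. \<Sum>j<N. (bform N S (l k) (l j))\<^sup>2))"
proof -
  define x where "x k \<omega> = (\<Sum>a<N. l k a * V \<omega> a)" for k \<omega>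
  define s where "s k j = bform N S (l k) (l j)" for k j
  have g: "gaussian M (x k) (s k k)" for k
    using V unfolding gauss_lin_def x_def s_def by blast
  have sym: "s j k = s k j" for k j unfolding s_def by (rule bform_sym[OF S])
  have gp: "gaussian M (\<lambda>\<omega>. x k \<omega> + x j \<omega>) (s k k + 2 * s k j + s j j)" for k j
    using V[unfolded gauss_lin_def, rule_format, of "\<lambda>a. l k a + l j a"] sym[of k j]
    by (simp add: x_def s_def bform_add_left bform_add_right distrib_right sum.distrib algebra_simps)
  have gm: "gaussian M (\<lambda>\<omega>. x k \<omega> - x j \<omega>) (s k k - 2 * s k j + s j j)" for k j
  proof -
    have "s k k - 2 * s k j + s j j = bform N S (\<lambda>a. l k a - l j a) (\<lambda>a. l k a - l j a)"
      using sym[of k j] by (simp add: s_def bform_diff_left bform_diff_right)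
    moreover have "(\<lambda>\<omega>. x k \<omega> - x j \<omega>) = (\<lambda>\<omega>. \<Sum>a<N. (l k a - l j a) * V \<omega> a)"
      by (simp add: x_def left_diff_distrib sum_subtractf)
    ultimately show ?thesis using V[unfolded gauss_lin_def, rule_format, of "\<lambda>a. l k a - l j a"] by simp
  qed
  have m: "has_bochner_integral M (\<lambda>\<omega>. (x k \<omega>)\<^sup>2 * (x j \<omega>)\<^sup>2) (s k k * s j j + 2 * (s k j)\<^sup>2)" for k j
    by (rule gaussian_mixed_moment[OF g g gp gm])
  have q: "bform N A (V \<omega>) (V \<omega>) = (\<Sum>k<N. (x k \<omega>)\<^sup>2)" for \<omega>
  proof -
    have "bform N A (V \<omega>) (V \<omega>) = (\<Sum>a<N. \<Sum>b<N. \<Sum>k<N. (l k a * V \<omega> a) * (l k b * V \<omega> b))"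
      unfolding bform_def by (intro sum.cong refl) (simp add: A sum_distrib_left sum_distrib_right mult_ac)
    also have "\<dots> = (\<Sum>k<N. \<Sum>a<N. \<Sum>b<N. (l k a * V \<omega> a) * (l k b * V \<omega> b))"
      by (subst (2) sum.swap, subst sum.swap) (rule refl)
    also have "\<dots> = (\<Sum>k<N. (x k \<omega>)\<^sup>2)"
      unfolding x_def power2_eq_square sum_product ..
    finally show ?thesis .
  qed
  define T where "T = (\<Sum>k<N. s k k)"
  have "has_bochner_integral M (\<lambda>\<omega>. (\<Sum>k<N. \<Sum>j<N. (x k \<omega>)\<^sup>2 * (x j \<omega>)\<^sup>2) - 2 * T * (\<Sum>k<N. (x k \<omega>)\<^sup>2) + T\<^sup>2 * 1)
     ((\<Sum>k<N. \<Sum>j<N. s k k * s j j + 2 * (s k j)\<^sup>2) - 2 * T * (\<Sum>k<N. s k k) + T\<^sup>2 * 1)"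
  proof (intro has_bochner_integral_add has_bochner_integral_diff has_bochner_integral_mult_right has_bochner_integral_sum)
    show "has_bochner_integral M (\<lambda>\<omega>. (x i \<omega>)\<^sup>2) (s i i)" for i by (rule gaussian_moments[OF g])
    show "has_bochner_integral M (\<lambda>_. 1::real) 1" by (simp add: has_bochner_integral_iff prob_space)
  qed (use m in auto)
  also have "(\<lambda>\<omega>. (\<Sum>k<N. \<Sum>j<N. (x k \<omega>)\<^sup>2 * (x j \<omega>)\<^sup>2) - 2 * T * (\<Sum>k<N. (x k \<omega>)\<^sup>2) + T\<^sup>2 * 1)
     = (\<lambda>\<omega>. (bform N A (V \<omega>) (V \<omega>) - T)\<^sup>2)"
    unfolding q by (intro ext) (simp add: power2_diff power2_eq_square[of "sum _ _"] sum_product)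
  also have "(\<Sum>k<N. \<Sum>j<N. s k k * s j j + 2 * (s k j)\<^sup>2) - 2 * T * (\<Sum>k<N. s k k) + T\<^sup>2 * 1
     = 2 * (\<Sum>k<N. \<Sum>j<N. (s k j)\<^sup>2)"
  proof -
    have "(\<Sum>k<N. \<Sum>j<N. s k k * s j j) = T\<^sup>2" unfolding T_def power2_eq_square sum_product ..
    then show ?thesis by (simp add: sum.distrib sum_distrib_left T_def[symmetric] power2_eq_square)
  qed
  finally show ?thesis
    unfolding T_def s_def by (subst nn_integral_eq_integral) (auto simp: has_bochner_integral_iff)
qed

section \<open>Symmetric matrices over finite index sets\<close>

text \<open>Over a finite index set instead of a range \<open>{..<N}\<close>, so that an induction
  may remove one index at a time.\<close>

definition quad :: "'i set \<Rightarrow> ('i \<Rightarrow> 'i \<Rightarrow> real) \<Rightarrow> ('i \<Rightarrow> real) \<Rightarrow> real" where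
  "quad J A c = (\<Sum>a\<in>J. \<Sum>b\<in>J. c a * A a b * c b)"

lemma quad_insert:
  assumes "finite J" "j \<notin> J" "\<And>a. a \<in> J \<Longrightarrow> A j a = A a j"
  shows "quad (insert j J) A c = quad J A c + 2 * c j * (\<Sum>a\<in>J. c a * A a j) + (c j)\<^sup>2 * A j j"
proof -
  have "(\<Sum>b\<in>J. c j * A j b * c b) = c j * (\<Sum>a\<in>J. c a * A a j)"
    unfolding sum_distrib_left by (intro sum.cong refl) (simp add: assms(3))
  moreover have "(\<Sum>a\<in>J. c a * A a j * c j) = c j * (\<Sum>a\<in>J. c a * A a j)"
    unfolding sum_distrib_left by (intro sum.cong refl) simp
  ultimately show ?thesis
    using assms(1,2) unfolding quad_def by (simp add: sum.distrib power2_eq_square)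
qed

lemma quad_cong: "(\<And>a. a \<in> J \<Longrightarrow> c a = d a) \<Longrightarrow> quad J A c = quad J A d"
  unfolding quad_def by (intro sum.cong refl) auto

definition schur :: "'i \<Rightarrow> ('i \<Rightarrow> 'i \<Rightarrow> real) \<Rightarrow> 'i \<Rightarrow> 'i \<Rightarrow> real" where
  "schur j A a b = A a b - A a j * A j b / A j j"

text \<open>Completing the square in the coordinate \<open>j\<close>.\<close>

lemma quad_schur:
  assumes "finite J" "j \<notin> J" "\<And>a. a \<in> J \<Longrightarrow> A j a = A a j" "A j j \<noteq> 0"
  shows "quad J (schur j A) c = quad (insert j J) A (c(j := - (\<Sum>a\<in>J. c a * A a j) / A j j))"
proof -
  let ?s = "\<Sum>a\<in>J. c a * A a j"
  let ?c = "c(j := - ?s / A j j)"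
  have s: "(\<Sum>a\<in>J. ?c a * A a j) = ?s" using assms(2) by (intro sum.cong refl) auto
  have "quad J A ?c = quad J A c" using assms(2) by (intro quad_cong) auto
  then have "quad (insert j J) A ?c = quad J A c - ?s * ?s / A j j"
    using quad_insert[of J j A ?c, OF assms(1,2) assms(3)] assms(4) unfolding s by (simp add: power2_eq_square field_simps)
  moreover have "quad J (schur j A) c = quad J A c - (\<Sum>a\<in>J. \<Sum>b\<in>J. (c a * A a j) * (c b * A b j) / A j j)"
    unfolding quad_def schur_def sum_subtractf[symmetric]
    by (intro sum.cong refl) (simp add: assms(3) algebra_simps)
  moreover have "(\<Sum>a\<in>J. \<Sum>b\<in>J. (c a * A a j) * (c b * A b j) / A j j) = ?s * ?s / A j j"
    by (simp add: sum_product sum_divide_distrib)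
  ultimately show ?thesis by simp
qed

lemma linear_coeff_zero:
  fixes p :: real
  assumes "\<And>y. q + y * p \<ge> 0"
  shows "p = 0"
proof (rule ccontr)
  assume "p \<noteq> 0"
  then show False using assms[of "- (q + 1) / p"] by simp
qed

text \<open>The first-variation principle behind the Rayleigh maximiser, the kernel of a
  semidefinite form and the first-order condition of the estimator. The witness
  \<open>- p / (\<bar>q\<bar> + 1)\<close> makes the linear term dominate.\<close>

lemma quadratic_linear_coeff_zero:
  fixes p :: real
  assumes "\<And>t. t * p + t\<^sup>2 * q \<ge> 0"
  shows "p = 0"
proof (rule ccontr)
  assume p: "p \<noteq> 0"
  define d where "d = \<bar>q\<bar> + 1"
  have d: "d > 0" "\<bar>q\<bar> = d - 1" by (auto simp: d_def)
  have "(- p / d) * p + (- p / d)\<^sup>2 * q \<le> (- p / d) * p + (- p / d)\<^sup>2 * \<bar>q\<bar>" by (simp add: mult_left_mono)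
  also have "\<dots> = - (p\<^sup>2 / d\<^sup>2)"
    unfolding d(2) using d(1) by (simp add: field_simps power2_eq_square)
  also have "\<dots> < 0" using p d(1) by simp
  finally show False using assms[of "- p / d"] by simp
qed

text \<open>Elimination of one index at a time, as in a Cholesky decomposition, but with zero pivots
  allowed: a zero diagonal entry of a semidefinite matrix forces its column to vanish, and a
  positive one leaves a semidefinite Schur complement.\<close>

lemma psd_factor:
  assumes "finite J" "\<And>a b. a \<in> J \<Longrightarrow> b \<in> J \<Longrightarrow> A a b = A b a" "\<And>c. quad J A c \<ge> 0"
  shows "\<exists>l. \<forall>a\<in>J. \<forall>b\<in>J. A a b = (\<Sum>k\<in>J. l k a * l k b)"
  using assms
proof (induction J arbitrary: A rule: finite_induct)
  case (insert j J)
  have sym: "\<And>a. a \<in> J \<Longrightarrow> A j a = A a j" using insert.prems(1) by blast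
  have qi: "quad (insert j J) A c = quad J A c + 2 * c j * (\<Sum>a\<in>J. c a * A a j) + (c j)\<^sup>2 * A j j" for c
    by (rule quad_insert) (use insert.hyps sym in auto)
  have nn: "A j j \<ge> 0"
  proof -
    have "quad J A (\<lambda>a. if a = j then 1 else 0) = quad J A (\<lambda>_. 0)"
      using insert.hyps(2) by (intro quad_cong) auto
    moreover have "(\<Sum>a\<in>J. (if a = j then 1 else 0) * A a j) = 0" using insert.hyps(2) by (intro sum.neutral) auto
    ultimately show ?thesis
      using insert.prems(2)[of "\<lambda>a. if a = j then 1 else 0"] unfolding qi by (simp add: quad_def)
  qed
  show ?case
  proof (cases "A j j = 0")
    case True
    \<comment> \<open>Testing with 1 at \<open>a\<close> and \<open>y / 2\<close> at
      \<open>j\<close> leaves \<open>A a a + y * A a j\<close>, which is nonnegative for every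
      \<open>y\<close> only if the slope vanishes.\<close>
    have z: "A a j = 0" if a: "a \<in> J" for a
    proof (rule linear_coeff_zero[of "quad J A (\<lambda>b. if b = a then 1 else 0)"])
      fix y :: real
      let ?c = "\<lambda>b. if b = a then 1 else if b = j then y / 2 else 0"
      have "(\<Sum>b\<in>J. ?c b * A b j) = (\<Sum>b\<in>J. (if b = a then 1 else 0) * A b j)"
        using insert.hyps(2) by (intro sum.cong refl) auto
      also have "\<dots> = A a j" using a insert.hyps(1) by (simp add: if_distrib[of "\<lambda>z. z * _"] cong: if_cong)
      finally have s: "(\<Sum>b\<in>J. ?c b * A b j) = A a j" .
      have "a \<noteq> j" using a insert.hyps(2) by auto
      then have ge: "quad J A ?c + y * A a j \<ge> 0"
        using insert.prems(2)[of ?c] unfolding qi s True by auto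
      have "quad J A ?c = quad J A (\<lambda>b. if b = a then 1 else 0)"
        using insert.hyps(2) by (intro quad_cong) auto
      then show "quad J A (\<lambda>b. if b = a then 1 else 0) + y * A a j \<ge> 0"
        using ge by simp
    qed
    have "\<exists>l. \<forall>a\<in>J. \<forall>b\<in>J. A a b = (\<Sum>k\<in>J. l k a * l k b)"
    proof (rule insert.IH)
      show "A a b = A b a" if "a \<in> J" "b \<in> J" for a b using insert.prems(1) that by blast
      show "0 \<le> quad J A c" for c
      proof -
        have "quad J A (c(j := 0)) = quad J A c" using insert.hyps(2) by (intro quad_cong) auto
        then show ?thesis using insert.prems(2)[of "c(j := 0)"] unfolding qi by simp
      qed
    qed
    then obtain l where l: "\<forall>a\<in>J. \<forall>b\<in>J. A a b = (\<Sum>k\<in>J. l k a * l k b)" by blast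
    show ?thesis
    proof (intro exI ballI)
      fix a b assume ab: "a \<in> insert j J" "b \<in> insert j J"
      let ?l = "\<lambda>k a. if k = j \<or> a = j then 0 else l k a"
      show "A a b = (\<Sum>k\<in>insert j J. ?l k a * ?l k b)"
      proof (cases "a = j \<or> b = j")
        case True
        then show ?thesis using ab z sym \<open>A j j = 0\<close> by (auto intro!: sum.neutral)
      next
        case False
        then have "A a b = (\<Sum>k\<in>J. l k a * l k b)" using l ab by auto
        also have "\<dots> = (\<Sum>k\<in>J. ?l k a * ?l k b)" using False insert.hyps(2) by (intro sum.cong) auto
        finally show ?thesis using insert.hyps by simp
      qed
    qed
  next
    case False
    then have pos: "A j j > 0" using nn by simp
    have "\<exists>l. \<forall>a\<in>J. \<forall>b\<in>J. schur j A a b = (\<Sum>k\<in>J. l k a * l k b)"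
    proof (rule insert.IH)
      show "schur j A a b = schur j A b a" if "a \<in> J" "b \<in> J" for a b 
        using insert.prems(1)[of a b] sym that by (simp add: schur_def)
      show "0 \<le> quad J (schur j A) c" for c
        using quad_schur[of J j A c] insert.hyps sym False insert.prems(2) by simp
    qed
    then obtain l where l: "\<forall>a\<in>J. \<forall>b\<in>J. schur j A a b = (\<Sum>k\<in>J. l k a * l k b)" by blast
    show ?thesis
    proof (intro exI ballI)
      fix a b assume ab: "a \<in> insert j J" "b \<in> insert j J"
      \<comment> \<open>The new row is column \<open>j\<close> divided by the root of the pivot; the
        old rows are extended by 0 at \<open>j\<close>, so they contribute the Schur complement
        alone.\<close>
      let ?l = "\<lambda>k a. if k = j then A a j / sqrt (A j j) else if a = j then 0 else l k a"
      have j: "?l j a * ?l j b = A a j * A b j / A j j" using pos by simp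
      show "A a b = (\<Sum>k\<in>insert j J. ?l k a * ?l k b)"
      proof (cases "a = j \<or> b = j")
        case True
        have "(\<Sum>k\<in>J. ?l k a * ?l k b) = 0" using True insert.hyps(2) by (intro sum.neutral) auto
        then show ?thesis using insert.hyps True pos ab sym unfolding sum.insert[OF insert.hyps] j by auto
      next
        case False
        then have "schur j A a b = (\<Sum>k\<in>J. l k a * l k b)" using l ab by auto
        also have "\<dots> = (\<Sum>k\<in>J. ?l k a * ?l k b)" using False insert.hyps(2) by (intro sum.cong) auto
        finally show ?thesis using sym ab False unfolding sum.insert[OF insert.hyps] j by (auto simp: schur_def)
      qed
    qed
  qed
qed simp

text \<open>Gaussian elimination carried out for all \<open>\<omega>\<close> at once. Positive
  definiteness keeps each pivot positive, so the solution arises by measurable arithmetic; the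
  inverse \<open>minv\<close>, defined by a choice, gets its measurability from here.\<close>

lemma pd_solve_measurable:
  assumes "finite J" 
    and "\<And>a b. a \<in> J \<Longrightarrow> b \<in> J \<Longrightarrow> (\<lambda>\<omega>. A \<omega> a b) \<in> borel_measurable M"
    and "\<And>\<omega> a b. \<omega> \<in> space M \<Longrightarrow> a \<in> J \<Longrightarrow> b \<in> J \<Longrightarrow> A \<omega> a b = A \<omega> b a"
    and "\<And>\<omega> c. \<omega> \<in> space M \<Longrightarrow> \<exists>a\<in>J. c a \<noteq> 0 \<Longrightarrow> quad J (A \<omega>) c > 0"
    and "\<And>a. a \<in> J \<Longrightarrow> y a \<in> borel_measurable M"
  shows "\<exists>x. (\<forall>a\<in>J. x a \<in> borel_measurable M) \<and> (\<forall>\<omega>\<in>space M. \<forall>a\<in>J. (\<Sum>b\<in>J. A \<omega> a b * x b \<omega>) = (y a \<omega> :: real))"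
  using assms
proof (induction J arbitrary: A y rule: finite_induct)
  case (insert j J)
  have [measurable]: "(\<lambda>\<omega>. A \<omega> a j) \<in> borel_measurable M" "(\<lambda>\<omega>. A \<omega> j a) \<in> borel_measurable M" "y a \<in> borel_measurable M"
      "(\<lambda>\<omega>. A \<omega> j j) \<in> borel_measurable M" "y j \<in> borel_measurable M" if "a \<in> J" for a
    using insert.prems(1,4) that by auto
  have [measurable]: "(\<lambda>\<omega>. A \<omega> j j) \<in> borel_measurable M" "y j \<in> borel_measurable M" using insert.prems(1,4) by auto
  have sym: "\<And>\<omega> a. \<omega> \<in> space M \<Longrightarrow> a \<in> J \<Longrightarrow> A \<omega> j a = A \<omega> a j" using insert.prems(2) by blast
  have pos: "A \<omega> j j > 0" if w: "\<omega> \<in> space M" for \<omega>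
  proof -
    have "quad (insert j J) (A \<omega>) (\<lambda>a. if a = j then 1 else 0) > 0"
      by (rule insert.prems(3)[OF w]) auto
    moreover have "quad J (A \<omega>) (\<lambda>a. if a = j then 1 else 0) = quad J (A \<omega>) (\<lambda>_. 0)"
      using insert.hyps(2) by (intro quad_cong) auto
    moreover have "(\<Sum>a\<in>J. (if a = j then 1 else 0) * A \<omega> a j) = 0" using insert.hyps(2) by (intro sum.neutral) auto
    ultimately show ?thesis using quad_insert[OF insert.hyps(1,2), of "A \<omega>", OF sym[OF w]] by (simp add: quad_def)
  qed
  have "\<exists>x. (\<forall>a\<in>J. x a \<in> borel_measurable M) \<and> (\<forall>\<omega>\<in>space M. \<forall>a\<in>J. (\<Sum>b\<in>J. schur j (A \<omega>) a b * x b \<omega>) = y a \<omega> - A \<omega> a j * y j \<omega> / A \<omega> j j)"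
  proof (rule insert.IH[of "\<lambda>\<omega>. schur j (A \<omega>)" "\<lambda>a \<omega>. y a \<omega> - A \<omega> a j * y j \<omega> / A \<omega> j j"])
    show "(\<lambda>\<omega>. schur j (A \<omega>) a b) \<in> borel_measurable M" if "a \<in> J" "b \<in> J" for a b
      using insert.prems(1)[of a b] that unfolding schur_def by auto
    show "schur j (A \<omega>) a b = schur j (A \<omega>) b a" if "\<omega> \<in> space M" "a \<in> J" "b \<in> J" for \<omega> a b 
      using insert.prems(2)[of \<omega> a b] sym that by (simp add: schur_def)
    show "0 < quad J (schur j (A \<omega>)) c" if w: "\<omega> \<in> space M" and c: "\<exists>a\<in>J. c a \<noteq> 0" for \<omega> c
    proof -
      have "quad (insert j J) (A \<omega>) (c(j := - (\<Sum>a\<in>J. c a * A \<omega> a j) / A \<omega> j j)) > 0"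
        using c insert.hyps(2) by (intro insert.prems(3)[OF w]) auto
      then show ?thesis using quad_schur[of J j "A \<omega>" c] insert.hyps sym[OF w] pos[OF w] by simp
    qed
  qed measurable
  then obtain x where xm: "\<And>a. a \<in> J \<Longrightarrow> x a \<in> borel_measurable M" 
    and x: "\<And>\<omega> a. \<omega> \<in> space M \<Longrightarrow> a \<in> J \<Longrightarrow> (\<Sum>b\<in>J. schur j (A \<omega>) a b * x b \<omega>) = y a \<omega> - A \<omega> a j * y j \<omega> / A \<omega> j j"
    by blast
  \<comment> \<open>Back substitution: the remaining coordinate is read off from equation
    \<open>j\<close>.\<close>
  define z where "z b \<omega> = (if b = j then (y j \<omega> - (\<Sum>b\<in>J. A \<omega> j b * x b \<omega>)) / A \<omega> j j else x b \<omega>)" for b \<omega>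
  show ?case
  proof (intro exI conjI ballI)
    fix a assume "a \<in> insert j J"
    then show "z a \<in> borel_measurable M"
    proof (cases "a = j")
      case True
      have [measurable]: "(\<lambda>\<omega>. \<Sum>b\<in>J. A \<omega> j b * x b \<omega>) \<in> borel_measurable M"
        by (intro borel_measurable_sum borel_measurable_times xm) auto
      show ?thesis using True unfolding z_def by simp
    next
      case False
      then have "z a = x a" by (auto simp: z_def)
      then show ?thesis using False \<open>a \<in> insert j J\<close> xm by auto
    qed
  next
    fix \<omega> a assume w: "\<omega> \<in> space M" and a: "a \<in> insert j J"
    let ?s = "\<Sum>b\<in>J. A \<omega> j b * x b \<omega>"
    have zs: "(\<Sum>b\<in>J. A \<omega> a b * z b \<omega>) = (\<Sum>b\<in>J. A \<omega> a b * x b \<omega>)" for a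
      using insert.hyps(2) by (intro sum.cong refl) (auto simp: z_def)
    have eq: "(\<Sum>b\<in>insert j J. A \<omega> a b * z b \<omega>) = A \<omega> a j * ((y j \<omega> - ?s) / A \<omega> j j) + (\<Sum>b\<in>J. A \<omega> a b * x b \<omega>)"
      unfolding sum.insert[OF insert.hyps] zs by (simp add: z_def)
    show "(\<Sum>b\<in>insert j J. A \<omega> a b * z b \<omega>) = y a \<omega>"
    proof (cases "a = j")
      case True
      then show ?thesis unfolding eq using pos[OF w] by (simp add: field_simps)
    next
      case False
      then have "a \<in> J" using a by simp
      have "(\<Sum>b\<in>J. A \<omega> a b * x b \<omega>) = (\<Sum>b\<in>J. schur j (A \<omega>) a b * x b \<omega> + A \<omega> a j / A \<omega> j j * (A \<omega> j b * x b \<omega>))"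
        by (intro sum.cong refl) (simp add: schur_def algebra_simps)
      also have "\<dots> = y a \<omega> - A \<omega> a j * y j \<omega> / A \<omega> j j + A \<omega> a j / A \<omega> j j * ?s"
        using x[OF w \<open>a \<in> J\<close>] by (simp add: sum.distrib sum_distrib_left)
      finally show ?thesis unfolding eq using pos[OF w] by (simp add: field_simps)
    qed
  qed
qed simp

section \<open>Symmetric matrices on index ranges and their inverses\<close>

definition mvec :: "nat \<Rightarrow> (nat \<Rightarrow> nat \<Rightarrow> real) \<Rightarrow> (nat \<Rightarrow> real) \<Rightarrow> nat \<Rightarrow> real" where
  "mvec N A x a = (\<Sum>b<N. A a b * x b)"

definition dot :: "nat \<Rightarrow> (nat \<Rightarrow> real) \<Rightarrow> (nat \<Rightarrow> real) \<Rightarrow> real" where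
  "dot N x y = (\<Sum>a<N. x a * y a)"

definition sym_on :: "nat \<Rightarrow> (nat \<Rightarrow> nat \<Rightarrow> real) \<Rightarrow> bool" where
  "sym_on N A \<longleftrightarrow> (\<forall>a<N. \<forall>b<N. A a b = A b a)"

lemma bform_eq_dot: "bform N A u v = dot N u (mvec N A v)"
  by (simp add: bform_def dot_def mvec_def sum_distrib_left mult.assoc)

lemma bform_eq_quad: "bform N A c c = quad {..<N} A c"
  by (simp add: bform_def quad_def)

lemma bform_sym_on: "sym_on N A \<Longrightarrow> bform N A u v = bform N A v u"
  by (rule bform_sym) (auto simp: sym_on_def)

lemma dot_commute: "dot N x y = dot N y x"
  by (simp add: dot_def mult.commute)

lemma dot_self_nonneg: "dot N x x \<ge> 0"
  by (simp add: dot_def sum_nonneg)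

lemma dot_self_eq_0: "dot N x x = 0 \<Longrightarrow> a < N \<Longrightarrow> x a = 0"
  unfolding dot_def by (subst (asm) sum_nonneg_eq_0_iff) auto

lemma dot_self_pos: "a < N \<Longrightarrow> x a \<noteq> 0 \<Longrightarrow> dot N x x > 0"
  using dot_self_eq_0[of N x a] dot_self_nonneg[of N x] by fastforce

lemma dot_Cauchy_Schwarz: "(dot N x y)\<^sup>2 \<le> dot N x x * dot N y y"
  unfolding dot_def using Cauchy_Schwarz_ineq_sum[of x y "{..<N}"] by (simp add: power2_eq_square)

lemma bform_Cauchy_Schwarz:
  assumes s: "sym_on N A" and p: "\<And>c. bform N A c c \<ge> 0"
  shows "(bform N A x y)\<^sup>2 \<le> bform N A x x * bform N A y y"
proof -
  obtain l where l: "\<forall>a\<in>{..<N}. \<forall>b\<in>{..<N}. A a b = (\<Sum>k\<in>{..<N}. l k a * l k b)"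
    using psd_factor[of "{..<N}" A] s p by (auto simp: sym_on_def bform_eq_quad)
  have "bform N A u v = dot N (\<lambda>k. dot N (l k) u) (\<lambda>k. dot N (l k) v)" for u v
  proof -
    have "bform N A u v = (\<Sum>a<N. \<Sum>b<N. \<Sum>k<N. (l k a * u a) * (l k b * v b))"
      unfolding bform_def using l by (intro sum.cong refl) (simp add: sum_distrib_left sum_distrib_right mult_ac)
    also have "\<dots> = (\<Sum>k<N. \<Sum>a<N. \<Sum>b<N. (l k a * u a) * (l k b * v b))"
      by (subst (2) sum.swap, subst sum.swap) (rule refl)
    finally show ?thesis unfolding dot_def sum_product .
  qed
  then show ?thesis using dot_Cauchy_Schwarz by simp
qed

lemma bform_idm: "bform N idm u v = dot N u v"
proof -
  have "(\<Sum>b<N. idm a b * v b) = v a" if "a < N" for a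
    using that by (simp add: idm_def if_distrib[of "\<lambda>z. z * _"] cong: if_cong)
  then show ?thesis unfolding bform_eq_dot mvec_def dot_def by (intro sum.cong) auto
qed

lemma mmul_assoc: "mmul N (mmul N A B) C = mmul N A (mmul N B C)"
proof (intro ext)
  fix i j
  have "mmul N (mmul N A B) C i j = (\<Sum>l<N. \<Sum>k<N. A i k * B k l * C l j)"
    by (simp add: mmul_def sum_distrib_right)
  also have "\<dots> = (\<Sum>k<N. \<Sum>l<N. A i k * B k l * C l j)" by (rule sum.swap)
  finally show "mmul N (mmul N A B) C i j = mmul N A (mmul N B C) i j"
    by (simp add: mmul_def sum_distrib_left mult.assoc)
qed

lemma mvec_mmul: "mvec N (mmul N A B) x = mvec N A (mvec N B x)"
proof
  fix i
  have "mvec N (mmul N A B) x i = (\<Sum>l<N. \<Sum>k<N. A i k * B k l * x l)"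
    by (simp add: mmul_def mvec_def sum_distrib_right)
  also have "\<dots> = (\<Sum>k<N. \<Sum>l<N. A i k * B k l * x l)" by (rule sum.swap)
  finally show "mvec N (mmul N A B) x i = mvec N A (mvec N B x) i"
    by (simp add: mvec_def sum_distrib_left mult.assoc)
qed

lemma dot_mvec_sym: "sym_on N A \<Longrightarrow> dot N (mvec N A u) v = dot N u (mvec N A v)"
  by (metis bform_eq_dot bform_sym_on dot_commute)

lemma bform_conj:
  assumes "sym_on N P"
  shows "bform N (mmul N (mmul N P Q) P) u v = bform N Q (mvec N P u) (mvec N P v)"
  unfolding bform_eq_dot mvec_mmul by (rule dot_mvec_sym[OF assms, symmetric])

lemma bform_mvec_single:
  assumes "a < N" shows "bform N A (\<lambda>b. if b = a then 1 else 0) v = mvec N A v a"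
  using assms by (simp add: bform_eq_dot dot_def if_distrib[of "\<lambda>z. z * _"] cong: if_cong)

lemma sym_pd_sym_on: "sym_pd N A \<Longrightarrow> sym_on N A"
  by (simp add: sym_pd_def sym_on_def)

lemma sym_pd_pos: "sym_pd N A \<Longrightarrow> a < N \<Longrightarrow> c a \<noteq> 0 \<Longrightarrow> bform N A c c > 0"
  unfolding sym_pd_def by blast

lemma sym_pd_mvec_inj:
  assumes A: "sym_pd N A" and eq: "\<And>a. a < N \<Longrightarrow> mvec N A x a = mvec N A y a" and a: "a < N"
  shows "x a = y a"
proof (rule ccontr)
  assume "x a \<noteq> y a"
  then have "bform N A (\<lambda>a. x a - y a) (\<lambda>a. x a - y a) > 0"
    using A a by (intro sym_pd_pos[OF A a]) auto
  moreover have "mvec N A (\<lambda>a. x a - y a) b = 0" if "b < N" for b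
    using eq[OF that] by (simp add: mvec_def right_diff_distrib sum_subtractf)
  then have "bform N A (\<lambda>a. x a - y a) (\<lambda>a. x a - y a) = 0"
    by (simp add: bform_eq_dot dot_def)
  ultimately show False by simp
qed

lemma sym_pd_inverse_measurable:
  assumes m: "\<And>a b. a < N \<Longrightarrow> b < N \<Longrightarrow> (\<lambda>\<omega>. A \<omega> a b) \<in> borel_measurable M"
    and A: "\<And>\<omega>. \<omega> \<in> space M \<Longrightarrow> sym_pd N (A \<omega>)"
  obtains B where "\<And>a b. a < N \<Longrightarrow> b < N \<Longrightarrow> (\<lambda>\<omega>. B \<omega> a b) \<in> borel_measurable M"
    and "\<And>\<omega> a b. \<omega> \<in> space M \<Longrightarrow> a < N \<Longrightarrow> b < N \<Longrightarrow> mmul N (A \<omega>) (B \<omega>) a b = idm a b"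
proof -
  have "\<exists>x. (\<forall>a\<in>{..<N}. x a \<in> borel_measurable M) \<and> (\<forall>\<omega>\<in>space M. \<forall>a\<in>{..<N}. (\<Sum>b\<in>{..<N}. A \<omega> a b * x b \<omega>) = idm a c)" for c
  proof (rule pd_solve_measurable)
    show "0 < quad {..<N} (A \<omega>) d" if "\<omega> \<in> space M" "\<exists>a\<in>{..<N}. d a \<noteq> 0" for \<omega> d
      using A[OF that(1)] that(2) unfolding sym_pd_def bform_eq_quad by auto
    show "A \<omega> a b = A \<omega> b a" if "\<omega> \<in> space M" "a \<in> {..<N}" "b \<in> {..<N}" for \<omega> a b
      using A[OF that(1)] that unfolding sym_pd_def by auto
  qed (use m in auto)
  then obtain x where x: "\<And>c. \<forall>a\<in>{..<N}. x c a \<in> borel_measurable M"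
      "\<And>c. \<forall>\<omega>\<in>space M. \<forall>a\<in>{..<N}. (\<Sum>b\<in>{..<N}. A \<omega> a b * x c b \<omega>) = idm a c"
    by metis
  show ?thesis by (rule that[of "\<lambda>\<omega> a c. x c a \<omega>"]) (use x in \<open>auto simp: mmul_def\<close>)
qed

text \<open>Pins down the choice in \<open>minv\<close>. A right inverse is unique since a definite
  matrix is injective, and it is also a left inverse because \<open>A (B A) = A = A I\<close>; the
  entries outside the range are zero by convention.\<close>

lemma minv_eqI:
  assumes A: "sym_pd N A" and B: "\<And>a b. a < N \<Longrightarrow> b < N \<Longrightarrow> mmul N A B a b = idm a b"
  shows "\<And>a b. a < N \<Longrightarrow> b < N \<Longrightarrow> minv N A a b = B a b"
    and "\<And>a b. N \<le> a \<or> N \<le> b \<Longrightarrow> minv N A a b = 0"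
proof -
  define P where "P C \<longleftrightarrow> (\<forall>i<N. \<forall>j<N. mmul N A C i j = idm i j \<and> mmul N C A i j = idm i j)
                     \<and> (\<forall>i j. (N \<le> i \<or> N \<le> j) \<longrightarrow> C i j = 0)" for C
  have sA: "\<And>a b. a < N \<Longrightarrow> b < N \<Longrightarrow> A a b = A b a" using A by (simp add: sym_pd_def)
  have uniq: "C a b = B a b" if C: "\<And>i j. i < N \<Longrightarrow> j < N \<Longrightarrow> mmul N A C i j = idm i j" and ab: "a < N" "b < N" for C a b
  proof (rule sym_pd_mvec_inj[OF A _ ab(1), of "\<lambda>i. C i b" "\<lambda>i. B i b"])
    fix i assume "i < N"
    then show "mvec N A (\<lambda>i. C i b) i = mvec N A (\<lambda>i. B i b) i"
      using C[of i b] B[of i b] ab by (simp add: mmul_def mvec_def)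
  qed
  define B' where "B' i j = (if i < N \<and> j < N then B i j else 0)" for i j
  have BA: "mmul N B A i j = idm i j" if ij: "i < N" "j < N" for i j
  proof -
    define C where "C i j = mmul N B A i j" for i j
    have "(\<Sum>k<N. A i k * (C k j - idm k j)) = 0" if "i < N" for i
    proof -
      have "(\<Sum>k<N. A i k * C k j) = mmul N A (mmul N B A) i j" by (simp add: C_def mmul_def)
      also have "\<dots> = (\<Sum>k<N. mmul N A B i k * A k j)" by (subst mmul_assoc[symmetric]) (simp add: mmul_def)
      also have "\<dots> = (\<Sum>k<N. idm i k * A k j)" using that B by (intro sum.cong) auto
      also have "\<dots> = A i j" using that by (simp add: idm_def if_distrib[of "\<lambda>z. z * _"] cong: if_cong)
      finally have 1: "(\<Sum>k<N. A i k * C k j) = A i j" .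
      have "(\<Sum>k<N. A i k * idm k j) = A i j" using ij by (simp add: idm_def if_distrib[of "\<lambda>z. _ * z"] cong: if_cong)
      with 1 show ?thesis by (simp add: right_diff_distrib sum_subtractf)
    qed
    then have "mvec N A (\<lambda>k. C k j) i = mvec N A (\<lambda>k. idm k j) i" if "i < N" for i
      using that by (simp add: mvec_def right_diff_distrib sum_subtractf)
    then show ?thesis using sym_pd_mvec_inj[OF A _ ij(1), of "\<lambda>k. C k j" "\<lambda>k. idm k j"] by (simp add: C_def)
  qed
  have "P B'"
    unfolding P_def
  proof (intro conjI allI impI)
    fix i j assume "i < N" "j < N"
    then show "mmul N A B' i j = idm i j" "mmul N B' A i j = idm i j"
      using B[of i j] BA[of i j] by (simp_all add: B'_def mmul_def)
  qed (auto simp: B'_def)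
  then have "P (minv N A)" unfolding minv_def P_def[symmetric] by (rule someI[of P])
  then show "\<And>a b. a < N \<Longrightarrow> b < N \<Longrightarrow> minv N A a b = B a b"
    and "\<And>a b. N \<le> a \<or> N \<le> b \<Longrightarrow> minv N A a b = 0"
    unfolding P_def by (auto intro!: uniq)
qed

lemma minv_cong:
  assumes "\<And>a b. a < N \<Longrightarrow> b < N \<Longrightarrow> A a b = A' a b"
  shows "minv N A = minv N A'"
proof -
  have "mmul N A B i j = mmul N A' B i j" "mmul N B A i j = mmul N B A' i j" if "i < N" "j < N" for B i j
    using that assms by (auto simp: mmul_def intro!: sum.cong)
  then show ?thesis unfolding minv_def by (intro arg_cong[where f = Hilbert_Choice.Eps] ext) auto
qed

lemma minv_measurable:
  assumes m: "\<And>a b. a < N \<Longrightarrow> b < N \<Longrightarrow> (\<lambda>\<omega>. A \<omega> a b) \<in> borel_measurable M"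
    and A: "\<And>\<omega>. \<omega> \<in> space M \<Longrightarrow> sym_pd N (A \<omega>)"
  shows "(\<lambda>\<omega>. minv N (A \<omega>) a b) \<in> borel_measurable M"
proof -
  obtain B where B: "\<And>a b. a < N \<Longrightarrow> b < N \<Longrightarrow> (\<lambda>\<omega>. B \<omega> a b) \<in> borel_measurable M"
    "\<And>\<omega> a b. \<omega> \<in> space M \<Longrightarrow> a < N \<Longrightarrow> b < N \<Longrightarrow> mmul N (A \<omega>) (B \<omega>) a b = idm a b"
    using sym_pd_inverse_measurable[OF assms] by metis
  show ?thesis
  proof (cases "a < N \<and> b < N")
    case True
    have "minv N (A \<omega>) a b = B \<omega> a b" if "\<omega> \<in> space M" for \<omega>
      using minv_eqI(1)[OF A B(2)] True that by auto
    then show ?thesis using B(1)[of a b] True by (subst measurable_cong) auto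
  next
    case False
    have "minv N (A \<omega>) a b = 0" if "\<omega> \<in> space M" for \<omega>
      using minv_eqI(2)[OF A B(2)] False that by (auto simp: not_less)
    then show ?thesis by (subst measurable_cong) auto
  qed
qed

lemma minv_mmul:
  assumes A: "sym_pd N A" and ab: "a < N" "b < N"
  shows "mmul N A (minv N A) a b = idm a b"
proof -
  \<comment> \<open>A one-point measurable space, which reduces the bare existence of an inverse to
    the measurable version.\<close>
  define M where "M = count_space (UNIV :: unit set)"
  obtain B where B: "\<And>a b. a < N \<Longrightarrow> b < N \<Longrightarrow> mmul N A (B ()) a b = idm a b"
    using sym_pd_inverse_measurable[of N "\<lambda>_. A" M] A by (auto simp: M_def)
  have "mmul N A (minv N A) a b = mmul N A (B ()) a b"
    unfolding mmul_def using minv_eqI(1)[OF A B] ab by (intro sum.cong) auto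
  then show ?thesis using B ab by simp
qed

lemma mvec_minv:
  assumes A: "sym_pd N A" and a: "a < N"
  shows "mvec N A (mvec N (minv N A) x) a = x a"
proof -
  have "mvec N A (mvec N (minv N A) x) a = (\<Sum>b<N. mmul N A (minv N A) a b * x b)"
    unfolding mvec_mmul[symmetric] by (simp add: mvec_def)
  also have "\<dots> = (\<Sum>b<N. idm a b * x b)" using minv_mmul[OF A a] by (intro sum.cong) auto
  also have "\<dots> = x a" using a by (simp add: idm_def if_distrib[of "\<lambda>z. z * _"] cong: if_cong)
  finally show ?thesis .
qed

lemma bform_minv:
  assumes A: "sym_pd N A"
  shows "bform N (minv N A) x y = bform N A (mvec N (minv N A) x) (mvec N (minv N A) y)"
proof -
  have "bform N A (mvec N (minv N A) x) (mvec N (minv N A) y) = bform N A (mvec N (minv N A) y) (mvec N (minv N A) x)"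
    by (rule bform_sym_on[OF sym_pd_sym_on[OF A]])
  also have "\<dots> = dot N (mvec N (minv N A) y) x"
    unfolding bform_eq_dot dot_def by (intro sum.cong refl) (simp add: mvec_minv[OF A])
  also have "\<dots> = bform N (minv N A) x y" by (simp add: bform_eq_dot dot_commute)
  finally show ?thesis ..
qed

lemma sym_on_minv: "sym_pd N A \<Longrightarrow> sym_on N (minv N A)"
  unfolding sym_on_def
proof (intro allI impI)
  fix a b assume A: "sym_pd N A" and ab: "a < N" "b < N"
  let ?e = "\<lambda>a b. if b = a then 1 else (0::real)"
  have c: "bform N (minv N A) x y = bform N (minv N A) y x" for x y
    unfolding bform_minv[OF A] by (rule bform_sym_on[OF sym_pd_sym_on[OF A]])
  have v: "mvec N (minv N A) (?e b) a = minv N A a b" if "b < N" for a b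
    using that by (simp add: mvec_def if_distrib[of "\<lambda>z. _ * z"] cong: if_cong)
  show "minv N A a b = minv N A b a"
    using c[of "?e a" "?e b"] ab by (simp add: bform_mvec_single v)
qed

lemma bform_minv_nonneg: "sym_pd N A \<Longrightarrow> bform N (minv N A) x x \<ge> 0"
  by (subst bform_minv) (auto intro: sym_pd_bform_nonneg)

text \<open>With \<open>y = A\<^sup>-\<^sup>1 x\<close> one has
  \<open>lam * |y|\<^sup>2 \<le> y . A y = y . x \<le> |y| |x|\<close>, so the operator norm of the
  inverse is at most \<open>1 / lam\<close>.\<close>

lemma minv_shift_bound:
  assumes lam: "lam > 0" and A: "sym_pd N A" and low: "\<And>c. bform N A c c \<ge> lam * dot N c c"
  shows "dot N (mvec N (minv N A) x) (mvec N (minv N A) x) \<le> dot N x x / lam\<^sup>2"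
proof -
  define y where "y = mvec N (minv N A) x"
  have "lam * dot N y y \<le> bform N A y y" by (rule low)
  also have "\<dots> = dot N y x"
    unfolding bform_eq_dot dot_def y_def by (intro sum.cong refl) (simp add: mvec_minv[OF A])
  finally have 1: "lam * dot N y y \<le> dot N y x" .
  have "(lam * dot N y y)\<^sup>2 \<le> (dot N y x)\<^sup>2"
    using 1 lam dot_self_nonneg[of N y] by (intro power_mono) auto
  also have "\<dots> \<le> dot N y y * dot N x x" by (rule dot_Cauchy_Schwarz)
  finally have "dot N y y * (lam\<^sup>2 * dot N y y) \<le> dot N y y * dot N x x"
    by (simp add: power2_eq_square mult_ac)
  then have "lam\<^sup>2 * dot N y y \<le> dot N x x"
    using dot_self_nonneg[of N y] dot_self_nonneg[of N x]
    by (cases "dot N y y = 0") (auto simp: mult_le_cancel_left)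
  then show ?thesis unfolding y_def[symmetric] using lam by (simp add: field_simps)
qed

section \<open>Trace identities, variance bounds and eigenvalues\<close>

lemma mtrace_mmul_factor:
  assumes A: "\<And>a b. a < N \<Longrightarrow> b < N \<Longrightarrow> A a b = (\<Sum>k<N. l k a * l k b)" and T: "sym_on N T"
  shows "mtrace N (mmul N A T) = (\<Sum>k<N. bform N T (l k) (l k))"
proof -
  have "mtrace N (mmul N A T) = (\<Sum>a<N. \<Sum>b<N. \<Sum>k<N. l k a * T a b * l k b)"
    unfolding mtrace_def mmul_def using T A
    by (intro sum.cong refl) (simp add: sum_distrib_left sum_distrib_right sym_on_def mult_ac)
  also have "\<dots> = (\<Sum>k<N. \<Sum>a<N. \<Sum>b<N. l k a * T a b * l k b)"
    by (subst (2) sum.swap, subst sum.swap) (rule refl)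
  finally show ?thesis unfolding bform_def .
qed

lemma bform_factor:
  assumes A: "\<And>a b. a < N \<Longrightarrow> b < N \<Longrightarrow> A a b = (\<Sum>k<N. l k a * l k b)"
  shows "bform N A x x = (\<Sum>k<N. (dot N (l k) x)\<^sup>2)"
proof -
  have "bform N A x x = (\<Sum>a<N. \<Sum>b<N. \<Sum>k<N. (l k a * x a) * (l k b * x b))"
    unfolding bform_def by (intro sum.cong refl) (simp add: A sum_distrib_left sum_distrib_right mult_ac)
  also have "\<dots> = (\<Sum>k<N. \<Sum>a<N. \<Sum>b<N. (l k a * x a) * (l k b * x b))"
    by (subst (2) sum.swap, subst sum.swap) (rule refl)
  finally show ?thesis unfolding dot_def power2_eq_square sum_product .
qed

lemma sym_on_conj: 
  assumes "sym_on N P" "sym_on N Q" shows "sym_on N (mmul N (mmul N P Q) P)"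
  unfolding sym_on_def
proof (intro allI impI)
  fix a b assume ab: "a < N" "b < N"
  let ?e = "\<lambda>a b. if b = a then 1 else (0::real)"
  let ?R = "mmul N (mmul N P Q) P"
  have v: "mvec N ?R (?e b) a = ?R a b" if "b < N" for a b
    using that by (simp add: mvec_def if_distrib[of "\<lambda>z. _ * z"] cong: if_cong)
  have "bform N ?R (?e a) (?e b) = bform N ?R (?e b) (?e a)"
    unfolding bform_conj[OF assms(1)] by (rule bform_sym_on[OF assms(2)])
  then show "?R a b = ?R b a" using ab by (simp add: bform_mvec_single v)
qed

text \<open>Rewrites the variance of a quadratic form as \<open>tr (A S A S)\<close>, a quantity
  independent of the factorisation. The inner sum is the form of \<open>A\<close> at
  \<open>S l\<close>, the outer one the trace of \<open>A\<close> against
  \<open>S A S\<close>.\<close>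

lemma quadratic_variance_trace:
  assumes A: "\<And>a b. a < N \<Longrightarrow> b < N \<Longrightarrow> A a b = (\<Sum>k<N. l k a * l k b)"
    and sA: "sym_on N A" and S: "sym_on N S"
  shows "(\<Sum>k<N. \<Sum>j<N. (bform N S (l k) (l j))\<^sup>2) = mtrace N (mmul N (mmul N (mmul N A S) A) S)"
proof -
  have "mtrace N (mmul N (mmul N (mmul N A S) A) S) = mtrace N (mmul N A (mmul N (mmul N S A) S))"
    by (simp add: mmul_assoc)
  also have "\<dots> = (\<Sum>k<N. bform N (mmul N (mmul N S A) S) (l k) (l k))"
    by (intro mtrace_mmul_factor A sym_on_conj S sA)
  also have "\<dots> = (\<Sum>k<N. \<Sum>j<N. (dot N (l j) (mvec N S (l k)))\<^sup>2)"
    unfolding bform_conj[OF S] by (intro sum.cong refl bform_factor A)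
  also have "\<dots> = (\<Sum>k<N. \<Sum>j<N. (bform N S (l k) (l j))\<^sup>2)"
    unfolding bform_eq_dot[symmetric] by (intro sum.cong refl arg_cong2[where f = power] bform_sym_on S)
  finally show ?thesis ..
qed

text \<open>With \<open>y = S x\<close>, Cauchy-Schwarz for the form \<open>S\<close> gives
  \<open>|y|^4 \<le> (y . S y) (x . S x)\<close>; bounding the first factor by
  \<open>u |y|\<^sup>2\<close> and cancelling leaves the claim.\<close>

lemma mvec_norm_bound:
  assumes S: "sym_on N S" and p: "\<And>c. bform N S c c \<ge> 0" and u: "\<And>c. bform N S c c \<le> u * dot N c c" and "u \<ge> 0"
  shows "dot N (mvec N S x) (mvec N S x) \<le> u * bform N S x x"
proof -
  let ?y = "mvec N S x"
  have "dot N ?y ?y * dot N ?y ?y = (bform N S ?y x)\<^sup>2" by (simp add: bform_eq_dot power2_eq_square)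
  also have "\<dots> \<le> bform N S ?y ?y * bform N S x x" by (rule bform_Cauchy_Schwarz[OF S p])
  also have "\<dots> \<le> u * dot N ?y ?y * bform N S x x" by (intro mult_right_mono u p)
  finally have "dot N ?y ?y * dot N ?y ?y \<le> dot N ?y ?y * (u * bform N S x x)" by (simp add: mult_ac)
  then show ?thesis
    using dot_self_nonneg[of N ?y] p[of x] \<open>u \<ge> 0\<close>
    by (cases "dot N ?y ?y = 0") (auto simp: mult_le_cancel_left)
qed

text \<open>The conditional variance of the form of \<open>W S W\<close> is a trace with four
  factors \<open>W\<close>, whose limit is not among the assumptions. Norm bounds for
  \<open>S\<close> and \<open>W\<close> strip two of these factors, leaving a multiple of
  \<open>tr (W S W S)\<close>. The constant \<open>k\<close> bounds the squared norm of
  \<open>W\<close>.\<close>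

lemma sandwich_variance_bound:
  assumes W: "sym_on N W" and Wb: "\<And>x. dot N (mvec N W x) (mvec N W x) \<le> k * dot N x x" and k: "k \<ge> 0"
    and S: "sym_on N S" and p: "\<And>c. bform N S c c \<ge> 0" and u: "\<And>c. bform N S c c \<le> u * dot N c c" and u0: "u \<ge> 0"
    and A: "\<And>a b. a < N \<Longrightarrow> b < N \<Longrightarrow> mmul N (mmul N W S) W a b = (\<Sum>k<N. l k a * l k b)"
  shows "(\<Sum>k<N. \<Sum>j<N. (bform N S (l k) (l j))\<^sup>2) \<le> u\<^sup>2 * k * mtrace N (mmul N (mmul N (mmul N W S) W) S)"
proof -
  have "(\<Sum>j<N. (bform N S (l i) (l j))\<^sup>2) \<le> u\<^sup>2 * k * bform N S (l i) (l i)" for i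
  proof -
    let ?y = "mvec N S (l i)"
    have "(\<Sum>j<N. (bform N S (l i) (l j))\<^sup>2) = (\<Sum>j<N. (dot N (l j) ?y)\<^sup>2)"
      unfolding bform_eq_dot[symmetric] by (intro sum.cong refl arg_cong2[where f = power] bform_sym_on S)
    also have "\<dots> = bform N (mmul N (mmul N W S) W) ?y ?y" by (rule bform_factor[OF A, symmetric])
    also have "\<dots> = bform N S (mvec N W ?y) (mvec N W ?y)" by (rule bform_conj[OF W])
    also have "\<dots> \<le> u * dot N (mvec N W ?y) (mvec N W ?y)" by (rule u)
    also have "\<dots> \<le> u * (k * dot N ?y ?y)" by (intro mult_left_mono Wb u0)
    also have "\<dots> \<le> u * (k * (u * bform N S (l i) (l i)))"
      by (intro mult_left_mono mvec_norm_bound S p u u0 k)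
    finally show ?thesis by (simp add: power2_eq_square mult_ac)
  qed
  then have "(\<Sum>i<N. \<Sum>j<N. (bform N S (l i) (l j))\<^sup>2) \<le> (\<Sum>i<N. u\<^sup>2 * k * bform N S (l i) (l i))"
    by (intro sum_mono)
  also have "\<dots> = u\<^sup>2 * k * mtrace N (mmul N (mmul N (mmul N W S) W) S)"
    unfolding sum_distrib_left[symmetric] by (subst mtrace_mmul_factor[OF A S]) auto
  finally show ?thesis .
qed

text \<open>\<open>lmax\<close> is a \<open>Max\<close> and has its intended meaning only for a
  finite set. If the set were infinite, \<open>N + 1\<close> eigenvalues would give as many
  orthonormal vectors; Bessel's inequality at each of the \<open>N\<close> unit vectors, summed,
  yields \<open>N + 1 \<le> N\<close>.\<close>

lemma finite_eigenvalues:
  assumes S: "sym_on N A"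
  shows "finite {l. is_eigenvalue N A l}"
proof (rule ccontr)
  assume "infinite {l. is_eigenvalue N A l}"
  then obtain F where F: "F \<subseteq> {l. is_eigenvalue N A l}" "finite F" "card F = Suc N"
    using infinite_arbitrarily_large by blast
  have "\<exists>v. dot N v v = 1 \<and> (\<forall>a<N. mvec N A v a = l * v a)" if "l \<in> F" for l
  proof -
    have "is_eigenvalue N A l" using F(1) that by auto
    then obtain v a where v: "a < N" "v a \<noteq> 0" "\<And>a. a < N \<Longrightarrow> mvec N A v a = l * v a"
      unfolding is_eigenvalue_def mvec_def by blast
    define s where "s = sqrt (dot N v v)"
    have s: "s > 0" "s\<^sup>2 = dot N v v" using dot_self_pos[of a N v] v(1,2) by (auto simp: s_def)
    have "dot N (\<lambda>a. v a / s) (\<lambda>a. v a / s) = dot N v v / s\<^sup>2"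
      by (simp add: dot_def power2_eq_square sum_divide_distrib)
    then have "dot N (\<lambda>a. v a / s) (\<lambda>a. v a / s) = 1" using s(1) unfolding s(2)[symmetric] by simp
    moreover have "mvec N A (\<lambda>a. v a / s) a = l * (v a / s)" if "a < N" for a
      using v(3)[OF that] by (simp add: mvec_def flip: sum_divide_distrib)
    ultimately show ?thesis by blast
  qed
  then obtain v where v1: "\<And>l. l \<in> F \<Longrightarrow> dot N (v l) (v l) = 1" 
    and v2: "\<And>l a. l \<in> F \<Longrightarrow> a < N \<Longrightarrow> mvec N A (v l) a = l * v l a" by metis
  have orth: "dot N (v l) (v m) = (if l = m then 1 else 0)" if lm: "l \<in> F" "m \<in> F" for l m
  proof -
    have "dot N (v l) (mvec N A (v m)) = m * dot N (v l) (v m)"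
      using v2[OF lm(2)] by (simp add: dot_def sum_distrib_left mult_ac)
    moreover have "dot N (mvec N A (v l)) (v m) = l * dot N (v l) (v m)"
      using v2[OF lm(1)] by (simp add: dot_def sum_distrib_left mult_ac)
    ultimately have "(l - m) * dot N (v l) (v m) = 0" using dot_mvec_sym[OF S, of "v l" "v m"] unfolding left_diff_distrib by linarith
    then show ?thesis using v1 lm by auto
  qed
  have bessel: "(\<Sum>l\<in>F. (v l a)\<^sup>2) \<le> 1" if a: "a < N" for a
  proof -
    let ?e = "\<lambda>b. if b = a then 1 else (0::real)"
    let ?p = "\<lambda>b. \<Sum>l\<in>F. v l a * v l b"
    have ee: "dot N ?e ?e = 1" using a by (simp add: dot_def if_distrib[of "\<lambda>z. z * _"] cong: if_cong)
    have ep: "dot N ?e ?p = (\<Sum>l\<in>F. (v l a)\<^sup>2)" using a by (simp add: dot_def if_distrib[of "\<lambda>z. z * _"] power2_eq_square cong: if_cong)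
    have "dot N ?p ?p = bform N idm ?p ?p" by (simp add: bform_idm)
    also have "\<dots> = (\<Sum>l\<in>F. \<Sum>m\<in>F. v l a * v m a * bform N idm (v l) (v m))"
      unfolding bform_sum_left bform_sum_right bform_scale_left bform_scale_right by (simp add: sum_distrib_left mult.assoc)
    also have "\<dots> = (\<Sum>l\<in>F. \<Sum>m\<in>F. v l a * v m a * (if l = m then 1 else 0))"
      by (intro sum.cong refl) (simp add: bform_idm orth)
    also have "\<dots> = (\<Sum>l\<in>F. (v l a)\<^sup>2)"
      using F(2) by (simp add: if_distrib[of "\<lambda>z. _ * z"] power2_eq_square cong: if_cong)
    finally have pp: "dot N ?p ?p = (\<Sum>l\<in>F. (v l a)\<^sup>2)" .
    have "0 \<le> dot N (\<lambda>b. ?e b - ?p b) (\<lambda>b. ?e b - ?p b)" by (rule dot_self_nonneg)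
    also have "\<dots> = dot N ?e ?e - 2 * dot N ?e ?p + dot N ?p ?p"
      unfolding bform_idm[symmetric] bform_diff_left bform_diff_right 
      unfolding bform_idm using dot_commute[of N ?p ?e] by simp
    finally show ?thesis using ee ep pp by simp
  qed
  have "real (card F) = (\<Sum>l\<in>F. dot N (v l) (v l))" using v1 by simp
  also have "\<dots> = (\<Sum>a<N. \<Sum>l\<in>F. (v l a)\<^sup>2)"
    unfolding dot_def power2_eq_square by (rule sum.swap)
  also have "\<dots> \<le> (\<Sum>a<N. 1)" by (intro sum_mono bessel) auto
  finally show False using F(3) by simp
qed

text \<open>The Rayleigh quotient attains its maximum on the unit sphere by compactness; the first
  variation there shows the maximiser to be an eigenvector, so the maximal value is at most
  \<open>lmax\<close>.\<close>

lemma bform_le_lmax: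
  assumes S: "sym_on N A"
  shows "bform N A x x \<le> lmax N A * dot N x x"
proof (cases "\<exists>a<N. x a \<noteq> 0")
  case False
  then show ?thesis by (simp add: bform_def dot_def)
next
  case True
  then have N: "N > 0" by auto
  \<comment> \<open>Vectors are functions on all of \<open>nat\<close>; pinning the coordinates from
    \<open>N\<close> on to 0 makes the box compact in the product topology.\<close>
  define I where "I a = (if a < N then {-1..1} else {0::real})" for a
  define B where "B = {v. \<forall>a. v a \<in> I a}"
  have "compactin (product_topology (\<lambda>_. euclidean) UNIV) (PiE UNIV I)"
    by (subst compactin_PiE) (simp add: I_def)
  also have "PiE UNIV I = B" unfolding B_def PiE_def extensional_def Pi_def by simp
  finally have cB: "compact B" by (simp add: euclidean_product_topology)
  have cd: "continuous_on T (\<lambda>v. dot N v v)" for T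
    unfolding dot_def by (intro continuous_intros continuous_on_subset[OF continuous_on_product_coordinates]) auto
  have cb: "continuous_on T (\<lambda>v. bform N A v v)" for T
    unfolding bform_def by (intro continuous_intros continuous_on_subset[OF continuous_on_product_coordinates]) auto
  define K where "K = B \<inter> {v. dot N v v = 1}"
  have "closed {v. dot N v v = 1}"
    by (rule closed_Collect_eq) (auto intro: cd continuous_intros)
  then have cK: "compact K" unfolding K_def using cB by (rule compact_Int_closed[rotated])
  have inK: "\<exists>w\<in>K. \<forall>a<N. w a = v a / sqrt (dot N v v)" if v: "dot N v v > 0" for v
  proof -
    define s where "s = sqrt (dot N v v)"
    have s: "s > 0" "s\<^sup>2 = dot N v v" using v by (auto simp: s_def)
    let ?w = "\<lambda>a. if a < N then v a / s else 0"
    have "dot N ?w ?w = dot N v v / s\<^sup>2"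
      by (simp add: dot_def power2_eq_square sum_divide_distrib)
    then have 1: "dot N ?w ?w = 1" using v by (simp only: s(2)) simp
    have "(?w a)\<^sup>2 \<le> 1" if "a < N" for a
      unfolding 1[symmetric] dot_def power2_eq_square by (rule member_le_sum) (use that in auto)
    then have "\<bar>?w a\<bar> \<le> 1" if "a < N" for a
      using that abs_square_le_1[of "?w a"] by blast
    then have "?w a \<in> I a" for a
      by (cases "a < N") (force simp: I_def abs_le_iff simp del: abs_divide)+
    then have "?w \<in> K" using 1 unfolding K_def B_def by blast
    then show ?thesis unfolding s_def[symmetric] by (intro bexI[of _ ?w]) auto
  qed
  have xpos: "dot N x x > 0" using True dot_self_pos by blast
  then have "K \<noteq> {}" using inK by blast
  then obtain v where v: "v \<in> K" "\<And>w. w \<in> K \<Longrightarrow> bform N A w w \<le> bform N A v v"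
    using continuous_attains_sup[OF cK _ cb] by blast
  define s where "s = bform N A v v"
  have vv: "dot N v v = 1" using v(1) by (simp add: K_def)
  have rayleigh: "bform N A w w \<le> s * dot N w w" for w
  proof (cases "dot N w w > 0")
    case True
    define r where "r = sqrt (dot N w w)"
    have r: "r > 0" "r\<^sup>2 = dot N w w" using True by (auto simp: r_def)
    obtain w' where w': "w' \<in> K" "\<And>a. a < N \<Longrightarrow> w' a = w a / r" using inK[OF True] r_def by auto
    have "bform N A w' w' = bform N A w w / r\<^sup>2"
      unfolding bform_def sum_divide_distrib by (intro sum.cong refl) (simp add: w' power2_eq_square)
    then have "bform N A w w / r\<^sup>2 \<le> s" using v(2)[OF w'(1)] by (simp add: s_def)
    then have "bform N A w w \<le> s * r\<^sup>2" using r(1) by (simp add: field_simps)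
    then show ?thesis using r by simp
  next
    case False
    then have "dot N w w = 0" using dot_self_nonneg[of N w] by simp
    then have "\<And>a. a < N \<Longrightarrow> w a = 0" using dot_self_eq_0 by blast
    then show ?thesis by (simp add: bform_def dot_def)
  qed
  \<comment> \<open>Each coordinate of the eigenvector equation comes from varying the maximiser
    along one unit vector.\<close>
  have ev: "mvec N A v a = s * v a" if a: "a < N" for a
  proof -
    let ?e = "\<lambda>b. if b = a then 1 else (0::real)"
    have "2 * (s * v a - mvec N A v a) = 0"
    proof (rule quadratic_linear_coeff_zero)
      fix t :: real
      let ?w = "\<lambda>b. v b + t * ?e b"
      have "bform N A ?w ?w = s + 2 * t * mvec N A v a + t\<^sup>2 * bform N A ?e ?e"
        unfolding bform_add_left bform_add_right bform_scale_left bform_scale_right 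
          bform_sym_on[OF S, of v ?e] bform_mvec_single[OF a, of A v] s_def
        by (simp add: algebra_simps power2_eq_square)
      moreover have "dot N ?w ?w = 1 + 2 * t * v a + t\<^sup>2 * dot N ?e ?e"
      proof -
        have "mvec N idm v a = v a" using a by (simp add: mvec_def idm_def if_distrib[of "\<lambda>z. z * _"] cong: if_cong)
        moreover have "sym_on N idm" by (simp add: sym_on_def idm_def)
        ultimately have "bform N idm ?w ?w = dot N v v + 2 * t * v a + t\<^sup>2 * bform N idm ?e ?e"
          unfolding bform_add_left bform_add_right bform_scale_left bform_scale_right 
           using bform_sym_on[of N idm v ?e] bform_mvec_single[OF a, of idm v]
          by (simp add: algebra_simps power2_eq_square bform_idm)
        then show ?thesis by (simp add: bform_idm vv)
      qed
      ultimately show "0 \<le> t * (2 * (s * v a - mvec N A v a)) + t\<^sup>2 * (s * dot N ?e ?e - bform N A ?e ?e)"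
        using rayleigh[of ?w] by (simp add: algebra_simps)
    qed
    then show ?thesis by simp
  qed
  have "\<exists>a<N. v a \<noteq> 0"
  proof (rule ccontr)
    assume "\<not> ?thesis"
    then have "dot N v v = 0" by (simp add: dot_def)
    then show False using vv by simp
  qed
  then have "is_eigenvalue N A s" using ev by (auto simp: is_eigenvalue_def mvec_def)
  then have "s \<le> lmax N A" unfolding lmax_def by (intro Max_ge finite_eigenvalues S) auto
  then show ?thesis
    using rayleigh[of x] mult_right_mono[OF _ dot_self_nonneg[of N x], of s "lmax N A"] by linarith
qed

section \<open>Conditioning on an independent block\<close>

context prob_space
begin

lemma indep_var_joint_distr:
  assumes "indep_var MX X MY Y"
  shows "distr M (MX \<Otimes>\<^sub>M MY) (\<lambda>\<omega>. (X \<omega>, Y \<omega>)) = distr M MX X \<Otimes>\<^sub>M distr M MY Y"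
  using assms by (subst (asm) indep_var_distribution_eq) simp

text \<open>Takes the place of a conditional expectation: the block \<open>X\<close> is frozen at
  one sample point while \<open>Y\<close> is integrated over another.\<close>

lemma nn_integral_indep_var:
  assumes ind: "indep_var MX X MY Y" and F: "F \<in> borel_measurable (MX \<Otimes>\<^sub>M MY)"
  shows "(\<integral>\<^sup>+\<omega>. F (X \<omega>, Y \<omega>) \<partial>M) = (\<integral>\<^sup>+\<omega>. \<integral>\<^sup>+\<omega>'. F (X \<omega>, Y \<omega>') \<partial>M \<partial>M)"
proof -
  have [measurable]: "X \<in> measurable M MX" "Y \<in> measurable M MY" using ind by (auto dest: indep_var_rv1 indep_var_rv2)
  interpret PX: prob_space "distr M MX X" by (rule prob_space_distr) simp
  interpret PY: prob_space "distr M MY Y" by (rule prob_space_distr) simp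
  note [measurable] = F
  have F': "F \<in> borel_measurable (distr M MX X \<Otimes>\<^sub>M distr M MY Y)" 
    using F by (subst measurable_cong_sets[OF sets_pair_measure_cong refl]) auto
  have "(\<integral>\<^sup>+\<omega>. F (X \<omega>, Y \<omega>) \<partial>M) = integral\<^sup>N (distr M (MX \<Otimes>\<^sub>M MY) (\<lambda>\<omega>. (X \<omega>, Y \<omega>))) F"
    by (subst nn_integral_distr) auto
  also have "\<dots> = (\<integral>\<^sup>+x. \<integral>\<^sup>+y. F (x, y) \<partial>distr M MY Y \<partial>distr M MX X)"
    unfolding indep_var_joint_distr[OF ind] by (rule PY.nn_integral_fst[symmetric, OF F'])
  also have "\<dots> = (\<integral>\<^sup>+\<omega>. \<integral>\<^sup>+y. F (X \<omega>, y) \<partial>distr M MY Y \<partial>M)"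
    by (subst nn_integral_distr) auto
  also have "\<dots> = (\<integral>\<^sup>+\<omega>. \<integral>\<^sup>+\<omega>'. F (X \<omega>, Y \<omega>') \<partial>M \<partial>M)"
  proof (rule nn_integral_cong)
    fix \<omega> assume "\<omega> \<in> space M"
    then have "X \<omega> \<in> space MX" using measurable_space[of X M MX] by simp
    then have "(\<lambda>y. F (X \<omega>, y)) \<in> borel_measurable MY" by measurable
    then show "(\<integral>\<^sup>+y. F (X \<omega>, y) \<partial>distr M MY Y) = (\<integral>\<^sup>+\<omega>'. F (X \<omega>, Y \<omega>') \<partial>M)"
      by (subst nn_integral_distr) auto
  qed
  finally show ?thesis .
qed

lemma integral_indep_var:
  fixes F :: "_ \<Rightarrow> 'c::{banach, second_countable_topology}"
  assumes ind: "indep_var MX X MY Y" and F: "F \<in> borel_measurable (MX \<Otimes>\<^sub>M MY)" and B: "\<And>x. norm (F x) \<le> B"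
  shows "(\<integral>\<omega>. F (X \<omega>, Y \<omega>) \<partial>M) = (\<integral>\<omega>. \<integral>\<omega>'. F (X \<omega>, Y \<omega>') \<partial>M \<partial>M)"
proof -
  have [measurable]: "X \<in> measurable M MX" "Y \<in> measurable M MY" using ind by (auto dest: indep_var_rv1 indep_var_rv2)
  interpret PX: prob_space "distr M MX X" by (rule prob_space_distr) simp
  interpret PY: prob_space "distr M MY Y" by (rule prob_space_distr) simp
  interpret PP: pair_prob_space "distr M MX X" "distr M MY Y" ..
  note [measurable] = F
  have F': "F \<in> borel_measurable (distr M MX X \<Otimes>\<^sub>M distr M MY Y)" 
    using F by (subst measurable_cong_sets[OF sets_pair_measure_cong refl]) auto
  have iF: "integrable (distr M MX X \<Otimes>\<^sub>M distr M MY Y) F"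
    by (rule PP.P.integrable_const_bound[of _ B]) (auto simp: B F')
  have "(\<integral>\<omega>. F (X \<omega>, Y \<omega>) \<partial>M) = integral\<^sup>L (distr M (MX \<Otimes>\<^sub>M MY) (\<lambda>\<omega>. (X \<omega>, Y \<omega>))) F"
    by (subst integral_distr) auto
  also have "\<dots> = (\<integral>x. \<integral>y. F (x, y) \<partial>distr M MY Y \<partial>distr M MX X)"
    unfolding indep_var_joint_distr[OF ind] by (rule PP.integral_fst'[symmetric, OF iF])
  also have "\<dots> = (\<integral>\<omega>. \<integral>y. F (X \<omega>, y) \<partial>distr M MY Y \<partial>M)"
    using PY.borel_measurable_lebesgue_integral[of "\<lambda>x y. F (x, y)" "distr M MX X"] F'
    by (subst integral_distr) auto
  also have "\<dots> = (\<integral>\<omega>. \<integral>\<omega>'. F (X \<omega>, Y \<omega>') \<partial>M \<partial>M)"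
  proof (rule Bochner_Integration.integral_cong[OF refl])
    fix \<omega> assume "\<omega> \<in> space M"
    then have "X \<omega> \<in> space MX" using measurable_space[of X M MX] by simp
    then have "(\<lambda>y. F (X \<omega>, y)) \<in> borel_measurable MY" by measurable
    then show "(\<integral>y. F (X \<omega>, y) \<partial>distr M MY Y) = (\<integral>\<omega>'. F (X \<omega>, Y \<omega>') \<partial>M)"
      by (subst integral_distr) auto
  qed
  finally show ?thesis .
qed

end

text \<open>Chebyshev's inequality is applied for frozen \<open>X\<close> on the event that the
  variance bound \<open>v\<close> lies below a threshold; in this way convergence of
  \<open>v\<close> in probability is enough, whatever its mean does.\<close>

lemma conditional_chebyshev:
  fixes q :: "nat \<Rightarrow> 'x \<times> 'x \<Rightarrow> real"
  assumes ps: "\<And>t. prob_space (M t)" and ind: "\<And>t. prob_space.indep_var (M t) (MX t) (X t) (MY t) (Y t)"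
    and qm: "\<And>t. q t \<in> borel_measurable (MX t \<Otimes>\<^sub>M MY t)" and vm: "\<And>t. v t \<in> borel_measurable (MX t)"
    and var: "\<And>t x. x \<in> space (MX t) \<Longrightarrow> (\<integral>\<^sup>+\<omega>. ennreal ((q t (x, Y t \<omega>))\<^sup>2) \<partial>M t) \<le> ennreal (v t x)"
    and v0: "((\<lambda>x. v (fst x) (X (fst x) (snd x))) \<longlongrightarrow> 0) (prob_filter M)"
  shows "((\<lambda>x. q (fst x) (X (fst x) (snd x), Y (fst x) (snd x))) \<longlongrightarrow> 0) (prob_filter M)"
proof (rule tendstoI)
  fix e :: real assume e: "e > 0"
  have "eventually (\<lambda>x. \<bar>q (fst x) (X (fst x) (snd x), Y (fst x) (snd x))\<bar> < e) (prob_filter M)"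
    unfolding eventually_prob_filter
  proof (intro allI impI)
    fix d :: real assume d: "d > 0"
    \<comment> \<open>Chebyshev's bound \<open>k / e\<^sup>2\<close> becomes \<open>d / 2\<close>,
      the other half of \<open>d\<close> being spent on the event that \<open>v\<close> is
      large.\<close>
    define k where "k = e\<^sup>2 * d / 2"
    have k: "k > 0" using e d by (simp add: k_def)
    have "\<forall>\<^sub>F x in prob_filter M. v (fst x) (X (fst x) (snd x)) < k"
      by (rule order_tendstoD(2)[OF v0 k])
    then have "\<forall>\<^sub>F t in sequentially. \<exists>B\<in>sets (M t). emeasure (M t) B \<le> ennreal (d/2) \<and> (\<forall>\<omega>\<in>space (M t) - B. v t (X t \<omega>) < k)"
      unfolding eventually_prob_filter using d by (elim allE[of _ "d/2"]) simp
    then show "\<forall>\<^sub>F t in sequentially. \<exists>B\<in>sets (M t). emeasure (M t) B \<le> ennreal d \<and>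
        (\<forall>\<omega>\<in>space (M t) - B. \<bar>q (fst (t, \<omega>)) (X (fst (t, \<omega>)) (snd (t, \<omega>)), Y (fst (t, \<omega>)) (snd (t, \<omega>)))\<bar> < e)"
    proof eventually_elim
      case (elim t)
      interpret prob_space "M t" by (rule ps)
      have Xm[measurable]: "X t \<in> measurable (M t) (MX t)" and [measurable]: "Y t \<in> measurable (M t) (MY t)"
        using ind[of t] by (auto dest: indep_var_rv1 indep_var_rv2)
      obtain B where B: "B \<in> sets (M t)" "emeasure (M t) B \<le> ennreal (d/2)" "\<And>\<omega>. \<omega>\<in>space (M t) - B \<Longrightarrow> v t (X t \<omega>) < k"
        using elim by blast
      define C where "C = {\<omega>\<in>space (M t). v t (X t \<omega>) < k \<and> e \<le> \<bar>q t (X t \<omega>, Y t \<omega>)\<bar>}"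
      have "(\<lambda>\<omega>. q t (X t \<omega>, Y t \<omega>)) \<in> borel_measurable (M t)" "(\<lambda>\<omega>. v t (X t \<omega>)) \<in> borel_measurable (M t)"
        by (rule measurable_compose[OF measurable_Pair qm[of t]], simp, simp) (rule measurable_compose[OF _ vm[of t]], simp)
      then have C[measurable]: "C \<in> sets (M t)" unfolding C_def by simp
      \<comment> \<open>The indicator of small \<open>v\<close> sits inside the integrand, so that
        the inner integral is at most \<open>k\<close> for every frozen sample point.\<close>
      let ?F = "\<lambda>p. ennreal ((q t p)\<^sup>2) * indicator {x\<in>space (MX t). v t x < k} (fst p)"
      have "{x\<in>space (MX t). v t x < k} \<in> sets (MX t)" using vm[of t] by simp
      then have Fm: "?F \<in> borel_measurable (MX t \<Otimes>\<^sub>M MY t)"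
        using qm[of t] by simp
      have "ennreal (e\<^sup>2) * emeasure (M t) C = (\<integral>\<^sup>+\<omega>. ennreal (e\<^sup>2) * indicator C \<omega> \<partial>M t)"
        by (simp add: nn_integral_cmult)
      also have "\<dots> \<le> (\<integral>\<^sup>+\<omega>. ?F (X t \<omega>, Y t \<omega>) \<partial>M t)"
      proof (rule nn_integral_mono)
        fix \<omega> assume w: "\<omega> \<in> space (M t)"
        then have "X t \<omega> \<in> space (MX t)" by (rule measurable_space[OF Xm])
        moreover have "e\<^sup>2 \<le> (q t (X t \<omega>, Y t \<omega>))\<^sup>2" if "\<omega> \<in> C"
        proof -
          have "e \<le> \<bar>q t (X t \<omega>, Y t \<omega>)\<bar>" using that by (simp add: C_def)
          from power_mono[OF this, of 2] e show ?thesis by simp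
        qed
        ultimately show "ennreal (e\<^sup>2) * indicator C \<omega> \<le> ?F (X t \<omega>, Y t \<omega>)"
          by (auto simp: indicator_def C_def intro!: ennreal_leI)
      qed
      also have "\<dots> = (\<integral>\<^sup>+\<omega>. \<integral>\<^sup>+\<omega>'. ?F (X t \<omega>, Y t \<omega>') \<partial>M t \<partial>M t)"
        by (rule nn_integral_indep_var[OF ind Fm])
      also have "\<dots> \<le> (\<integral>\<^sup>+\<omega>. ennreal k \<partial>M t)"
      proof (rule nn_integral_mono)
        fix \<omega> assume "\<omega> \<in> space (M t)"
        then have x: "X t \<omega> \<in> space (MX t)" by (rule measurable_space[OF Xm])
        show "(\<integral>\<^sup>+\<omega>'. ?F (X t \<omega>, Y t \<omega>') \<partial>M t) \<le> ennreal k"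
        proof (cases "v t (X t \<omega>) < k")
          case True
          have "(\<integral>\<^sup>+\<omega>'. ?F (X t \<omega>, Y t \<omega>') \<partial>M t) = (\<integral>\<^sup>+\<omega>'. ennreal ((q t (X t \<omega>, Y t \<omega>'))\<^sup>2) \<partial>M t)"
            using True x by (simp add: indicator_def)
          also have "\<dots> \<le> ennreal (v t (X t \<omega>))" by (rule var[OF x])
          also have "\<dots> \<le> ennreal k" using True by (intro ennreal_leI) simp
          finally show ?thesis .
        next
          case False
          then show ?thesis by (simp add: indicator_def)
        qed
      qed
      also have "\<dots> = ennreal k" by (simp add: emeasure_space_1)
      finally have "e\<^sup>2 * measure (M t) C \<le> k"
        using k e by (simp add: emeasure_eq_measure flip: ennreal_mult)
      then have "measure (M t) C \<le> d/2" using e by (simp add: k_def field_simps)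
      then have Cd: "emeasure (M t) C \<le> ennreal (d/2)" by (simp add: emeasure_eq_measure ennreal_leI)
      have "emeasure (M t) (B \<union> C) \<le> emeasure (M t) B + emeasure (M t) C"
        by (rule emeasure_subadditive) (use B in auto)
      also have "\<dots> \<le> ennreal (d/2) + ennreal (d/2)" by (intro add_mono B Cd)
      also have "\<dots> = ennreal d" using d by (subst ennreal_plus[symmetric]) auto
      finally have "emeasure (M t) (B \<union> C) \<le> ennreal d" .
      moreover have "B \<union> C \<in> sets (M t)" using B(1) C by simp
      ultimately show ?case using B(3) by (intro bexI[of _ "B \<union> C"]) (auto simp: C_def not_le)
    qed
  qed
  then show "\<forall>\<^sub>F x in prob_filter M. dist (q (fst x) (X (fst x) (snd x), Y (fst x) (snd x))) 0 < e"
    by simp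
qed

section \<open>The errors-in-variables model for a fixed sample size\<close>

text \<open>Labels of the response and regressor noise, as opposed to the noise-only sample \<open>Z\<close>.\<close>

definition xy_labels :: "('p::finite \<Rightarrow> nat) \<Rightarrow> 'p lab set" where
  "xy_labels n = insert Eps ((\<lambda>(i, k). Eta i k) ` (SIGMA i:UNIV. {..<n i}))"

definition z_labels :: "nat \<Rightarrow> 'p lab set" where
  "z_labels m = Zl ` {..<m}"

lemma finite_xy_labels [simp]: "finite (xy_labels n)"
  by (simp add: xy_labels_def)

lemma labels_split: "labels n m = xy_labels n \<union> z_labels m" "z_labels m \<inter> xy_labels n = {}"
  by (auto simp: labels_def xy_labels_def z_labels_def)

lemma sum_xy_labels:
  "(\<Sum>l\<in>xy_labels n. f l) = f Eps + (\<Sum>i\<in>UNIV. \<Sum>k<n i. f (Eta i k))"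
proof -
  have "(\<Sum>l\<in>xy_labels n. f l) = f Eps + (\<Sum>l\<in>(\<lambda>(i, k). Eta i k) ` (SIGMA i:UNIV. {..<n i}). f l)"
    unfolding xy_labels_def by (subst sum.insert) auto
  also have "(\<Sum>l\<in>(\<lambda>(i, k). Eta i k) ` (SIGMA i:UNIV. {..<n i}). f l) = (\<Sum>(i, k)\<in>(SIGMA i:UNIV. {..<n i}). f (Eta i k))"
    by (subst sum.reindex) (auto simp: inj_on_def intro!: sum.cong)
  also have "\<dots> = (\<Sum>i\<in>UNIV. \<Sum>k<n i. f (Eta i k))"
    by (subst sum.Sigma) auto
  finally show ?thesis .
qed

section \<open>Mixtures of noise vectors and the regularised covariance\<close>

definition mix :: "('p::finite \<Rightarrow> nat) \<Rightarrow> ('p lab \<Rightarrow> real) \<Rightarrow> ('p lab \<Rightarrow> nat \<Rightarrow> real) \<Rightarrow> nat \<Rightarrow> real" where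
  "mix n w y a = (\<Sum>l\<in>xy_labels n. w l * y l a)"

text \<open>The scalar covariance factor: mixtures with weights \<open>w\<close> and
  \<open>w'\<close> have cross-covariance \<open>wdot n w w'\<close> times \<open>Sig\<close>, so
  uncorrelated means \<open>wdot n w w' = 0\<close>.\<close>

definition wdot :: "('p::finite \<Rightarrow> nat) \<Rightarrow> ('p lab \<Rightarrow> real) \<Rightarrow> ('p lab \<Rightarrow> real) \<Rightarrow> real" where
  "wdot n w w' = (\<Sum>l\<in>xy_labels n. w l * w' l)"

text \<open>Weights of \<open>c0\<close> times the response noise plus the combination, with
  coefficients \<open>c\<close>, of the averaged regressor noises; the division by
  \<open>n i\<close> is the averaging over replicates.\<close>

definition weight :: "('p::finite \<Rightarrow> nat) \<Rightarrow> real \<Rightarrow> real^'p \<Rightarrow> 'p lab \<Rightarrow> real" where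
  "weight n c0 c l = (case l of Eps \<Rightarrow> c0 | Eta i k \<Rightarrow> c $ i / real (n i) | Zl _ \<Rightarrow> 0)"

lemma wdot_weight:
  assumes "\<And>i. n i \<ge> 1"
  shows "wdot n (weight n c0 c) (weight n d0 d) = c0 * d0 + (\<Sum>i\<in>UNIV. c $ i * d $ i / real (n i))"
proof -
  have nz: "n i \<noteq> 0" for i using assms[of i] by simp
  show ?thesis unfolding wdot_def sum_xy_labels by (simp add: weight_def nz)
qed

lemma mix_weight:
  "mix n (weight n c0 c) y a = c0 * y Eps a + (\<Sum>i\<in>UNIV. c $ i * ((\<Sum>k<n i. y (Eta i k) a) / real (n i)))"
  unfolding mix_def sum_xy_labels by (simp add: weight_def sum_distrib_left sum_divide_distrib)

text \<open>\<open>sighat\<close> as a function of noise values instead of sample points: it lives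
  on the product space of the \<open>Z\<close> block, where Fubini's theorem is applied.\<close>

definition zcov :: "nat \<Rightarrow> real \<Rightarrow> ('p lab \<Rightarrow> nat \<Rightarrow> real) \<Rightarrow> nat \<Rightarrow> nat \<Rightarrow> real" where
  "zcov m lam z a b = (\<Sum>j<m. z (Zl j) a * z (Zl j) b) / real m + lam * idm a b"

lemma bform_zcov: 
  "bform N (zcov m lam z) c c = (\<Sum>j<m. (dot N c (z (Zl j)))\<^sup>2) / real m + lam * dot N c c"
proof -
  have "bform N (zcov m lam z) c c = (\<Sum>a<N. \<Sum>b<N. (\<Sum>j<m. (c a * z (Zl j) a) * (c b * z (Zl j) b)) / real m + lam * (c a * idm a b * c b))"
    unfolding bform_def zcov_def
    by (intro sum.cong refl) (simp add: algebra_simps sum_distrib_left sum_divide_distrib)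
  also have "\<dots> = (\<Sum>a<N. \<Sum>b<N. \<Sum>j<m. (c a * z (Zl j) a) * (c b * z (Zl j) b)) / real m + lam * bform N idm c c"
    by (simp add: sum.distrib sum_distrib_left sum_divide_distrib bform_def)
  also have "(\<Sum>a<N. \<Sum>b<N. \<Sum>j<m. (c a * z (Zl j) a) * (c b * z (Zl j) b)) = (\<Sum>j<m. \<Sum>a<N. \<Sum>b<N. (c a * z (Zl j) a) * (c b * z (Zl j) b))"
    by (subst (2) sum.swap, subst sum.swap) (rule refl)
  also have "\<dots> = (\<Sum>j<m. (dot N c (z (Zl j)))\<^sup>2)" unfolding dot_def power2_eq_square sum_product ..
  finally show ?thesis by (simp add: bform_idm)
qed

lemma zcov_lower: "bform N (zcov m lam z) c c \<ge> lam * dot N c c"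
  unfolding bform_zcov by (simp add: sum_nonneg)

lemma sym_pd_zcov: "lam > 0 \<Longrightarrow> sym_pd N (zcov m lam z)"
  unfolding sym_pd_def
proof (intro conjI allI impI)
  fix c :: "nat \<Rightarrow> real" assume lam: "lam > 0" and "\<exists>a<N. c a \<noteq> 0"
  then have "lam * dot N c c > 0" using dot_self_pos by (intro mult_pos_pos) auto
  then show "bform N (zcov m lam z) c c > 0" using zcov_lower[of lam N c m z] by linarith
qed (auto simp: zcov_def idm_def mult.commute)

definition zinv :: "nat \<Rightarrow> nat \<Rightarrow> real \<Rightarrow> ('p lab \<Rightarrow> nat \<Rightarrow> real) \<Rightarrow> nat \<Rightarrow> nat \<Rightarrow> real" where
  "zinv N m lam z = minv N (zcov m lam z)"

abbreviation block :: "'p lab set \<Rightarrow> nat \<Rightarrow> ('p lab \<Rightarrow> nat \<Rightarrow> real) measure" where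
  "block L N \<equiv> Pi\<^sub>M L (\<lambda>_. Pi\<^sub>M {..<N} (\<lambda>_. borel))"

lemma block_component: "l \<in> L \<Longrightarrow> a < N \<Longrightarrow> (\<lambda>y. y l a) \<in> borel_measurable (block L N)"
  by (rule measurable_compose[of "\<lambda>y. y l" _ "Pi\<^sub>M {..<N} (\<lambda>_. borel)"]; rule measurable_component_singleton) simp_all

lemma zinv_measurable:
  assumes "lam > 0"
  shows "(\<lambda>z. zinv N m lam z a b) \<in> borel_measurable (block (z_labels m) N)"
  unfolding zinv_def
proof (rule minv_measurable)
  fix a b assume "a < N" "b < N"
  then show "(\<lambda>z. zcov m lam z a b) \<in> borel_measurable (block (z_labels m) N)"
    unfolding zcov_def
    by (intro borel_measurable_add borel_measurable_divide borel_measurable_sum borel_measurable_times block_component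
        borel_measurable_const) (auto simp: z_labels_def)
qed (use assms sym_pd_zcov in auto)

lemma sum_lessThan_add: "(\<Sum>i<N+K. f i) = (\<Sum>i<N. f i) + (\<Sum>i<K. f (N + i :: nat) :: real)"
  by (induction K) (simp_all add: add.assoc)

lemma mix_block_measurable: "a < N \<Longrightarrow> (\<lambda>y. mix n w y a) \<in> borel_measurable (block (xy_labels n) N)"
  unfolding mix_def by (intro borel_measurable_sum borel_measurable_times block_component borel_measurable_const)

lemma bform_measurable:
  assumes "\<And>a b. a < N \<Longrightarrow> b < N \<Longrightarrow> (\<lambda>\<omega>. A \<omega> a b) \<in> borel_measurable M"
    and "\<And>a. a < N \<Longrightarrow> (\<lambda>\<omega>. u \<omega> a) \<in> borel_measurable M" "\<And>a. a < N \<Longrightarrow> (\<lambda>\<omega>. v \<omega> a) \<in> borel_measurable M"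
  shows "(\<lambda>\<omega>. bform N (A \<omega>) (u \<omega>) (v \<omega>)) \<in> borel_measurable M"
  unfolding bform_def by (intro borel_measurable_sum borel_measurable_times assms) auto

lemma mmul_measurable:
  assumes "\<And>a b. a < N \<Longrightarrow> b < N \<Longrightarrow> (\<lambda>\<omega>. A \<omega> a b) \<in> borel_measurable M"
    and "\<And>a b. a < N \<Longrightarrow> b < N \<Longrightarrow> (\<lambda>\<omega>. B \<omega> a b) \<in> borel_measurable M" and "a < N" "b < N"
  shows "(\<lambda>\<omega>. mmul N (A \<omega>) (B \<omega>) a b) \<in> borel_measurable M"
  unfolding mmul_def by (intro borel_measurable_sum borel_measurable_times assms) auto

lemma mtrace_measurable:
  assumes "\<And>a b. a < N \<Longrightarrow> b < N \<Longrightarrow> (\<lambda>\<omega>. A \<omega> a b) \<in> borel_measurable M"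
  shows "(\<lambda>\<omega>. mtrace N (A \<omega>)) \<in> borel_measurable M"
  unfolding mtrace_def by (intro borel_measurable_sum assms) auto

section \<open>Gaussian mixtures given the covariance estimate\<close>

locale noise_model = prob_space M for M :: "'a measure" +
  fixes N m :: nat and n :: "'p::finite \<Rightarrow> nat" and Sig :: "nat \<Rightarrow> nat \<Rightarrow> real" and nz :: "'p lab \<Rightarrow> 'a \<Rightarrow> nat \<Rightarrow> real" and lam :: real
  assumes lam_pos: "lam > 0"
    and Sig_pd: "sym_pd N Sig"
    and indep: "indep_vars (\<lambda>_. Pi\<^sub>M {..<N} (\<lambda>_. borel)) (\<lambda>l \<omega>. restrict (nz l \<omega>) {..<N}) (labels n m)"
    and gauss: "\<And>l. l \<in> labels n m \<Longrightarrow> gauss_lin M N Sig (nz l)"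
begin

text \<open>The restrictions place the noise among the extensional functions that make up the
  product spaces, where \<open>indep_var_restrict\<close> yields independence of the two
  blocks.\<close>

definition zb :: "'a \<Rightarrow> 'p lab \<Rightarrow> nat \<Rightarrow> real" where
  "zb \<omega> = restrict (\<lambda>l. restrict (nz l \<omega>) {..<N}) (z_labels m)"

definition yb :: "'a \<Rightarrow> 'p lab \<Rightarrow> nat \<Rightarrow> real" where
  "yb \<omega> = restrict (\<lambda>l. restrict (nz l \<omega>) {..<N}) (xy_labels n)"

definition Wm :: "'a \<Rightarrow> nat \<Rightarrow> nat \<Rightarrow> real" where "Wm \<omega> = zinv N m lam (zb \<omega>)"

definition mx :: "('p lab \<Rightarrow> real) \<Rightarrow> 'a \<Rightarrow> nat \<Rightarrow> real" where "mx w \<omega> = mix n w (yb \<omega>)"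

lemma indep_blocks: "indep_var (block (z_labels m) N) zb (block (xy_labels n) N) yb"
  unfolding zb_def yb_def by (rule indep_var_restrict[OF indep]) (auto simp: labels_split(1)[of n m] labels_split(2))

lemma zb_measurable [measurable]: "zb \<in> measurable M (block (z_labels m) N)"
  and yb_measurable [measurable]: "yb \<in> measurable M (block (xy_labels n) N)"
  using indep_blocks by (auto dest: indep_var_rv1 indep_var_rv2)

lemma Wm_measurable: "(\<lambda>\<omega>. Wm \<omega> a b) \<in> borel_measurable M"
  unfolding Wm_def by (rule measurable_compose[OF zb_measurable zinv_measurable[OF lam_pos]])

lemma mx_measurable: "a < N \<Longrightarrow> (\<lambda>\<omega>. mx w \<omega> a) \<in> borel_measurable M"
  unfolding mx_def by (rule measurable_compose[OF yb_measurable mix_block_measurable])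

lemma mx_eq: "a < N \<Longrightarrow> mx w \<omega> a = (\<Sum>l\<in>xy_labels n. w l * nz l \<omega> a)"
  unfolding mx_def mix_def yb_def by (intro sum.cong) auto

lemma sym_pd_zinv: "sym_on N (zinv N m lam z)" "bform N (zinv N m lam z) x x \<ge> 0"
  unfolding zinv_def by (intro sym_on_minv bform_minv_nonneg sym_pd_zcov lam_pos)+

lemma zinv_bound: "dot N (mvec N (zinv N m lam z) x) (mvec N (zinv N m lam z) x) \<le> 1 / lam\<^sup>2 * dot N x x"
  unfolding zinv_def using minv_shift_bound[OF lam_pos sym_pd_zcov[OF lam_pos] zcov_lower, of N m z x] by simp

lemma Sig_sym: "sym_on N Sig" by (rule sym_pd_sym_on[OF Sig_pd])

lemma Sig_nonneg: "bform N Sig c c \<ge> 0" by (rule sym_pd_bform_nonneg[OF Sig_pd])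

text \<open>Regrouped by label, the noise vector \<open>l\<close> is tested against
  \<open>w l * c + w' l * d\<close>; the summands are then independent Gaussian variables.\<close>

lemma joint_gaussian:
  "gaussian M (\<lambda>\<omega>. dot N c (mx w \<omega>) + dot N d (mx w' \<omega>))
    (wdot n w w * bform N Sig c c + 2 * wdot n w w' * bform N Sig c d + wdot n w' w' * bform N Sig d d)"
proof -
  define f where "f l y = (\<Sum>a<N. (w l * c a + w' l * d a) * y a)" for l and y :: "nat \<Rightarrow> real"
  have "indep_vars (\<lambda>_. borel) (\<lambda>l \<omega>. f l (restrict (nz l \<omega>) {..<N})) (xy_labels n)"
    by (rule indep_vars_compose2[OF indep_vars_subset[OF indep]])
       (auto simp: labels_split(1)[of n m] f_def intro!: borel_measurable_sum borel_measurable_times)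
  moreover have "f l (restrict (nz l \<omega>) {..<N}) = f l (nz l \<omega>)" for l \<omega>
    unfolding f_def by (intro sum.cong) auto
  ultimately have "indep_vars (\<lambda>_. borel) (\<lambda>l \<omega>. f l (nz l \<omega>)) (xy_labels n)" by simp
  then have "gaussian M (\<lambda>\<omega>. \<Sum>l\<in>xy_labels n. f l (nz l \<omega>))
     (\<Sum>l\<in>xy_labels n. bform N Sig (\<lambda>a. w l * c a + w' l * d a) (\<lambda>a. w l * c a + w' l * d a))"
  proof (rule gaussian_sum[rotated])
    fix l assume "l \<in> xy_labels n"
    then show "gaussian M (\<lambda>\<omega>. f l (nz l \<omega>)) (bform N Sig (\<lambda>a. w l * c a + w' l * d a) (\<lambda>a. w l * c a + w' l * d a))"
      using gauss[of l] unfolding gauss_lin_def f_def by (auto simp: labels_split(1)[of n m])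
  qed simp
  also have "(\<lambda>\<omega>. \<Sum>l\<in>xy_labels n. f l (nz l \<omega>)) = (\<lambda>\<omega>. dot N c (mx w \<omega>) + dot N d (mx w' \<omega>))"
  proof
    fix \<omega>
    have "dot N c (mx w \<omega>) + dot N d (mx w' \<omega>) = (\<Sum>a<N. \<Sum>l\<in>xy_labels n. (w l * c a + w' l * d a) * nz l \<omega> a)"
      unfolding dot_def sum.distrib[symmetric]
      by (intro sum.cong refl) (simp add: mx_eq sum_distrib_left algebra_simps sum.distrib)
    also have "\<dots> = (\<Sum>l\<in>xy_labels n. f l (nz l \<omega>))" unfolding f_def by (rule sum.swap)
    finally show "(\<Sum>l\<in>xy_labels n. f l (nz l \<omega>)) = dot N c (mx w \<omega>) + dot N d (mx w' \<omega>)" ..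
  qed
  also have "(\<Sum>l\<in>xy_labels n. bform N Sig (\<lambda>a. w l * c a + w' l * d a) (\<lambda>a. w l * c a + w' l * d a))
     = wdot n w w * bform N Sig c c + 2 * wdot n w w' * bform N Sig c d + wdot n w' w' * bform N Sig d d"
  proof -
    have e: "bform N Sig (\<lambda>a. w l * c a + w' l * d a) (\<lambda>a. w l * c a + w' l * d a)
      = (w l * w l) * bform N Sig c c + (w l * w' l) * (2 * bform N Sig c d) + (w' l * w' l) * bform N Sig d d" for l
      unfolding bform_add_left bform_add_right bform_scale_left bform_scale_right bform_sym_on[OF Sig_sym, of d c]
      by (simp add: algebra_simps)
    show ?thesis unfolding wdot_def e sum.distrib sum_distrib_right[symmetric] by simp
  qed
  finally show ?thesis .
qed

lemma mx_gaussian: "gaussian M (\<lambda>\<omega>. dot N c (mx w \<omega>)) (wdot n w w * bform N Sig c c)"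
proof -
  have "(\<lambda>\<omega>. dot N c (mx w \<omega>) + dot N (\<lambda>_. 0) (mx w \<omega>)) = (\<lambda>\<omega>. dot N c (mx w \<omega>))"
    by (simp add: dot_def)
  moreover have "bform N Sig (\<lambda>_. 0) (\<lambda>_. 0) = 0" "bform N Sig c (\<lambda>_. 0) = 0" by (simp_all add: bform_def)
  ultimately show ?thesis using joint_gaussian[of c w "\<lambda>_. 0" w] by simp
qed

lemma mx_gauss_lin: "gauss_lin M N (\<lambda>a b. wdot n w w * Sig a b) (mx w)"
proof -
  have "bform N (\<lambda>a b. wdot n w w * Sig a b) c c = wdot n w w * bform N Sig c c" for c
    unfolding bform_def sum_distrib_left by (intro sum.cong refl) simp
  then show ?thesis unfolding gauss_lin_def using mx_gaussian by (simp add: dot_def)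
qed

lemma linear_second_moment:
  "(\<integral>\<^sup>+\<omega>. ennreal ((dot N c (mx w \<omega>))\<^sup>2) \<partial>M) = ennreal (wdot n w w * bform N Sig c c)"
  using gaussian_moments(1)[OF mx_gaussian[of c w]]
  by (subst nn_integral_eq_integral) (auto simp: has_bochner_integral_iff)

text \<open>The factor \<open>l\<close> is exported together with the moment because the sum over
  \<open>l\<close> is later both evaluated as a trace and bounded.\<close>

lemma quadratic_second_moment:
  assumes sA: "sym_on N A" and pA: "\<And>x. bform N A x x \<ge> 0"
  obtains l where "\<And>a b. a < N \<Longrightarrow> b < N \<Longrightarrow> A a b = (\<Sum>k<N. l k a * l k b)"
    and "(\<integral>\<^sup>+\<omega>. ennreal ((bform N A (mx w \<omega>) (mx w \<omega>) - wdot n w w * mtrace N (mmul N A Sig))\<^sup>2) \<partial>M)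
      = ennreal (2 * (wdot n w w)\<^sup>2 * (\<Sum>k<N. \<Sum>j<N. (bform N Sig (l k) (l j))\<^sup>2))"
proof -
  obtain l where "\<forall>a\<in>{..<N}. \<forall>b\<in>{..<N}. A a b = (\<Sum>k\<in>{..<N}. l k a * l k b)"
    using psd_factor[of "{..<N}" A] sA pA by (auto simp: sym_on_def bform_eq_quad)
  then have l: "\<And>a b. a < N \<Longrightarrow> b < N \<Longrightarrow> A a b = (\<Sum>k<N. l k a * l k b)" by blast
  have b: "bform N (\<lambda>a b. wdot n w w * Sig a b) c d = wdot n w w * bform N Sig c d" for c d
    unfolding bform_def sum_distrib_left by (intro sum.cong refl) simp
  have "(\<integral>\<^sup>+\<omega>. ennreal ((bform N A (mx w \<omega>) (mx w \<omega>) - (\<Sum>k<N. bform N (\<lambda>a b. wdot n w w * Sig a b) (l k) (l k)))\<^sup>2) \<partial>M)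
     = ennreal (2 * (\<Sum>k<N. \<Sum>j<N. (bform N (\<lambda>a b. wdot n w w * Sig a b) (l k) (l j))\<^sup>2))"
    by (rule gauss_quadratic_variance[OF mx_gauss_lin _ l]) (use Sig_sym in \<open>auto simp: sym_on_def\<close>)
  then have *: "(\<integral>\<^sup>+\<omega>. ennreal ((bform N A (mx w \<omega>) (mx w \<omega>) - wdot n w w * (\<Sum>k<N. bform N Sig (l k) (l k)))\<^sup>2) \<partial>M)
      = ennreal (2 * (wdot n w w)\<^sup>2 * (\<Sum>k<N. \<Sum>j<N. (bform N Sig (l k) (l j))\<^sup>2))"
    unfolding b power_mult_distrib sum_distrib_left[symmetric] by (simp add: mult.assoc)
  have tr: "mtrace N (mmul N A Sig) = (\<Sum>k<N. bform N Sig (l k) (l k))"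
    by (rule mtrace_mmul_factor[OF l Sig_sym])
  show ?thesis by (rule that[OF l]) (use * in \<open>simp_all add: tr\<close>)
qed

text \<open>Uncorrelated mixtures are independent; hence the second one can be integrated out.\<close>

lemma uncorrelated_char:
  assumes w: "wdot n w w' = 0"
  shows "(\<integral>\<omega>. iexp (s * (dot N q (mx w \<omega>) + bform N W (mx w \<omega>) (mx w' \<omega>))) \<partial>M)
     = (\<integral>\<omega>. iexp (s * dot N q (mx w \<omega>)) * complex_of_real (exp (- (s\<^sup>2 * (wdot n w' w' *
          bform N Sig (\<lambda>b. \<Sum>a<N. mx w \<omega> a * W a b) (\<lambda>b. \<Sum>a<N. mx w \<omega> a * W a b))) / 2)) \<partial>M)"
proof -
  interpret PP: pair_prob_space M M ..
  \<comment> \<open>Both mixtures are stacked into one vector of length \<open>2 N\<close>. In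
    \<open>V'\<close> the second half is read off an independent copy of the sample, so equality of
    the two laws expresses independence.\<close>
  define V where "V i \<omega> = (if i < N then mx w \<omega> i else mx w' \<omega> (i - N))" for i \<omega>
  define V' where "V' i p = (if i < N then mx w (fst p) i else mx w' (snd p) (i - N))" for i and p :: "'a \<times> 'a"
  have Vm: "V i \<in> borel_measurable M" if "i \<in> {..<N+N}" for i
    using that unfolding V_def by (cases "i < N") (auto intro!: mx_measurable)
  have V'm: "V' i \<in> borel_measurable (M \<Otimes>\<^sub>M M)" if "i \<in> {..<N+N}" for i
    using that unfolding V'_def
    by (cases "i < N") (auto intro!: measurable_compose[OF measurable_fst mx_measurable] measurable_compose[OF measurable_snd mx_measurable])
  have sumV: "(\<Sum>i\<in>{..<N+N}. a i * V i \<omega>) = dot N a (mx w \<omega>) + dot N (\<lambda>i. a (N + i)) (mx w' \<omega>)" for a \<omega>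
    unfolding dot_def V_def sum_lessThan_add by simp
  have sumV': "(\<Sum>i\<in>{..<N+N}. a i * V' i p) = dot N a (mx w (fst p)) + dot N (\<lambda>i. a (N + i)) (mx w' (snd p))" for a p
    unfolding dot_def V'_def sum_lessThan_add by simp
  have dm: "(\<lambda>\<omega>. dot N c (mx v \<omega>)) \<in> borel_measurable M" for c v
    by (rule gaussian_measurable[OF mx_gaussian])
  note dmf = measurable_compose[OF measurable_fst dm] measurable_compose[OF measurable_snd dm]
  define F where "F v = iexp (s * (dot N q v + bform N W v (\<lambda>b. v (N + b))))" for v
  have split: "iexp (x + y) = iexp x * iexp y" for x y by (simp add: algebra_simps exp_add)
  have eq: "distr M (Pi\<^sub>M {..<N+N} (\<lambda>_. borel)) (\<lambda>\<omega>. \<lambda>i\<in>{..<N+N}. V i \<omega>)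
      = distr (M \<Otimes>\<^sub>M M) (Pi\<^sub>M {..<N+N} (\<lambda>_. borel)) (\<lambda>p. \<lambda>i\<in>{..<N+N}. V' i p)"
  proof (rule char_unique_PiM)
    fix a :: "nat \<Rightarrow> real"
    let ?b = "\<lambda>i. a (N + i)"
    have "(\<integral>\<omega>. iexp (\<Sum>i\<in>{..<N+N}. a i * V i \<omega>) \<partial>M)
       = complex_of_real (exp (- (wdot n w w * bform N Sig a a + wdot n w' w' * bform N Sig ?b ?b) / 2))"
      unfolding sumV using gaussian_char1[OF joint_gaussian[of a w ?b w']] w by simp
    also have "\<dots> = complex_of_real (exp (- (wdot n w w * bform N Sig a a) / 2)) * complex_of_real (exp (- (wdot n w' w' * bform N Sig ?b ?b) / 2))"
      by (simp add: exp_add[symmetric] add_divide_distrib flip: of_real_mult)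
    also have "\<dots> = (\<integral>\<omega>. iexp (dot N a (mx w \<omega>)) \<partial>M) * (\<integral>\<omega>. iexp (dot N ?b (mx w' \<omega>)) \<partial>M)"
      unfolding gaussian_char1[OF mx_gaussian] ..
    also have "\<dots> = (\<integral>\<omega>. \<integral>\<omega>'. iexp (dot N a (mx w \<omega>)) * iexp (dot N ?b (mx w' \<omega>')) \<partial>M \<partial>M)" by simp
    also have "\<dots> = (\<integral>p. iexp (dot N a (mx w (fst p))) * iexp (dot N ?b (mx w' (snd p))) \<partial>(M \<Otimes>\<^sub>M M))"
      by (subst PP.integral_fst'[symmetric])
         (auto intro!: PP.P.integrable_const_bound[of _ 1] borel_measurable_times measurable_compose[OF dmf(1)] measurable_compose[OF dmf(2)] simp: norm_mult)
    finally show "(\<integral>\<omega>. iexp (\<Sum>i\<in>{..<N+N}. a i * V i \<omega>) \<partial>M) = (\<integral>p. iexp (\<Sum>i\<in>{..<N+N}. a i * V' i p) \<partial>(M \<Otimes>\<^sub>M M))"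
      unfolding sumV' split .
  qed (auto intro: Vm V'm prob_space_axioms PP.P.prob_space_axioms)
  have Fm: "F \<in> borel_measurable (Pi\<^sub>M {..<N+N} (\<lambda>_. borel))"
  proof -
    have c: "(\<lambda>v. v i) \<in> borel_measurable (Pi\<^sub>M {..<N+N} (\<lambda>_. borel))" if "i < N + N" for i
      using that by (intro measurable_component_singleton) auto
    have "(\<lambda>v. dot N q v + bform N W v (\<lambda>b. v (N + b))) \<in> borel_measurable (Pi\<^sub>M {..<N+N} (\<lambda>_. borel))"
      unfolding dot_def by (intro borel_measurable_add borel_measurable_sum borel_measurable_times bform_measurable c borel_measurable_const) auto
    then show ?thesis unfolding F_def by measurable
  qed
  have Vr: "(\<lambda>\<omega>. \<lambda>i\<in>{..<N+N}. V i \<omega>) \<in> measurable M (Pi\<^sub>M {..<N+N} (\<lambda>_. borel))"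
    "(\<lambda>p. \<lambda>i\<in>{..<N+N}. V' i p) \<in> measurable (M \<Otimes>\<^sub>M M) (Pi\<^sub>M {..<N+N} (\<lambda>_. borel))"
    by (auto intro!: measurable_restrict Vm V'm)
  have cross: "bform N W (mx w \<omega>) (mx w' \<omega>') = dot N (\<lambda>b. \<Sum>a<N. mx w \<omega> a * W a b) (mx w' \<omega>')" for \<omega> \<omega>'
    unfolding bform_def dot_def sum_distrib_right by (rule sum.swap)
  have FV: "F (\<lambda>i\<in>{..<N+N}. V i \<omega>) = iexp (s * (dot N q (mx w \<omega>) + bform N W (mx w \<omega>) (mx w' \<omega>)))" for \<omega>
    unfolding F_def by (intro arg_cong[where f = iexp] arg_cong2[where f = "(*)"] arg_cong2[where f = "(+)"] refl bform_cong)
      (auto simp: dot_def V_def)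
  have FV': "F (\<lambda>i\<in>{..<N+N}. V' i p) = iexp (s * dot N q (mx w (fst p))) * iexp (s * dot N (\<lambda>b. \<Sum>a<N. mx w (fst p) a * W a b) (mx w' (snd p)))" for p
    unfolding split[symmetric] distrib_left[symmetric] F_def cross[symmetric]
    by (intro arg_cong[where f = iexp] arg_cong2[where f = "(*)"] arg_cong2[where f = "(+)"] refl bform_cong)
      (auto simp: dot_def V'_def)
  have "(\<integral>\<omega>. iexp (s * (dot N q (mx w \<omega>) + bform N W (mx w \<omega>) (mx w' \<omega>))) \<partial>M)
     = (\<integral>v. F v \<partial>distr M (Pi\<^sub>M {..<N+N} (\<lambda>_. borel)) (\<lambda>\<omega>. \<lambda>i\<in>{..<N+N}. V i \<omega>))"
    by (subst integral_distr[OF Vr(1) Fm]) (simp only: FV)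
  also have "\<dots> = (\<integral>p. F (\<lambda>i\<in>{..<N+N}. V' i p) \<partial>(M \<Otimes>\<^sub>M M))"
    unfolding eq by (rule integral_distr[OF Vr(2) Fm])
  also have "\<dots> = (\<integral>\<omega>. \<integral>\<omega>'. F (\<lambda>i\<in>{..<N+N}. V' i (\<omega>, \<omega>')) \<partial>M \<partial>M)"
  proof (rule PP.integral_fst'[symmetric])
    show "integrable (M \<Otimes>\<^sub>M M) (\<lambda>p. F (\<lambda>i\<in>{..<N+N}. V' i p))"
    proof (rule PP.P.integrable_const_bound[of _ 1])
      show "AE p in M \<Otimes>\<^sub>M M. norm (F (\<lambda>i\<in>{..<N+N}. V' i p)) \<le> 1" unfolding F_def by simp
    qed (rule measurable_compose[OF Vr(2) Fm])
  qed
  also have "\<dots> = (\<integral>\<omega>. iexp (s * dot N q (mx w \<omega>)) * complex_of_real (exp (- (s\<^sup>2 * (wdot n w' w' *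
          bform N Sig (\<lambda>b. \<Sum>a<N. mx w \<omega> a * W a b) (\<lambda>b. \<Sum>a<N. mx w \<omega> a * W a b))) / 2)) \<partial>M)"
    unfolding FV' fst_conv snd_conv Bochner_Integration.integral_mult_right_zero gaussian_char[OF mx_gaussian] ..
  finally show ?thesis .
qed


end

context noise_model
begin

text \<open>The matrix \<open>W Sig W\<close>: for fixed \<open>z\<close>, the covariance of
  \<open>W\<close> applied to a vector with covariance \<open>Sig\<close>.\<close>

definition zsand :: "('p lab \<Rightarrow> nat \<Rightarrow> real) \<Rightarrow> nat \<Rightarrow> nat \<Rightarrow> real" where
  "zsand z = mmul N (mmul N (zinv N m lam z) Sig) (zinv N m lam z)"

lemma zsand_measurable: "a < N \<Longrightarrow> b < N \<Longrightarrow> (\<lambda>z. zsand z a b) \<in> borel_measurable (block (z_labels m) N)"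
  unfolding zsand_def by (intro mmul_measurable zinv_measurable lam_pos borel_measurable_const)

lemma zsand_sym: "sym_on N (zsand z)"
  unfolding zsand_def by (intro sym_on_conj sym_pd_zinv Sig_sym)

lemma bform_zsand: "bform N (zsand z) x y = bform N Sig (mvec N (zinv N m lam z) x) (mvec N (zinv N m lam z) y)"
  unfolding zsand_def by (rule bform_conj[OF sym_pd_zinv(1)])

lemma zsand_nonneg: "bform N (zsand z) x x \<ge> 0"
  unfolding bform_zsand by (rule Sig_nonneg)

lemma bform_zinv_dot: "bform N (zinv N m lam z) x y = dot N (mvec N (zinv N m lam z) x) y"
  unfolding bform_eq_dot by (rule dot_mvec_sym[OF sym_pd_zinv(1), symmetric])

lemma bform_pair_measurable:
  assumes "\<And>a b. a < N \<Longrightarrow> b < N \<Longrightarrow> (\<lambda>z. A z a b) \<in> borel_measurable (block (z_labels m) N)"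
    and "\<And>a. a < N \<Longrightarrow> (\<lambda>y. u y a) \<in> borel_measurable (block (xy_labels n) N)"
    and "\<And>a. a < N \<Longrightarrow> (\<lambda>y. v y a) \<in> borel_measurable (block (xy_labels n) N)"
  shows "(\<lambda>x. bform N (A (fst x)) (u (snd x)) (v (snd x))) \<in> borel_measurable (block (z_labels m) N \<Otimes>\<^sub>M block (xy_labels n) N)"
  by (intro bform_measurable measurable_compose[OF measurable_fst assms(1)] measurable_compose[OF measurable_snd assms(2)]
     measurable_compose[OF measurable_snd assms(3)])

text \<open>Freeze the \<open>Z\<close> block, hence \<open>W\<close>; integrate out the mixture
  \<open>w'\<close>, independent of the mixture \<open>w\<close>, by
  \<open>uncorrelated_char\<close>; then release the block. The variance left in the exponent still
  depends on the mixture \<open>w\<close>.\<close>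

lemma char_score:
  assumes w: "wdot n w w' = 0"
  shows "(\<integral>\<omega>. iexp (s * (bform N (Wm \<omega>) p (mx w \<omega>) + bform N (Wm \<omega>) (mx w \<omega>) (mx w' \<omega>))) \<partial>M)
    = (\<integral>\<omega>. iexp (s * bform N (Wm \<omega>) p (mx w \<omega>)) * complex_of_real (exp (- (s\<^sup>2 * (wdot n w' w' *
          bform N (zsand (zb \<omega>)) (mx w \<omega>) (mx w \<omega>))) / 2)) \<partial>M)"
proof -
  let ?W = "zinv N m lam :: ('p lab \<Rightarrow> nat \<Rightarrow> real) \<Rightarrow> nat \<Rightarrow> nat \<Rightarrow> real"
  define F where "F x = iexp (s * (bform N (?W (fst x)) p (mix n w (snd x)) + bform N (?W (fst x)) (mix n w (snd x)) (mix n w' (snd x))))" for x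
  define G where "G x = iexp (s * bform N (?W (fst x)) p (mix n w (snd x))) * complex_of_real (exp (- (s\<^sup>2 * (wdot n w' w' *
          bform N (zsand (fst x)) (mix n w (snd x)) (mix n w (snd x)))) / 2))" for x
  note [measurable] = bform_pair_measurable[of ?W "\<lambda>_. p" "mix n w", OF zinv_measurable[OF lam_pos] borel_measurable_const mix_block_measurable]
    bform_pair_measurable[of ?W "mix n w" "mix n w'", OF zinv_measurable[OF lam_pos] mix_block_measurable mix_block_measurable]
    bform_pair_measurable[of zsand "mix n w" "mix n w", OF zsand_measurable mix_block_measurable mix_block_measurable]
  have Fm: "F \<in> borel_measurable (block (z_labels m) N \<Otimes>\<^sub>M block (xy_labels n) N)" unfolding F_def by measurable
  have Gm: "G \<in> borel_measurable (block (z_labels m) N \<Otimes>\<^sub>M block (xy_labels n) N)" unfolding G_def by measurable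
  have Fb: "norm (F x) \<le> 1" for x by (simp add: F_def)
  have w'0: "wdot n w' w' \<ge> 0" unfolding wdot_def by (intro sum_nonneg) auto
  have Gb: "norm (G x) \<le> 1" for x 
    unfolding G_def norm_mult using zsand_nonneg w'0 by (simp)
  have "(\<integral>\<omega>. F (zb \<omega>, yb \<omega>) \<partial>M) = (\<integral>\<omega>. \<integral>\<omega>'. F (zb \<omega>, yb \<omega>') \<partial>M \<partial>M)"
    by (rule integral_indep_var[OF indep_blocks Fm Fb])
  also have "\<dots> = (\<integral>\<omega>. \<integral>\<omega>'. G (zb \<omega>, yb \<omega>') \<partial>M \<partial>M)"
  proof (rule Bochner_Integration.integral_cong[OF refl])
    fix \<omega> assume "\<omega> \<in> space M"
    let ?V = "?W (zb \<omega>)"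
    have b: "bform N Sig (\<lambda>b. \<Sum>a<N. x a * ?V a b) (\<lambda>b. \<Sum>a<N. x a * ?V a b) = bform N (zsand (zb \<omega>)) x x" for x
      unfolding bform_zsand
      by (intro bform_cong) (use sym_pd_zinv(1)[of "zb \<omega>"] in \<open>auto simp: mvec_def sym_on_def mult.commute intro!: sum.cong\<close>)
    show "(\<integral>\<omega>'. F (zb \<omega>, yb \<omega>') \<partial>M) = (\<integral>\<omega>'. G (zb \<omega>, yb \<omega>') \<partial>M)"
      unfolding F_def G_def fst_conv snd_conv mx_def[symmetric] bform_zinv_dot[of "zb \<omega>" p]
      by (subst uncorrelated_char[OF w]) (simp only: b)
  qed
  also have "\<dots> = (\<integral>\<omega>. G (zb \<omega>, yb \<omega>) \<partial>M)"
    by (rule integral_indep_var[OF indep_blocks Gm Gb, symmetric])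
  finally show ?thesis by (simp only: F_def G_def fst_conv snd_conv mx_def Wm_def)
qed

text \<open>The remaining mixture is integrated out of the oscillating factor alone, again for
  frozen \<open>W\<close>; \<open>score_char_limit\<close> applies this once the Gaussian factor has
  been replaced by a constant.\<close>

lemma char_linear:
  "(\<integral>\<omega>. iexp (s * bform N (Wm \<omega>) p (mx w \<omega>)) \<partial>M)
    = (\<integral>\<omega>. complex_of_real (exp (- (s\<^sup>2 * (wdot n w w * bform N (zsand (zb \<omega>)) p p)) / 2)) \<partial>M)"
proof -
  let ?W = "zinv N m lam :: ('p lab \<Rightarrow> nat \<Rightarrow> real) \<Rightarrow> nat \<Rightarrow> nat \<Rightarrow> real"
  define F where "F x = iexp (s * bform N (?W (fst x)) p (mix n w (snd x)))" for x
  note [measurable] = bform_pair_measurable[of ?W "\<lambda>_. p" "mix n w", OF zinv_measurable[OF lam_pos] borel_measurable_const mix_block_measurable]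
  have Fm: "F \<in> borel_measurable (block (z_labels m) N \<Otimes>\<^sub>M block (xy_labels n) N)" unfolding F_def by measurable
  have Fb: "norm (F x) \<le> 1" for x by (simp add: F_def)
  have "(\<integral>\<omega>. F (zb \<omega>, yb \<omega>) \<partial>M) = (\<integral>\<omega>. \<integral>\<omega>'. F (zb \<omega>, yb \<omega>') \<partial>M \<partial>M)"
    by (rule integral_indep_var[OF indep_blocks Fm Fb])
  also have "\<dots> = (\<integral>\<omega>. complex_of_real (exp (- (s\<^sup>2 * (wdot n w w * bform N (zsand (zb \<omega>)) p p)) / 2)) \<partial>M)"
    unfolding F_def fst_conv snd_conv mx_def[symmetric] bform_zinv_dot gaussian_char[OF mx_gaussian] bform_zsand ..
  finally show ?thesis by (simp only: F_def fst_conv snd_conv mx_def Wm_def)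
qed

lemma quadratic_second_moment_trace:
  assumes "sym_on N A" "\<And>x. bform N A x x \<ge> 0"
  shows "(\<integral>\<^sup>+\<omega>. ennreal ((bform N A (mx w \<omega>) (mx w \<omega>) - wdot n w w * mtrace N (mmul N A Sig))\<^sup>2) \<partial>M)
      = ennreal (2 * (wdot n w w)\<^sup>2 * mtrace N (mmul N (mmul N (mmul N A Sig) A) Sig))"
proof -
  obtain l where l: "\<And>a b. a < N \<Longrightarrow> b < N \<Longrightarrow> A a b = (\<Sum>k<N. l k a * l k b)"
    and m: "(\<integral>\<^sup>+\<omega>. ennreal ((bform N A (mx w \<omega>) (mx w \<omega>) - wdot n w w * mtrace N (mmul N A Sig))\<^sup>2) \<partial>M)
      = ennreal (2 * (wdot n w w)\<^sup>2 * (\<Sum>k<N. \<Sum>j<N. (bform N Sig (l k) (l j))\<^sup>2))"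
    using quadratic_second_moment[OF assms] by blast
  have "(\<Sum>k<N. \<Sum>j<N. (bform N Sig (l k) (l j))\<^sup>2) = mtrace N (mmul N (mmul N (mmul N A Sig) A) Sig)"
    by (rule quadratic_variance_trace[OF _ assms(1) Sig_sym]) (rule l)
  then show ?thesis using m by simp
qed

lemma trace_sandwich_nonneg:
  assumes "sym_on N A" "\<And>x. bform N A x x \<ge> 0"
  shows "mtrace N (mmul N (mmul N (mmul N A Sig) A) Sig) \<ge> 0"
proof -
  obtain l where l: "\<And>a b. a < N \<Longrightarrow> b < N \<Longrightarrow> A a b = (\<Sum>k<N. l k a * l k b)"
    using quadratic_second_moment[OF assms] by blast
  have "(\<Sum>k<N. \<Sum>j<N. (bform N Sig (l k) (l j))\<^sup>2) = mtrace N (mmul N (mmul N (mmul N A Sig) A) Sig)"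
    by (rule quadratic_variance_trace[OF _ assms(1) Sig_sym]) (rule l)
  then show ?thesis by (metis (no_types, lifting) sum_nonneg zero_le_power2)
qed

lemma trace_zsand_bound:
  assumes "\<And>c. bform N Sig c c \<le> u * dot N c c" "u \<ge> 0"
  shows "mtrace N (mmul N (mmul N (mmul N (zsand z) Sig) (zsand z)) Sig)
    \<le> u\<^sup>2 * (1 / lam\<^sup>2) * mtrace N (mmul N (zsand z) Sig)"
proof -
  obtain l where l: "\<And>a b. a < N \<Longrightarrow> b < N \<Longrightarrow> zsand z a b = (\<Sum>k<N. l k a * l k b)"
    using quadratic_second_moment[OF zsand_sym zsand_nonneg] by blast
  have "(\<Sum>k<N. \<Sum>j<N. (bform N Sig (l k) (l j))\<^sup>2) = mtrace N (mmul N (mmul N (mmul N (zsand z) Sig) (zsand z)) Sig)"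
    by (rule quadratic_variance_trace[OF _ zsand_sym Sig_sym]) (rule l)
  moreover have "(\<Sum>k<N. \<Sum>j<N. (bform N Sig (l k) (l j))\<^sup>2) \<le> u\<^sup>2 * (1 / lam\<^sup>2) * mtrace N (mmul N (zsand z) Sig)"
    unfolding zsand_def
    by (rule sandwich_variance_bound[OF sym_pd_zinv(1) zinv_bound _ Sig_sym Sig_nonneg assms])
       (simp_all add: zsand_def[symmetric] l)
  ultimately show ?thesis by simp
qed

end

section \<open>Limits along growing sample sizes\<close>

locale noise_seq =
  fixes M :: "nat \<Rightarrow> 'a measure" and NN mm :: "nat \<Rightarrow> nat" and n :: "'p::finite \<Rightarrow> nat" 
    and Sig :: "nat \<Rightarrow> nat \<Rightarrow> nat \<Rightarrow> real" and nz :: "nat \<Rightarrow> 'p lab \<Rightarrow> 'a \<Rightarrow> nat \<Rightarrow> real" and lam :: real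
    and u kap K :: real
  assumes nm: "\<And>t. noise_model (M t) (NN t) (mm t) n (Sig t) (nz t) lam"
    and N_lim: "filterlim NN at_top sequentially"
    and Sig_bound: "\<forall>\<^sub>F t in sequentially. \<forall>c. bform (NN t) (Sig t) c c \<le> u * dot (NN t) c c" and u_nonneg: "u \<ge> 0"
    and trace1: "((\<lambda>x. mtrace (NN (fst x)) (mmul (NN (fst x)) (noise_model.Wm (NN (fst x)) (mm (fst x)) (nz (fst x)) lam (snd x)) (Sig (fst x))) / real (NN (fst x))) \<longlongrightarrow> kap) (prob_filter M)"
    and trace2: "((\<lambda>x. mtrace (NN (fst x)) (mmul (NN (fst x)) (noise_model.zsand (NN (fst x)) (mm (fst x)) (Sig (fst x)) lam (noise_model.zb (NN (fst x)) (mm (fst x)) (nz (fst x)) (snd x))) (Sig (fst x))) / real (NN (fst x))) \<longlongrightarrow> K) (prob_filter M)"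
begin

sublocale T: noise_model "M t" "NN t" "mm t" n "Sig t" "nz t" lam for t
  by (rule nm)

lemma inverse_N_tendsto: "((\<lambda>x. 1 / real (NN (fst x))) \<longlongrightarrow> 0) (prob_filter M)"
proof -
  have "(\<lambda>t. 1 / real (NN t)) \<longlonglongrightarrow> 0"
    by (rule filterlim_compose[OF lim_1_over_n N_lim])
  from tendsto_prob_filter_seq[OF this] show ?thesis .
qed

text \<open>Given the \<open>Z\<close> block, the form has mean \<open>wdot n w w\<close> times the
  trace, and after division by \<open>N\<close> its conditional variance is
  \<open>2 (wdot n w w)\<^sup>2\<close> times the quantity assumed to vanish.\<close>

lemma quadratic_limit:
  fixes A :: "nat \<Rightarrow> ('p lab \<Rightarrow> nat \<Rightarrow> real) \<Rightarrow> nat \<Rightarrow> nat \<Rightarrow> real"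
  assumes Am: "\<And>t a b. a < NN t \<Longrightarrow> b < NN t \<Longrightarrow> (\<lambda>z. A t z a b) \<in> borel_measurable (block (z_labels (mm t)) (NN t))"
    and As: "\<And>t z. sym_on (NN t) (A t z)" and Ap: "\<And>t z x. bform (NN t) (A t z) x x \<ge> 0"
    and tr: "((\<lambda>x. mtrace (NN (fst x)) (mmul (NN (fst x)) (A (fst x) (T.zb (fst x) (snd x))) (Sig (fst x))) / real (NN (fst x))) \<longlongrightarrow> k) (prob_filter M)"
    and var: "((\<lambda>x. mtrace (NN (fst x)) (mmul (NN (fst x)) (mmul (NN (fst x)) (mmul (NN (fst x)) (A (fst x) (T.zb (fst x) (snd x))) (Sig (fst x))) (A (fst x) (T.zb (fst x) (snd x)))) (Sig (fst x))) / (real (NN (fst x)))\<^sup>2) \<longlongrightarrow> 0) (prob_filter M)"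
  shows "((\<lambda>x. bform (NN (fst x)) (A (fst x) (T.zb (fst x) (snd x))) (T.mx (fst x) w (snd x)) (T.mx (fst x) w (snd x)) / real (NN (fst x))) \<longlongrightarrow> wdot n w w * k) (prob_filter M)"
proof -
  define \<tau> where "\<tau> = wdot n w w"
  define tr1 where "tr1 t z = mtrace (NN t) (mmul (NN t) (A t z) (Sig t))" for t z
  define tr2 where "tr2 t z = mtrace (NN t) (mmul (NN t) (mmul (NN t) (mmul (NN t) (A t z) (Sig t)) (A t z)) (Sig t))" for t z
  define q where "q t x = (bform (NN t) (A t (fst x)) (mix n w (snd x)) (mix n w (snd x)) - \<tau> * tr1 t (fst x)) / real (NN t)" for t x
  define v where "v t z = 2 * \<tau>\<^sup>2 * tr2 t z / (real (NN t))\<^sup>2" for t z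
  have tr1m: "tr1 t \<in> borel_measurable (block (z_labels (mm t)) (NN t))" for t
    unfolding tr1_def by (intro mtrace_measurable mmul_measurable Am borel_measurable_const)
  have tr2m: "tr2 t \<in> borel_measurable (block (z_labels (mm t)) (NN t))" for t
    unfolding tr2_def by (intro mtrace_measurable mmul_measurable Am borel_measurable_const)
  have "((\<lambda>x. q (fst x) (T.zb (fst x) (snd x), T.yb (fst x) (snd x))) \<longlongrightarrow> 0) (prob_filter M)"
  proof (rule conditional_chebyshev[OF T.prob_space_axioms T.indep_blocks])
    show "q t \<in> borel_measurable (block (z_labels (mm t)) (NN t) \<Otimes>\<^sub>M block (xy_labels n) (NN t))" for t
      unfolding q_def
      by (intro borel_measurable_divide borel_measurable_diff borel_measurable_times borel_measurable_const
          measurable_compose[OF measurable_fst tr1m] T.bform_pair_measurable Am mix_block_measurable)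
    show "v t \<in> borel_measurable (block (z_labels (mm t)) (NN t))" for t
      unfolding v_def by (intro borel_measurable_divide borel_measurable_times borel_measurable_const tr2m)
    show "((\<lambda>x. v (fst x) (T.zb (fst x) (snd x))) \<longlongrightarrow> 0) (prob_filter M)"
      using tendsto_mult_right_zero[OF var, of "2 * \<tau>\<^sup>2"] by (simp add: v_def tr2_def)
    fix t and z :: "'p lab \<Rightarrow> nat \<Rightarrow> real"
    have mm: "(\<lambda>\<omega>. bform (NN t) (A t z) (T.mx t w \<omega>) (T.mx t w \<omega>)) \<in> borel_measurable (M t)"
      by (intro bform_measurable T.mx_measurable borel_measurable_const)
    have "(\<integral>\<^sup>+\<omega>. ennreal ((q t (z, T.yb t \<omega>))\<^sup>2) \<partial>M t)
      = (\<integral>\<^sup>+\<omega>. ennreal (1 / (real (NN t))\<^sup>2) * ennreal ((bform (NN t) (A t z) (T.mx t w \<omega>) (T.mx t w \<omega>) - \<tau> * tr1 t z)\<^sup>2) \<partial>M t)"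
      by (intro nn_integral_cong) (simp add: q_def T.mx_def power_divide flip: ennreal_mult)
    also have "\<dots> = ennreal (1 / (real (NN t))\<^sup>2) * (\<integral>\<^sup>+\<omega>. ennreal ((bform (NN t) (A t z) (T.mx t w \<omega>) (T.mx t w \<omega>) - \<tau> * tr1 t z)\<^sup>2) \<partial>M t)"
      using mm by (intro nn_integral_cmult) simp
    also have "\<dots> = ennreal (1 / (real (NN t))\<^sup>2) * ennreal (2 * \<tau>\<^sup>2 * tr2 t z)"
      unfolding \<tau>_def tr1_def tr2_def T.quadratic_second_moment_trace[OF As Ap] ..
    also have "\<dots> = ennreal (v t z)"
      using T.trace_sandwich_nonneg[OF As Ap, of t z] by (simp add: v_def tr2_def flip: ennreal_mult)
    finally show "(\<integral>\<^sup>+\<omega>. ennreal ((q t (z, T.yb t \<omega>))\<^sup>2) \<partial>M t) \<le> ennreal (v t z)" by simp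
  qed
  from tendsto_add[OF this tendsto_mult_left[OF tr, of \<tau>]]
  show ?thesis by (simp add: q_def tr1_def T.mx_def \<tau>_def diff_divide_distrib)
qed

lemma trace_zsand_div: "((\<lambda>x. mtrace (NN (fst x)) (mmul (NN (fst x)) (T.zsand (fst x) (T.zb (fst x) (snd x))) (Sig (fst x))) / (real (NN (fst x)))\<^sup>2) \<longlongrightarrow> 0) (prob_filter M)"
  using tendsto_mult[OF trace2 inverse_N_tendsto] by (simp add: power2_eq_square)

lemma noise_quadratic_limit:
  "((\<lambda>x. bform (NN (fst x)) (T.Wm (fst x) (snd x)) (T.mx (fst x) w (snd x)) (T.mx (fst x) w (snd x)) / real (NN (fst x))) \<longlongrightarrow> wdot n w w * kap) (prob_filter M)"
  unfolding T.Wm_def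
proof (rule quadratic_limit[where A = "\<lambda>t. zinv (NN t) (mm t) lam"])
  show "((\<lambda>x. mtrace (NN (fst x)) (mmul (NN (fst x)) (zinv (NN (fst x)) (mm (fst x)) lam (T.zb (fst x) (snd x))) (Sig (fst x))) / real (NN (fst x))) \<longlongrightarrow> kap) (prob_filter M)"
    using trace1 unfolding T.Wm_def .
  show "((\<lambda>x. mtrace (NN (fst x)) (mmul (NN (fst x)) (mmul (NN (fst x)) (mmul (NN (fst x)) (zinv (NN (fst x)) (mm (fst x)) lam (T.zb (fst x) (snd x))) (Sig (fst x))) (zinv (NN (fst x)) (mm (fst x)) lam (T.zb (fst x) (snd x)))) (Sig (fst x))) / (real (NN (fst x)))\<^sup>2) \<longlongrightarrow> 0) (prob_filter M)"
    using trace_zsand_div unfolding T.zsand_def .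
qed (rule zinv_measurable T.sym_pd_zinv T.lam_pos)+

text \<open>Here the variance is the trace with four factors \<open>W\<close>;
  \<open>trace_zsand_bound\<close> reduces it to the assumed trace limit, and this is where the
  bound on the eigenvalues of \<open>Sig\<close> enters.\<close>

lemma noise_sandwich_limit:
  "((\<lambda>x. bform (NN (fst x)) (T.zsand (fst x) (T.zb (fst x) (snd x))) (T.mx (fst x) w (snd x)) (T.mx (fst x) w (snd x)) / real (NN (fst x))) \<longlongrightarrow> wdot n w w * K) (prob_filter M)"
proof (rule quadratic_limit[where A = T.zsand])
  let ?f = "\<lambda>x. mtrace (NN (fst x)) (mmul (NN (fst x)) (mmul (NN (fst x)) (mmul (NN (fst x)) (T.zsand (fst x) (T.zb (fst x) (snd x))) (Sig (fst x))) (T.zsand (fst x) (T.zb (fst x) (snd x)))) (Sig (fst x))) / (real (NN (fst x)))\<^sup>2"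
  let ?g = "\<lambda>x. u\<^sup>2 * (1 / lam\<^sup>2) * (mtrace (NN (fst x)) (mmul (NN (fst x)) (T.zsand (fst x) (T.zb (fst x) (snd x))) (Sig (fst x))) / (real (NN (fst x)))\<^sup>2)"
  show "(?f \<longlongrightarrow> 0) (prob_filter M)"
  proof (rule tendsto_sandwich[of "\<lambda>_. 0" _ _ ?g])
    show "\<forall>\<^sub>F x in prob_filter M. 0 \<le> ?f x"
      by (intro always_eventually allI divide_nonneg_nonneg T.trace_sandwich_nonneg T.zsand_sym T.zsand_nonneg) simp
    have "\<forall>\<^sub>F t in sequentially. \<forall>\<omega>\<in>space (M t). ?f (t, \<omega>) \<le> ?g (t, \<omega>)"
      using Sig_bound
    proof eventually_elim
      case (elim t)
      show ?case
      proof
        fix \<omega>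
        show "?f (t, \<omega>) \<le> ?g (t, \<omega>)"
          using divide_right_mono[OF T.trace_zsand_bound[OF elim[rule_format] u_nonneg, of "T.zb t \<omega>"], of "(real (NN t))\<^sup>2"] by simp
      qed
    qed
    then show "\<forall>\<^sub>F x in prob_filter M. ?f x \<le> ?g x" by (rule eventually_prob_filter_seq)
    show "(?g \<longlongrightarrow> 0) (prob_filter M)" by (rule tendsto_mult_right_zero[OF trace_zsand_div])
  qed simp
qed (rule T.zsand_measurable T.zsand_sym T.zsand_nonneg trace2 | assumption)+

text \<open>Polarisation of the quadratic limit, since \<open>mx\<close> is linear in the
  weights.\<close>

lemma noise_bilinear_limit:
  "((\<lambda>x. bform (NN (fst x)) (T.Wm (fst x) (snd x)) (T.mx (fst x) w (snd x)) (T.mx (fst x) w' (snd x)) / real (NN (fst x))) \<longlongrightarrow> wdot n w w' * kap) (prob_filter M)"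
proof -
  let ?b = "\<lambda>w w' x. bform (NN (fst x)) (T.Wm (fst x) (snd x)) (T.mx (fst x) w (snd x)) (T.mx (fst x) w' (snd x)) / real (NN (fst x))"
  have mx: "T.mx t (\<lambda>l. w l + w' l) \<omega> = (\<lambda>a. T.mx t w \<omega> a + T.mx t w' \<omega> a)" for t \<omega>
    by (simp add: T.mx_def mix_def fun_eq_iff distrib_right sum.distrib)
  have wd: "wdot n (\<lambda>l. w l + w' l) (\<lambda>l. w l + w' l) = wdot n w w + 2 * wdot n w w' + wdot n w' w'"
    by (simp add: wdot_def algebra_simps sum.distrib sum_distrib_left)
  have "((\<lambda>x. (?b (\<lambda>l. w l + w' l) (\<lambda>l. w l + w' l) x - ?b w w x - ?b w' w' x) / 2) \<longlongrightarrow>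
      (wdot n (\<lambda>l. w l + w' l) (\<lambda>l. w l + w' l) * kap - wdot n w w * kap - wdot n w' w' * kap) / 2) (prob_filter M)"
    by (intro tendsto_intros noise_quadratic_limit) simp
  also have "(\<lambda>x. (?b (\<lambda>l. w l + w' l) (\<lambda>l. w l + w' l) x - ?b w w x - ?b w' w' x) / 2) = ?b w w'"
  proof
    fix x
    have "bform (NN (fst x)) (T.Wm (fst x) (snd x)) (T.mx (fst x) w' (snd x)) (T.mx (fst x) w (snd x)) =
       bform (NN (fst x)) (T.Wm (fst x) (snd x)) (T.mx (fst x) w (snd x)) (T.mx (fst x) w' (snd x))"
      unfolding T.Wm_def by (rule bform_sym_on[OF T.sym_pd_zinv(1)])
    then show "(?b (\<lambda>l. w l + w' l) (\<lambda>l. w l + w' l) x - ?b w w x - ?b w' w' x) / 2 = ?b w w' x"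
      unfolding mx bform_add_left bform_add_right by (simp add: add_divide_distrib)
  qed
  also have "(wdot n (\<lambda>l. w l + w' l) (\<lambda>l. w l + w' l) * kap - wdot n w w * kap - wdot n w' w' * kap) / 2 = wdot n w w' * kap"
    unfolding wd by (simp add: algebra_simps)
  finally show ?thesis .
qed

text \<open>Given \<open>W\<close>, the form is centred with variance proportional to the form of
  \<open>W Sig W\<close> at \<open>p\<close>. The latter is at most of order \<open>N\<close>, so
  division by \<open>N\<^sup>2\<close> sends the variance to 0.\<close>

lemma noise_linear_limit:
  assumes p: "((\<lambda>x. bform (NN (fst x)) (T.zsand (fst x) (T.zb (fst x) (snd x))) (p (fst x)) (p (fst x)) / real (NN (fst x))) \<longlongrightarrow> d) (prob_filter M)"
  shows "((\<lambda>x. bform (NN (fst x)) (T.Wm (fst x) (snd x)) (p (fst x)) (T.mx (fst x) w (snd x)) / real (NN (fst x))) \<longlongrightarrow> 0) (prob_filter M)"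
proof -
  define \<tau> where "\<tau> = wdot n w w"
  define q where "q t x = bform (NN t) (zinv (NN t) (mm t) lam (fst x)) (p t) (mix n w (snd x)) / real (NN t)"
    for t and x :: "('p lab \<Rightarrow> nat \<Rightarrow> real) \<times> ('p lab \<Rightarrow> nat \<Rightarrow> real)"
  define v where "v t z = \<tau> * bform (NN t) (T.zsand t z) (p t) (p t) / (real (NN t))\<^sup>2" for t z
  have "((\<lambda>x. q (fst x) (T.zb (fst x) (snd x), T.yb (fst x) (snd x))) \<longlongrightarrow> 0) (prob_filter M)"
  proof (rule conditional_chebyshev[OF T.prob_space_axioms T.indep_blocks])
    show "q t \<in> borel_measurable (block (z_labels (mm t)) (NN t) \<Otimes>\<^sub>M block (xy_labels n) (NN t))" for t
      unfolding q_def
      by (intro borel_measurable_divide borel_measurable_const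
          T.bform_pair_measurable[of t _ "\<lambda>_. p t"] zinv_measurable T.lam_pos mix_block_measurable)
    show "v t \<in> borel_measurable (block (z_labels (mm t)) (NN t))" for t
      unfolding v_def by (intro borel_measurable_divide borel_measurable_times borel_measurable_const bform_measurable T.zsand_measurable)
    show "((\<lambda>x. v (fst x) (T.zb (fst x) (snd x))) \<longlongrightarrow> 0) (prob_filter M)"
      using tendsto_mult[OF tendsto_mult_left[OF p, of \<tau>] inverse_N_tendsto] by (simp add: v_def power2_eq_square)
    fix t and z :: "'p lab \<Rightarrow> nat \<Rightarrow> real"
    let ?c = "mvec (NN t) (zinv (NN t) (mm t) lam z) (p t)"
    have mm: "(\<lambda>\<omega>. dot (NN t) ?c (T.mx t w \<omega>)) \<in> borel_measurable (M t)"
      by (rule gaussian_measurable[OF T.mx_gaussian])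
    have "(\<integral>\<^sup>+\<omega>. ennreal ((q t (z, T.yb t \<omega>))\<^sup>2) \<partial>M t)
      = (\<integral>\<^sup>+\<omega>. ennreal (1 / (real (NN t))\<^sup>2) * ennreal ((dot (NN t) ?c (T.mx t w \<omega>))\<^sup>2) \<partial>M t)"
      by (intro nn_integral_cong) (simp add: q_def T.mx_def T.bform_zinv_dot power_divide flip: ennreal_mult)
    also have "\<dots> = ennreal (1 / (real (NN t))\<^sup>2) * (\<integral>\<^sup>+\<omega>. ennreal ((dot (NN t) ?c (T.mx t w \<omega>))\<^sup>2) \<partial>M t)"
      using mm by (intro nn_integral_cmult) simp
    also have "\<dots> = ennreal (1 / (real (NN t))\<^sup>2) * ennreal (\<tau> * bform (NN t) (T.zsand t z) (p t) (p t))"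
      unfolding \<tau>_def T.linear_second_moment T.bform_zsand ..
    also have "\<dots> = ennreal (v t z)"
      by (simp add: v_def flip: ennreal_mult')
    finally show "(\<integral>\<^sup>+\<omega>. ennreal ((q t (z, T.yb t \<omega>))\<^sup>2) \<partial>M t) \<le> ennreal (v t z)" by simp
  qed
  then show ?thesis by (simp add: q_def T.mx_def T.Wm_def)
qed

end

text \<open>The two Gaussian integrations cannot be chained directly, because the factor
  \<open>b\<close> produced by the first depends on the mixture \<open>w\<close> that the second
  integrates. Hence \<open>b\<close> is replaced by its limit \<open>b'\<close> in between, at a
  cost that vanishes since \<open>a\<close> has modulus 1.\<close>

lemma (in noise_seq) score_char_limit:
  assumes w: "wdot n w w' = 0"
    and p: "((\<lambda>x. bform (NN (fst x)) (T.zsand (fst x) (T.zb (fst x) (snd x))) (p (fst x)) (p (fst x)) / real (NN (fst x))) \<longlongrightarrow> d) (prob_filter M)"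
  shows "(\<lambda>t. \<integral>\<omega>. iexp (1 / sqrt (real (NN t)) * (bform (NN t) (T.Wm t \<omega>) (p t) (T.mx t w \<omega>) + bform (NN t) (T.Wm t \<omega>) (T.mx t w \<omega>) (T.mx t w' \<omega>))) \<partial>M t)
    \<longlonglongrightarrow> complex_of_real (exp (- (wdot n w w * (d + wdot n w' w' * K)) / 2))"
proof -
  define s where "s t = 1 / sqrt (real (NN t))" for t
  define \<tau> where "\<tau> = wdot n w w"
  define \<tau>' where "\<tau>' = wdot n w' w'"
  have s2: "(s t)\<^sup>2 = 1 / real (NN t)" for t by (simp add: s_def power_divide)
  have pos: "\<tau> \<ge> 0" "\<tau>' \<ge> 0" by (simp_all add: \<tau>_def \<tau>'_def wdot_def sum_nonneg)
  define a where "a t \<omega> = iexp (s t * bform (NN t) (T.Wm t \<omega>) (p t) (T.mx t w \<omega>))" for t \<omega>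
  define b where "b t \<omega> = exp (- ((s t)\<^sup>2 * (\<tau>' * bform (NN t) (T.zsand t (T.zb t \<omega>)) (T.mx t w \<omega>) (T.mx t w \<omega>))) / 2)" for t \<omega>
  define b' where "b' = exp (- (\<tau>' * (\<tau> * K)) / 2)"
  define c where "c t \<omega> = exp (- ((s t)\<^sup>2 * (\<tau> * bform (NN t) (T.zsand t (T.zb t \<omega>)) (p t) (p t))) / 2)" for t \<omega>
  define c' where "c' = exp (- (\<tau> * d) / 2)"
  have am[measurable]: "a t \<in> borel_measurable (M t)" for t
  proof -
    have "(\<lambda>\<omega>. bform (NN t) (T.Wm t \<omega>) (p t) (T.mx t w \<omega>)) \<in> borel_measurable (M t)"
      by (intro bform_measurable T.Wm_measurable T.mx_measurable borel_measurable_const)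
    then show ?thesis unfolding a_def by measurable
  qed
  have zm: "(\<lambda>\<omega>. T.zsand t (T.zb t \<omega>) i j) \<in> borel_measurable (M t)" if "i < NN t" "j < NN t" for t i j
    by (rule measurable_compose[OF T.zb_measurable T.zsand_measurable[OF that]])
  have bm[measurable]: "b t \<in> borel_measurable (M t)" for t
  proof -
    have "(\<lambda>\<omega>. bform (NN t) (T.zsand t (T.zb t \<omega>)) (T.mx t w \<omega>) (T.mx t w \<omega>)) \<in> borel_measurable (M t)"
      by (intro bform_measurable zm T.mx_measurable)
    then show ?thesis unfolding b_def by measurable
  qed
  have cm[measurable]: "c t \<in> borel_measurable (M t)" for t
  proof -
    have "(\<lambda>\<omega>. bform (NN t) (T.zsand t (T.zb t \<omega>)) (p t) (p t)) \<in> borel_measurable (M t)"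
      by (intro bform_measurable zm borel_measurable_const)
    then show ?thesis unfolding c_def by measurable
  qed
  have a1: "cmod (a t \<omega>) = 1" for t \<omega> by (simp add: a_def)
  have b1: "0 \<le> b t \<omega>" "b t \<omega> \<le> 1" for t \<omega>
    using mult_nonneg_nonneg[OF pos(2) T.zsand_nonneg[of t "T.zb t \<omega>" "T.mx t w \<omega>"]] by (auto simp: b_def)
  have c1: "0 \<le> c t \<omega>" "c t \<omega> \<le> 1" for t \<omega>
    using mult_nonneg_nonneg[OF pos(1) T.zsand_nonneg[of t "T.zb t \<omega>" "p t"]] by (auto simp: c_def)
  have b_lim: "((\<lambda>x. b (fst x) (snd x)) \<longlongrightarrow> b') (prob_filter M)"
  proof -
    have "((\<lambda>x. exp (- (\<tau>' * (bform (NN (fst x)) (T.zsand (fst x) (T.zb (fst x) (snd x))) (T.mx (fst x) w (snd x)) (T.mx (fst x) w (snd x)) / real (NN (fst x)))) / 2)) \<longlongrightarrow> b') (prob_filter M)"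
      unfolding b'_def \<tau>_def by (intro tendsto_intros noise_sandwich_limit) simp
    then show ?thesis by (simp add: b_def s2)
  qed
  have c_lim: "((\<lambda>x. c (fst x) (snd x)) \<longlongrightarrow> c') (prob_filter M)"
  proof -
    have "((\<lambda>x. exp (- (\<tau> * (bform (NN (fst x)) (T.zsand (fst x) (T.zb (fst x) (snd x))) (p (fst x)) (p (fst x)) / real (NN (fst x)))) / 2)) \<longlongrightarrow> c') (prob_filter M)"
      unfolding c'_def by (intro tendsto_intros p) simp
    then show ?thesis by (simp add: c_def s2)
  qed
  have 1: "(\<lambda>t. \<integral>\<omega>. a t \<omega> * complex_of_real (b t \<omega> - b') \<partial>M t) \<longlonglongrightarrow> 0"
  proof (rule expectation_tendsto_prob_filter_0[OF T.prob_space_axioms, where B = "1 + \<bar>b'\<bar>"])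
    show "norm (a t \<omega> * complex_of_real (b t \<omega> - b')) \<le> 1 + \<bar>b'\<bar>" for t \<omega>
      using b1[of t \<omega>] abs_triangle_ineq4[of "b t \<omega>" b'] by (simp add: norm_mult a1 del: of_real_diff)
    have "((\<lambda>x. b (fst x) (snd x) - b') \<longlongrightarrow> 0) (prob_filter M)"
      using tendsto_diff[OF b_lim tendsto_const[of b']] by simp
    then have "((\<lambda>x. norm (b (fst x) (snd x) - b')) \<longlongrightarrow> 0) (prob_filter M)" by (rule tendsto_norm_zero)
    then have "((\<lambda>x. norm (a (fst x) (snd x) * complex_of_real (b (fst x) (snd x) - b'))) \<longlongrightarrow> 0) (prob_filter M)"
      by (simp add: norm_mult a1 del: of_real_diff)
    then show "((\<lambda>x. a (fst x) (snd x) * complex_of_real (b (fst x) (snd x) - b')) \<longlongrightarrow> 0) (prob_filter M)"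
      by (rule tendsto_norm_zero_cancel)
  qed measurable
  have 2: "(\<lambda>t. \<integral>\<omega>. c t \<omega> - c' \<partial>M t) \<longlonglongrightarrow> 0"
  proof (rule expectation_tendsto_prob_filter_0[OF T.prob_space_axioms, where B = "1 + \<bar>c'\<bar>"])
    show "norm (c t \<omega> - c') \<le> 1 + \<bar>c'\<bar>" for t \<omega>
      using c1[of t \<omega>] abs_triangle_ineq4[of "c t \<omega>" c'] by simp
    show "((\<lambda>x. c (fst x) (snd x) - c') \<longlongrightarrow> 0) (prob_filter M)"
      using tendsto_diff[OF c_lim tendsto_const[of c']] by simp
  qed measurable
  have ic: "integrable (M t) (c t)" for t
    by (rule T.integrable_const_bound[where B = 1]) (use c1 in auto)
  have ia: "integrable (M t) (a t)" for t
    by (rule T.integrable_const_bound[where B = 1]) (use a1 in auto)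
  have iab: "integrable (M t) (\<lambda>\<omega>. a t \<omega> * complex_of_real (b t \<omega>))" for t
    by (rule T.integrable_const_bound[where B = 1]) (use a1 b1 in \<open>auto simp: norm_mult\<close>)
  have ea: "(\<integral>\<omega>. a t \<omega> \<partial>M t) = complex_of_real (\<integral>\<omega>. c t \<omega> \<partial>M t)" for t
    unfolding a_def T.char_linear c_def \<tau>_def by (rule integral_complex_of_real)
  have "(\<lambda>t. (\<integral>\<omega>. c t \<omega> - c' \<partial>M t) + c') \<longlonglongrightarrow> 0 + c'" by (intro tendsto_intros 2)
  then have c_conv: "(\<lambda>t. \<integral>\<omega>. c t \<omega> \<partial>M t) \<longlonglongrightarrow> c'" using ic by (simp add: T.prob_space)
  \<comment> \<open>Decomposition \<open>a b = a (b - b') + a b'\<close>, the mean of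
    \<open>a\<close> being equal to that of \<open>c\<close>.\<close>
  have "(\<lambda>t. (\<integral>\<omega>. a t \<omega> * complex_of_real (b t \<omega> - b') \<partial>M t) + complex_of_real (\<integral>\<omega>. c t \<omega> \<partial>M t) * complex_of_real b') \<longlonglongrightarrow> 0 + complex_of_real c' * complex_of_real b'"
    by (intro tendsto_intros 1 c_conv)
  moreover have "(\<integral>\<omega>. a t \<omega> * complex_of_real (b t \<omega> - b') \<partial>M t) + complex_of_real (\<integral>\<omega>. c t \<omega> \<partial>M t) * complex_of_real b'
      = (\<integral>\<omega>. a t \<omega> * complex_of_real (b t \<omega>) \<partial>M t)" for t
    unfolding ea[symmetric] using ia iab by (simp add: right_diff_distrib)
  moreover have "(\<integral>\<omega>. a t \<omega> * complex_of_real (b t \<omega>) \<partial>M t) = (\<integral>\<omega>. iexp (s t * (bform (NN t) (T.Wm t \<omega>) (p t) (T.mx t w \<omega>) + bform (NN t) (T.Wm t \<omega>) (T.mx t w \<omega>) (T.mx t w' \<omega>))) \<partial>M t)" for t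
    unfolding a_def b_def \<tau>'_def T.char_score[OF w] ..
  moreover have "0 + complex_of_real c' * complex_of_real b' = complex_of_real (exp (- (\<tau> * (d + \<tau>' * K)) / 2))"
    by (simp add: c'_def b'_def algebra_simps add_divide_distrib flip: of_real_mult exp_add)
  ultimately show ?thesis unfolding s_def \<tau>_def \<tau>'_def by simp
qed

section \<open>Matrices of fixed size\<close>

lemma matrix_inv_eqI:
  fixes A :: "real^'p::finite^'p"
  assumes "A ** B = mat 1"
  shows "matrix_inv A = B"
proof -
  have BA: "B ** A = mat 1" using assms matrix_left_right_inverse by blast
  then have "A ** matrix_inv A = mat 1 \<and> matrix_inv A ** A = mat 1"
    unfolding matrix_inv_def using assms by (intro someI[of "\<lambda>A'. A ** A' = mat 1 \<and> A' ** A = mat 1" B]) auto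
  then show ?thesis by (metis BA matrix_mul_assoc matrix_mul_lid matrix_mul_rid)
qed

lemma matrix_inv_invertible:
  fixes A :: "real^'p::finite^'p"
  assumes "invertible A"
  shows "A ** matrix_inv A = mat 1" "matrix_inv A ** A = mat 1"
proof -
  obtain B where "A ** B = mat 1" "B ** A = mat 1" using assms by (auto simp: invertible_def)
  then show "A ** matrix_inv A = mat 1" "matrix_inv A ** A = mat 1" using matrix_inv_eqI by metis+
qed

lemma norm_matrix_vector_le:
  fixes A :: "real^'n::finite^'m::finite"
  shows "norm (A *v x) \<le> norm A * norm x"
proof -
  have "norm (A *v x) = L2_set (\<lambda>i. norm ((A $ i) \<bullet> x)) UNIV"
    unfolding norm_vec_def[of "A *v x"] by (simp add: matrix_vector_mult_def inner_vec_def)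
  also have "\<dots> \<le> L2_set (\<lambda>i. norm (A $ i) * norm x) UNIV"
    by (intro L2_set_mono) (auto simp: Cauchy_Schwarz_ineq2)
  also have "\<dots> = norm A * norm x"
    unfolding norm_vec_def[of A] by (simp add: L2_set_left_distrib)
  finally show ?thesis .
qed

lemma abs_inner_matrix_le:
  fixes A :: "real^'n::finite^'n"
  shows "\<bar>x \<bullet> (A *v x)\<bar> \<le> norm A * (norm x)\<^sup>2"
proof -
  have "\<bar>x \<bullet> (A *v x)\<bar> \<le> norm x * norm (A *v x)" by (rule Cauchy_Schwarz_ineq2)
  also have "\<dots> \<le> norm x * (norm A * norm x)" by (intro mult_left_mono norm_matrix_vector_le) auto
  finally show ?thesis by (simp add: power2_eq_square mult_ac)
qed

lemma inner_matrix_eq_sum: "x \<bullet> (A *v y) = (\<Sum>i\<in>UNIV. \<Sum>j\<in>UNIV. x $ i * A $ i $ j * y $ j)"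
  by (simp add: inner_vec_def matrix_vector_mult_def sum_distrib_left mult.assoc)

lemma inner_matrix_sym:
  fixes A :: "real^'n::finite^'n"
  assumes "transpose A = A" shows "x \<bullet> (A *v y) = (A *v x) \<bullet> y"
  by (metis assms dot_lmul_matrix vector_transpose_matrix)

lemma tendsto_matrixI:
  fixes f :: "'x \<Rightarrow> real^'n::finite^'m::finite"
  assumes "\<And>i j. ((\<lambda>x. f x $ i $ j) \<longlongrightarrow> l $ i $ j) F"
  shows "(f \<longlongrightarrow> l) F"
  by (intro vec_tendstoI assms)

lemma tendsto_matrix_vector_mult:
  fixes f :: "'x \<Rightarrow> real^'n::finite^'m::finite"
  assumes "(f \<longlongrightarrow> l) F" "(g \<longlongrightarrow> v) F"
  shows "((\<lambda>x. f x *v g x) \<longlongrightarrow> l *v v) F"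
  unfolding matrix_vector_mult_def
  by (intro tendsto_vec_lambda tendsto_sum tendsto_mult tendsto_vec_nth assms)

text \<open>A factor of \<open>V\<close> maps independent standard normals to the desired vector;
  this includes singular \<open>V\<close>, for which there is no density.\<close>

lemma gaussian_vector_exists:
  fixes V :: "real^'p::finite^'p"
  assumes sym: "transpose V = V" and psd: "\<And>a. a \<bullet> (V *v a) \<ge> 0"
  obtains Q :: "(real^'p) measure" and G where "prob_space Q" "G \<in> borel_measurable Q"
    "\<And>a. gaussian Q (\<lambda>\<omega>. a \<bullet> G \<omega>) (a \<bullet> (V *v a))"
proof -
  have sym': "V $ i $ j = V $ j $ i" for i j
  proof -
    have "transpose V $ i $ j = V $ j $ i" by (simp add: transpose_def)
    then show ?thesis by (simp add: sym)
  qed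
  have "\<exists>l. \<forall>i\<in>UNIV. \<forall>j\<in>UNIV. V $ i $ j = (\<Sum>k\<in>(UNIV::'p set). l k i * l k j)"
  proof (rule psd_factor[of UNIV "\<lambda>i j. V $ i $ j"])
    show "0 \<le> quad UNIV (\<lambda>i j. V $ i $ j) c" for c
      using psd[of "\<chi> i. c i"] unfolding inner_matrix_eq_sum quad_def by simp
  qed (use sym' in auto)
  then obtain l where l: "\<And>i j. V $ i $ j = (\<Sum>k\<in>(UNIV::'p set). l k i * l k j)" by blast
  interpret std: prob_space std_normal_distribution
    using real_dist_normal_dist by (simp add: real_distribution_def)
  interpret P: product_prob_space "\<lambda>_::'p. std_normal_distribution" UNIV ..
  define P where "P = Pi\<^sub>M (UNIV :: 'p set) (\<lambda>_. std_normal_distribution)"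
  have psP: "prob_space P" unfolding P_def by (rule P.prob_space_axioms)
  interpret PP: prob_space P by fact
  define g where "g \<omega> = (\<chi> i. \<Sum>k\<in>UNIV. l k i * \<omega> k)" for \<omega> :: "'p \<Rightarrow> real"
  have cm[measurable]: "(\<lambda>\<omega>. \<omega> k) \<in> borel_measurable P" for k
    unfolding P_def by (rule measurable_compose[OF measurable_component_singleton]) auto
  have gm[measurable]: "g \<in> borel_measurable P"
  proof (subst borel_measurable_euclidean_space, intro ballI)
    fix b :: "real^'p" assume "b \<in> Basis"
    have "(\<lambda>\<omega>. g \<omega> \<bullet> b) = (\<lambda>\<omega>. \<Sum>i\<in>UNIV. (\<Sum>k\<in>UNIV. l k i * \<omega> k) * b $ i)"
      by (simp add: g_def inner_vec_def)
    then show "(\<lambda>\<omega>. g \<omega> \<bullet> b) \<in> borel_measurable P" by simp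
  qed
  define Q where "Q = distr P borel g"
  have "prob_space Q" unfolding Q_def by (rule PP.prob_space_distr) simp
  moreover have "(\<lambda>x. x) \<in> borel_measurable Q" unfolding Q_def by simp
  moreover have "gaussian Q (\<lambda>x. a \<bullet> x) (a \<bullet> (V *v a))" for a
    unfolding gaussian_def
  proof (intro conjI allI psd)
    show "(\<lambda>x. a \<bullet> x) \<in> borel_measurable Q" unfolding Q_def by simp
    fix u
    define c where "c k = (\<Sum>i\<in>UNIV. a $ i * l k i)" for k
    have ag: "a \<bullet> g \<omega> = (\<Sum>k\<in>UNIV. c k * \<omega> k)" for \<omega>
    proof -
      have "a \<bullet> g \<omega> = (\<Sum>i\<in>UNIV. \<Sum>k\<in>UNIV. a $ i * l k i * \<omega> k)"
        by (simp add: g_def inner_vec_def sum_distrib_left mult.assoc)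
      also have "\<dots> = (\<Sum>k\<in>UNIV. \<Sum>i\<in>UNIV. a $ i * l k i * \<omega> k)" by (rule sum.swap)
      finally show ?thesis by (simp add: c_def sum_distrib_right)
    qed
    have c2: "(\<Sum>k\<in>UNIV. (c k)\<^sup>2) = a \<bullet> (V *v a)"
    proof -
      have "a \<bullet> (V *v a) = (\<Sum>i\<in>UNIV. \<Sum>j\<in>UNIV. \<Sum>k\<in>UNIV. (a $ i * l k i) * (a $ j * l k j))"
        unfolding inner_matrix_eq_sum l by (intro sum.cong refl) (simp add: sum_distrib_left sum_distrib_right mult_ac)
      also have "\<dots> = (\<Sum>k\<in>UNIV. \<Sum>i\<in>UNIV. \<Sum>j\<in>UNIV. (a $ i * l k i) * (a $ j * l k j))"
        by (subst (2) sum.swap, subst sum.swap) (rule refl)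
      finally show ?thesis unfolding c_def power2_eq_square sum_product by simp
    qed
    have "(\<integral>x. iexp (u * (a \<bullet> x)) \<partial>Q) = (\<integral>\<omega>. iexp (u * (a \<bullet> g \<omega>)) \<partial>P)"
      unfolding Q_def by (subst integral_distr) auto
    also have "\<dots> = (\<integral>\<omega>. (\<Prod>k\<in>UNIV. iexp ((u * c k) * \<omega> k)) \<partial>P)"
      unfolding ag by (simp add: sum_distrib_left exp_sum mult.assoc)
    also have "\<dots> = (\<Prod>k\<in>UNIV. \<integral>y. iexp ((u * c k) * y) \<partial>std_normal_distribution)"
      unfolding P_def by (rule P.product_integral_prod) (auto intro!: std.integrable_iexp)
    also have "\<dots> = (\<Prod>k\<in>UNIV. complex_of_real (exp (- ((u * c k)\<^sup>2) / 2)))"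
      unfolding char_def[symmetric] char_std_normal_distribution ..
    also have "\<dots> = complex_of_real (exp (\<Sum>k\<in>UNIV. - ((u * c k)\<^sup>2) / 2))"
      by (simp add: exp_sum)
    also have "(\<Sum>k\<in>UNIV. - ((u * c k)\<^sup>2) / 2) = - (u\<^sup>2 * (a \<bullet> (V *v a))) / 2"
      unfolding c2[symmetric] by (simp add: power_mult_distrib sum_negf sum_divide_distrib sum_distrib_left)
    finally show "(\<integral>x. iexp (u * (a \<bullet> x)) \<partial>Q) = complex_of_real (exp (- (u\<^sup>2 * (a \<bullet> (V *v a))) / 2))" .
  qed
  ultimately show ?thesis by (rule that)
qed

lemma gauss_p_if_gaussian:
  assumes "prob_space Q" "G \<in> borel_measurable Q" and g: "\<And>a. gaussian Q (\<lambda>\<omega>. a \<bullet> G \<omega>) (a \<bullet> (V *v a))"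
  shows "gauss_p Q G V"
  unfolding gauss_p_def
proof (intro conjI allI impI assms)
  interpret prob_space Q by fact
  fix a
  show "distributed Q lborel (\<lambda>\<omega>. a \<bullet> G \<omega>) (normal_density 0 (sqrt (a \<bullet> (V *v a))))" if "a \<bullet> (V *v a) > 0"
    by (rule gaussian_imp_distributed[OF g that])
  show "AE \<omega> in Q. a \<bullet> G \<omega> = 0" if "a \<bullet> (V *v a) \<le> 0"
  proof (rule gaussian_zero_AE)
    have "a \<bullet> (V *v a) = 0" using g[of a] that by (auto simp: gaussian_def)
    then show "gaussian Q (\<lambda>\<omega>. a \<bullet> G \<omega>) 0" using g[of a] by simp
  qed
qed

lemma vec_measurableI:
  fixes f :: "'a \<Rightarrow> ('b::euclidean_space)^'n::finite"
  assumes [measurable]: "\<And>i. (\<lambda>\<omega>. f \<omega> $ i) \<in> borel_measurable M"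
  shows "f \<in> borel_measurable M"
proof (subst borel_measurable_euclidean_space, intro ballI)
  fix b :: "'b^'n"
  have "(\<lambda>\<omega>. f \<omega> \<bullet> b) = (\<lambda>\<omega>. \<Sum>i\<in>UNIV. f \<omega> $ i \<bullet> b $ i)" by (simp add: inner_vec_def)
  then show "(\<lambda>\<omega>. f \<omega> \<bullet> b) \<in> borel_measurable M" by simp
qed

text \<open>If the form vanished at a nonzero \<open>x\<close>, then \<open>x\<close> would minimise
  it and the first variation would give \<open>A x = 0\<close>, against invertibility. Compactness
  of the sphere then yields a uniform constant.\<close>

lemma psd_invertible_coercive:
  fixes A :: "real^'p::finite^'p"
  assumes sym: "transpose A = A" and psd: "\<And>x. x \<bullet> (A *v x) \<ge> 0" and inv: "invertible A"
  obtains \<alpha> where "\<alpha> > 0" "\<And>x. \<alpha> * (norm x)\<^sup>2 \<le> x \<bullet> (A *v x)"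
proof -
  have pos: "x \<bullet> (A *v x) > 0" if x: "x \<noteq> 0" for x
  proof (rule ccontr)
    assume "\<not> ?thesis"
    then have z: "x \<bullet> (A *v x) = 0" using psd[of x] by simp
    have "2 * (v \<bullet> (A *v x)) = 0" for v
    proof (rule quadratic_linear_coeff_zero)
      fix t
      have "x \<bullet> (A *v v) = v \<bullet> (A *v x)" using inner_matrix_sym[OF sym, of x v] by (simp add: inner_commute)
      then have "(x + t *\<^sub>R v) \<bullet> (A *v (x + t *\<^sub>R v)) = t * (2 * (v \<bullet> (A *v x))) + t\<^sup>2 * (v \<bullet> (A *v v))"
        using z by (simp add: matrix_vector_right_distrib matrix_vector_mult_scaleR inner_add_left inner_add_right power2_eq_square algebra_simps)
      then show "0 \<le> t * (2 * (v \<bullet> (A *v x))) + t\<^sup>2 * (v \<bullet> (A *v v))" using psd by metis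
    qed
    from this[of "A *v x"] have "A *v x = 0" by simp
    then have "(matrix_inv A ** A) *v x = 0" by (simp add: matrix_vector_mul_assoc[symmetric])
    then show False using x matrix_inv_invertible(2)[OF inv] by simp
  qed
  have "continuous_on (sphere 0 1) (\<lambda>x. x \<bullet> (A *v x))"
    by (intro continuous_intros linear_continuous_on_compose[of _ "\<lambda>x. x"] matrix_vector_mul_linear) 
  moreover have "sphere (0 :: real^'p) 1 \<noteq> {}" by simp
  ultimately obtain x0 where x0: "x0 \<in> sphere 0 1" "\<And>x. x \<in> sphere 0 1 \<Longrightarrow> x0 \<bullet> (A *v x0) \<le> x \<bullet> (A *v x)"
    using continuous_attains_inf[OF compact_sphere] by blast
  show ?thesis
  proof (rule that)
    show "x0 \<bullet> (A *v x0) > 0" by (rule pos) (use x0(1) in auto)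
    fix x :: "real^'p"
    show "x0 \<bullet> (A *v x0) * (norm x)\<^sup>2 \<le> x \<bullet> (A *v x)"
    proof (cases "x = 0")
      case False
      define y where "y = (1 / norm x) *\<^sub>R x"
      have xy: "x = norm x *\<^sub>R y" using False by (simp add: y_def)
      have "x0 \<bullet> (A *v x0) \<le> y \<bullet> (A *v y)" by (rule x0(2)) (use False in \<open>simp add: y_def\<close>)
      then have "x0 \<bullet> (A *v x0) * (norm x)\<^sup>2 \<le> y \<bullet> (A *v y) * (norm x)\<^sup>2" by (rule mult_right_mono) simp
      also have "\<dots> = (norm x *\<^sub>R y) \<bullet> (A *v (norm x *\<^sub>R y))"
        by (simp add: matrix_vector_mult_scaleR power2_eq_square)
      finally show ?thesis using xy by simp
    qed simp
  qed
qed

section \<open>Minimising a ratio of quadratic functions\<close>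

locale quotient_min =
  fixes A D :: "real^'p::finite^'p" and s beta bh :: "real^'p" and f :: real
  assumes A_sym: "transpose A = A" and D_sym: "transpose D = D" and D_psd: "\<And>v. v \<bullet> (D *v v) \<ge> 0"
    and minimal: "\<And>b. (f - 2 * ((bh - beta) \<bullet> s) + (bh - beta) \<bullet> (A *v (bh - beta))) / (1 + bh \<bullet> (D *v bh))
       \<le> (f - 2 * ((b - beta) \<bullet> s) + (b - beta) \<bullet> (A *v (b - beta))) / (1 + b \<bullet> (D *v b))"
begin

definition num :: "real^'p \<Rightarrow> real" where "num b = f - 2 * ((b - beta) \<bullet> s) + (b - beta) \<bullet> (A *v (b - beta))"
definition den :: "real^'p \<Rightarrow> real" where "den b = 1 + b \<bullet> (D *v b)"
definition J where "J = num bh / den bh"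
definition J0 where "J0 = f / den beta"
definition \<delta> where "\<delta> = bh - beta"
text \<open>The first-order residual at \<open>beta\<close> with the multiplier frozen at
  \<open>J0\<close>, which, unlike \<open>J\<close>, does not involve the minimiser.\<close>

definition S0 where "S0 = s + J0 *\<^sub>R (D *v beta)"

lemma den_ge_1: "den b \<ge> 1" using D_psd[of b] by (simp add: den_def)

lemma J_le: "J \<le> num b / den b" using minimal[of b] by (simp add: J_def num_def den_def)

text \<open>By minimality \<open>num b - J * den b\<close> is nonnegative and vanishes at
  \<open>bh\<close>; as a quadratic function of \<open>b\<close> it has zero gradient there.\<close>

lemma first_order: "A *v \<delta> = s + J *\<^sub>R (D *v bh)"
proof -
  let ?r = "A *v \<delta> - s - J *\<^sub>R (D *v bh)"
  have "2 * (v \<bullet> ?r) = 0" for v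
  proof (rule quadratic_linear_coeff_zero)
    fix t
    let ?b = "bh + t *\<^sub>R v"
    have b: "?b - beta = \<delta> + t *\<^sub>R v" by (simp add: \<delta>_def)
    have sA: "\<delta> \<bullet> (A *v v) = v \<bullet> (A *v \<delta>)" using inner_matrix_sym[OF A_sym, of \<delta> v] by (simp add: inner_commute)
    have sD: "bh \<bullet> (D *v v) = v \<bullet> (D *v bh)" using inner_matrix_sym[OF D_sym, of bh v] by (simp add: inner_commute)
    have n: "num ?b = num bh + 2 * t * (v \<bullet> (A *v \<delta>) - v \<bullet> s) + t\<^sup>2 * (v \<bullet> (A *v v))"
      unfolding num_def b \<delta>_def[symmetric] using sA
      by (simp add: matrix_vector_right_distrib matrix_vector_mult_scaleR inner_add_left inner_add_right power2_eq_square algebra_simps)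
    have d: "den ?b = den bh + 2 * t * (v \<bullet> (D *v bh)) + t\<^sup>2 * (v \<bullet> (D *v v))"
      unfolding den_def using sD
      by (simp add: matrix_vector_right_distrib matrix_vector_mult_scaleR inner_add_left inner_add_right power2_eq_square algebra_simps)
    have "J * den ?b \<le> num ?b" using J_le[of ?b] den_ge_1[of ?b] by (simp add: pos_le_divide_eq)
    moreover have "J * den bh = num bh" using den_ge_1[of bh] by (simp add: J_def)
    ultimately show "0 \<le> t * (2 * (v \<bullet> ?r)) + t\<^sup>2 * (v \<bullet> (A *v v) - J * (v \<bullet> (D *v v)))"
      unfolding n d by (simp add: inner_diff_right algebra_simps)
  qed
  from this[of ?r] have "?r \<bullet> ?r = 0" by (simp only: mult_eq_0_iff) simp
  then have "?r = 0" by (simp only: inner_eq_zero_iff)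
  then show ?thesis by (simp only: diff_diff_eq right_minus_eq)
qed

text \<open>Since \<open>J0 * den beta = f\<close>, the constant terms cancel, and every remaining
  term is a product of \<open>\<delta>\<close> with \<open>\<delta>\<close> or \<open>S0\<close>;
  \<open>J - J0\<close> is thus negligible against these once \<open>\<delta>\<close> is
  small.\<close>

lemma J_diff: "J - J0 = (- 2 * (\<delta> \<bullet> S0) + \<delta> \<bullet> (A *v \<delta>) - J0 * (\<delta> \<bullet> (D *v \<delta>))) / den bh"
proof -
  have bh: "beta + \<delta> = bh" by (simp add: \<delta>_def)
  have "beta \<bullet> (D *v \<delta>) = \<delta> \<bullet> (D *v beta)" using inner_matrix_sym[OF D_sym, of beta \<delta>] by (simp add: inner_commute)
  then have "den (beta + \<delta>) = den beta + 2 * (\<delta> \<bullet> (D *v beta)) + \<delta> \<bullet> (D *v \<delta>)"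
    unfolding den_def by (simp add: matrix_vector_right_distrib inner_add_left inner_add_right)
  then have d: "den bh = den beta + 2 * (\<delta> \<bullet> (D *v beta)) + \<delta> \<bullet> (D *v \<delta>)" unfolding bh .
  have "J0 * den beta = f" using den_ge_1[of beta] by (simp add: J0_def)
  then have "num bh - J0 * den bh = - 2 * (\<delta> \<bullet> S0) + \<delta> \<bullet> (A *v \<delta>) - J0 * (\<delta> \<bullet> (D *v \<delta>))"
    unfolding d num_def \<delta>_def[symmetric] S0_def by (simp add: inner_add_right algebra_simps)
  moreover have "J - J0 = (num bh - J0 * den bh) / den bh"
    using den_ge_1[of bh] by (simp add: J_def diff_divide_distrib)
  ultimately show ?thesis by simp
qed

text \<open>In the application \<open>A\<close> is close to \<open>\<Delta> + J D\<close>, the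
  excess being the effect of measurement error; splitting \<open>D bh\<close> as
  \<open>D beta + D \<delta>\<close> lets \<open>J D \<delta>\<close> cancel that excess.\<close>

lemma linearised:
  "\<Delta> *v \<delta> - S0 = (\<Delta> - A + J *\<^sub>R D) *v \<delta> + (J - J0) *\<^sub>R (D *v beta)"
proof -
  have "D *v bh = D *v beta + D *v \<delta>" by (simp add: \<delta>_def matrix_vector_mult_diff_distrib)
  then have "A *v \<delta> = s + J *\<^sub>R (D *v beta) + J *\<^sub>R (D *v \<delta>)" using first_order by (simp add: scaleR_add_right)
  then show ?thesis
    by (simp add: S0_def matrix_vector_mult_add_rdistrib matrix_vector_mult_diff_rdistrib scaleR_matrix_vector_assoc[symmetric] algebra_simps)
qed

definition err :: "real^'p^'p \<Rightarrow> real" where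
  "err \<Delta> = norm (\<Delta> - A + J *\<^sub>R D) + (2 * norm \<delta> + norm \<delta> * (norm A + \<bar>J0\<bar> * norm D)) * norm (D *v beta)"

lemma linearised_bound: "norm (\<Delta> *v \<delta> - S0) \<le> err \<Delta> * (norm \<delta> + norm S0)"
proof -
  have "\<bar>J - J0\<bar> \<le> \<bar>- 2 * (\<delta> \<bullet> S0) + \<delta> \<bullet> (A *v \<delta>) - J0 * (\<delta> \<bullet> (D *v \<delta>))\<bar>"
    unfolding J_diff abs_divide using den_ge_1[of bh]
    by (simp add: divide_le_eq mult_left_le_one_le mult_le_cancel_left1)
  also have "\<dots> \<le> 2 * \<bar>\<delta> \<bullet> S0\<bar> + \<bar>\<delta> \<bullet> (A *v \<delta>)\<bar> + \<bar>J0\<bar> * \<bar>\<delta> \<bullet> (D *v \<delta>)\<bar>"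
    unfolding abs_mult[symmetric] by linarith
  also have "\<dots> \<le> 2 * (norm \<delta> * norm S0) + norm A * (norm \<delta>)\<^sup>2 + \<bar>J0\<bar> * (norm D * (norm \<delta>)\<^sup>2)"
    by (intro add_mono mult_left_mono Cauchy_Schwarz_ineq2 abs_inner_matrix_le) auto
  also have "\<dots> = 2 * norm \<delta> * norm S0 + norm \<delta> * (norm A + \<bar>J0\<bar> * norm D) * norm \<delta>"
    by (simp add: power2_eq_square algebra_simps)
  also have "\<dots> \<le> (2 * norm \<delta> + norm \<delta> * (norm A + \<bar>J0\<bar> * norm D)) * norm S0
       + (2 * norm \<delta> + norm \<delta> * (norm A + \<bar>J0\<bar> * norm D)) * norm \<delta>"
    by (intro add_mono mult_right_mono) auto
  finally have JJ: "\<bar>J - J0\<bar> \<le> (2 * norm \<delta> + norm \<delta> * (norm A + \<bar>J0\<bar> * norm D)) * (norm \<delta> + norm S0)"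
    by (simp add: algebra_simps)
  have "norm (\<Delta> *v \<delta> - S0) \<le> norm ((\<Delta> - A + J *\<^sub>R D) *v \<delta>) + norm ((J - J0) *\<^sub>R (D *v beta))"
    unfolding linearised by (rule norm_triangle_ineq)
  also have "\<dots> \<le> norm (\<Delta> - A + J *\<^sub>R D) * norm \<delta> + \<bar>J - J0\<bar> * norm (D *v beta)"
    using norm_matrix_vector_le[of "\<Delta> - A + J *\<^sub>R D" \<delta>] by simp
  also have "\<dots> \<le> norm (\<Delta> - A + J *\<^sub>R D) * (norm \<delta> + norm S0) 
      + (2 * norm \<delta> + norm \<delta> * (norm A + \<bar>J0\<bar> * norm D)) * (norm \<delta> + norm S0) * norm (D *v beta)"
    by (intro add_mono mult_right_mono mult_left_mono JJ) auto
  finally show ?thesis unfolding err_def by (simp add: algebra_simps)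
qed

text \<open>The error is measured relative to the leading term, a form that survives scaling by
  \<open>sqrt N\<close>. The part proportional to the norm of \<open>\<delta> - U\<close> is
  absorbed on the left, which is what the bound 1/2 is for.\<close>

lemma solved_bound:
  assumes inv: "invertible \<Delta>" and small: "norm (matrix_inv \<Delta>) * err \<Delta> \<le> 1/2"
  shows "norm (\<delta> - matrix_inv \<Delta> *v S0) \<le> 2 * norm (matrix_inv \<Delta>) * err \<Delta> * (1 + norm \<Delta>) * norm (matrix_inv \<Delta> *v S0)"
proof -
  let ?P = "matrix_inv \<Delta>"
  define U where "U = ?P *v S0"
  define p where "p = norm ?P * err \<Delta>"
  have P1: "?P *v (\<Delta> *v x) = x" "\<Delta> *v (?P *v x) = x" for x
    using matrix_inv_invertible[OF inv] by (simp_all add: matrix_vector_mul_assoc)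
  have p0: "p \<ge> 0" unfolding p_def err_def by simp
  have SU: "norm S0 \<le> norm \<Delta> * norm U"
    using norm_matrix_vector_le[of \<Delta> U] by (simp add: U_def P1)
  have "\<delta> - U = ?P *v (\<Delta> *v \<delta> - S0)" by (simp add: U_def P1 matrix_vector_mult_diff_distrib)
  then have "norm (\<delta> - U) \<le> norm ?P * norm (\<Delta> *v \<delta> - S0)" using norm_matrix_vector_le[of ?P] by metis
  also have "\<dots> \<le> norm ?P * (err \<Delta> * (norm \<delta> + norm S0))" by (intro mult_left_mono linearised_bound) auto
  also have "\<dots> = p * (norm \<delta> + norm S0)" by (simp add: p_def)
  also have "\<dots> \<le> p * (norm (\<delta> - U) + (1 + norm \<Delta>) * norm U)"
    using norm_triangle_ineq[of "\<delta> - U" U] SU by (intro mult_left_mono p0) (simp add: algebra_simps)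
  also have "\<dots> \<le> 1/2 * norm (\<delta> - U) + p * ((1 + norm \<Delta>) * norm U)"
    using mult_right_mono[OF small[folded p_def], of "norm (\<delta> - U)"] by (simp add: algebra_simps)
  finally have "norm (\<delta> - U) \<le> 2 * p * (1 + norm \<Delta>) * norm U" by (simp add: algebra_simps)
  then show ?thesis unfolding U_def p_def by (simp add: mult.assoc)
qed

text \<open>Quantitative consistency: the limiting criterion grows quadratically around \<open>beta\<close>.\<close>

lemma consistency_bound:
  assumes \<alpha>: "\<And>x. \<alpha> * (norm x)\<^sup>2 \<le> x \<bullet> (\<Delta> *v x)" and D1: "\<And>x. x \<bullet> (D *v x) \<le> (norm x)\<^sup>2"
  shows "\<alpha> * (norm \<delta>)\<^sup>2 \<le> ((2 * den beta + 3) * \<bar>f - kap * den beta\<bar> + norm (s + kap *\<^sub>R (D *v beta)) + norm (A - (\<Delta> + kap *\<^sub>R D))) * (1 + (norm \<delta>)\<^sup>2)"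
proof -
  define e1 where "e1 = \<bar>f - kap * den beta\<bar>"
  define e2 where "e2 = norm (s + kap *\<^sub>R (D *v beta))"
  define e3 where "e3 = norm (A - (\<Delta> + kap *\<^sub>R D))"
  let ?q = "1 + (norm \<delta>)\<^sup>2"
  have q1: "?q \<ge> 1" by simp
  have bh: "beta + \<delta> = bh" by (simp add: \<delta>_def)
  have sD: "beta \<bullet> (D *v \<delta>) = \<delta> \<bullet> (D *v beta)" using inner_matrix_sym[OF D_sym, of beta \<delta>] by (simp add: inner_commute)
  have "den (beta + \<delta>) = den beta + 2 * (\<delta> \<bullet> (D *v beta)) + \<delta> \<bullet> (D *v \<delta>)"
    using sD unfolding den_def by (simp add: matrix_vector_right_distrib inner_add_left inner_add_right)
  then have d: "den bh = den beta + 2 * (\<delta> \<bullet> (D *v beta)) + \<delta> \<bullet> (D *v \<delta>)" unfolding bh .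
  \<comment> \<open>Semidefiniteness at \<open>beta - \<delta>\<close> controls the mixed term by
    the two pure ones.\<close>
  have dle: "den bh \<le> 2 * den beta + 2 * (norm \<delta>)\<^sup>2"
  proof -
    have "0 \<le> (beta - \<delta>) \<bullet> (D *v (beta - \<delta>))" by (rule D_psd)
    then have "2 * (\<delta> \<bullet> (D *v beta)) \<le> beta \<bullet> (D *v beta) + \<delta> \<bullet> (D *v \<delta>)"
      using sD by (simp add: matrix_vector_mult_diff_distrib inner_diff_left inner_diff_right)
    then show ?thesis unfolding d using D1[of \<delta>] by (simp add: den_def)
  qed
  \<comment> \<open>Minimality against the competitor \<open>beta\<close>, where the numerator is
    \<open>f\<close>.\<close>
  have numle: "num bh \<le> f / den beta * den bh"
  proof -
    have "num beta = f" by (simp add: num_def)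
    then have "J \<le> f / den beta" using J_le[of beta] by simp
    then have "J * den bh \<le> f / den beta * den bh" using den_ge_1[of bh] by (intro mult_right_mono) auto
    then show ?thesis using den_ge_1[of bh] by (simp add: J_def)
  qed
  have fk: "f / den beta - kap \<le> e1"
  proof -
    have "f / den beta - kap = (f - kap * den beta) / den beta" using den_ge_1[of beta] by (simp add: diff_divide_distrib)
    also have "\<dots> \<le> e1 / den beta" unfolding e1_def using den_ge_1[of beta] by (intro divide_right_mono) auto
    also have "\<dots> \<le> e1" using den_ge_1[of beta] by (simp add: e1_def divide_le_eq mult_le_cancel_left1)
    finally show ?thesis .
  qed
  \<comment> \<open>An identity that splits the quadratic growth into the excess of the criterion
    over its limit \<open>kap\<close> and the deviations of \<open>f\<close>, \<open>s\<close> and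
    \<open>A\<close> from their limits.\<close>
  have "\<delta> \<bullet> (\<Delta> *v \<delta>) = num bh - kap * den bh - (f - kap * den beta) + 2 * (\<delta> \<bullet> (s + kap *\<^sub>R (D *v beta)))
      - \<delta> \<bullet> ((A - (\<Delta> + kap *\<^sub>R D)) *v \<delta>)"
    unfolding d num_def \<delta>_def[symmetric]
    by (simp add: inner_add_right matrix_vector_mult_diff_rdistrib matrix_vector_mult_add_rdistrib scaleR_matrix_vector_assoc[symmetric] inner_diff_right algebra_simps)
  also have "\<dots> \<le> (f / den beta - kap) * den bh + e1 + 2 * (norm \<delta> * e2) + e3 * (norm \<delta>)\<^sup>2"
    using numle norm_cauchy_schwarz[of \<delta> "s + kap *\<^sub>R (D *v beta)"] abs_inner_matrix_le[of \<delta> "A - (\<Delta> + kap *\<^sub>R D)"]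
    unfolding e1_def e2_def e3_def by (simp add: left_diff_distrib)
  also have "\<dots> \<le> e1 * ((2 * den beta + 2) * ?q) + e1 * ?q + e2 * ?q + e3 * ?q"
  proof (intro add_mono)
    have "(f / den beta - kap) * den bh \<le> e1 * den bh" using fk den_ge_1[of bh] by (intro mult_right_mono) auto
    also have "\<dots> \<le> e1 * ((2 * den beta + 2) * ?q)"
    proof (intro mult_left_mono)
      have "den beta * (norm \<delta>)\<^sup>2 \<ge> 0" using den_ge_1[of beta] by simp
      then show "den bh \<le> (2 * den beta + 2) * ?q" using dle by (simp add: algebra_simps)
    qed (simp add: e1_def)
    finally show "(f / den beta - kap) * den bh \<le> e1 * ((2 * den beta + 2) * ?q)" .
    show "e1 \<le> e1 * ?q" by (simp add: e1_def algebra_simps)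
    have "2 * norm \<delta> \<le> ?q" using sum_squares_bound[of "norm \<delta>" 1] by (simp add: power2_eq_square)
    then have "2 * norm \<delta> * e2 \<le> ?q * e2" by (rule mult_right_mono) (simp add: e2_def)
    then show "2 * (norm \<delta> * e2) \<le> e2 * ?q" by (simp add: algebra_simps)
    show "e3 * (norm \<delta>)\<^sup>2 \<le> e3 * ?q" by (simp add: e3_def mult_left_mono)
  qed
  also have "\<dots> = ((2 * den beta + 3) * e1 + e2 + e3) * ?q" by (simp add: algebra_simps)
  finally show ?thesis using \<alpha>[of \<delta>] unfolding e1_def e2_def e3_def by linarith
qed

end

section \<open>The estimator\<close>

definition Dmat :: "('p::finite \<Rightarrow> nat) \<Rightarrow> real^'p^'p" where
  "Dmat n = (\<chi> i j. if i = j then 1 / real (n i) else 0)"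

lemma Dmat_mult: "(Dmat n *v x) $ i = x $ i / real (n i)"
  by (simp add: Dmat_def matrix_vector_mult_def if_distrib[of "\<lambda>z. z * _"] cong: if_cong)

lemma inner_Dmat: "x \<bullet> (Dmat n *v y) = (\<Sum>i\<in>UNIV. x $ i * y $ i / real (n i))"
  by (simp add: inner_vec_def Dmat_mult)

lemma bDb_Dmat: "bDb n b = b \<bullet> (Dmat n *v b)"
  by (simp add: inner_Dmat bDb_def power2_eq_square)

lemma Dmat_sym: "transpose (Dmat n) = Dmat n"
  by (simp add: Dmat_def transpose_def vec_eq_iff)

lemma Dmat_psd: "x \<bullet> (Dmat n *v x) \<ge> 0"
  unfolding inner_Dmat by (intro sum_nonneg) auto

lemma Dmat_le: 
  assumes "\<And>i. n i \<ge> 1" shows "x \<bullet> (Dmat n *v x) \<le> (norm x)\<^sup>2"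
proof -
  have "x $ i * x $ i / real (n i) \<le> x $ i * x $ i" for i
    using assms[of i] by (simp add: divide_le_eq mult_le_cancel_left1)
  then have "x \<bullet> (Dmat n *v x) \<le> (\<Sum>i\<in>UNIV. x $ i * x $ i)" unfolding inner_Dmat by (rule sum_mono)
  also have "\<dots> = (norm x)\<^sup>2" by (simp add: power2_norm_eq_inner inner_vec_def)
  finally show ?thesis .
qed

text \<open>The Sherman-Morrison formula for a rank-one update of the diagonal matrix with entries
  \<open>n i\<close>, whose inverse is \<open>Dmat n\<close> because every \<open>n i\<close> is
  positive.\<close>

lemma matrix_inv_Dinv_bb:
  assumes n: "\<And>i. n i \<ge> 1"
  shows "matrix_inv (Dinv_bb n b) = (\<chi> i j. Dmat n $ i $ j - (b $ i / real (n i)) * (b $ j / real (n j)) / (1 + bDb n b))"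
    (is "_ = ?C")
proof (rule matrix_inv_eqI)
  let ?g = "1 + bDb n b"
  have g: "?g > 0" using Dmat_psd[of b n] by (simp add: bDb_Dmat)
  have nz: "real (n i) \<noteq> 0" for i using n[of i] by simp
  have sb: "(\<Sum>k\<in>UNIV. b $ k * (b $ k / real (n k))) = ?g - 1" by (simp add: bDb_def power2_eq_square)
  \<comment> \<open>Groups each product of entries so that a Kronecker delta stands in front and
    collapses the sum; the one sum without a delta is evaluated by \<open>sb\<close>.\<close>
  have ring: "(d * N + x * y) * (e * r - z * w / G) = d * (N * (e * r)) - d * (N * z * w / G) + e * (x * y * r) - x * w / G * (y * z)"
    for d N x y e r z w G :: real
    by (simp add: algebra_simps add_divide_distrib)
  have delta: "(\<Sum>k\<in>UNIV. (if i = k then 1 else 0) * F k) = F i" "(\<Sum>k\<in>UNIV. (if k = i then 1 else 0) * F k) = F i"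
    for F :: "'a \<Rightarrow> real" and i
    by (simp_all add: if_distrib[of "\<lambda>z. z * _"] cong: if_cong)
  have "(Dinv_bb n b ** ?C) $ i $ j = mat 1 $ i $ j" for i j
  proof -
    let ?d = "\<lambda>i j. if i = j then 1 else (0::real)"
    have "(Dinv_bb n b ** ?C) $ i $ j = (\<Sum>k\<in>UNIV. (?d i k * real (n i) + b $ i * b $ k) * 
        (?d k j * (1 / real (n k)) - (b $ k / real (n k)) * (b $ j / real (n j)) / ?g))"
      unfolding matrix_matrix_mult_def Dinv_bb_def Dmat_def vec_lambda_beta
      by (intro sum.cong refl arg_cong2[where f = "(*)"] arg_cong2[where f = "(+)"] arg_cong2[where f = "(-)"]) simp_all
    also have "\<dots> = (\<Sum>k\<in>UNIV. ?d i k * (real (n i) * (?d k j * (1 / real (n k)))))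
       - (\<Sum>k\<in>UNIV. ?d i k * (real (n i) * (b $ k / real (n k)) * (b $ j / real (n j)) / ?g))
       + (\<Sum>k\<in>UNIV. ?d k j * (b $ i * b $ k * (1 / real (n k)))) - (\<Sum>k\<in>UNIV. b $ i * (b $ j / real (n j)) / ?g * (b $ k * (b $ k / real (n k))))"
      unfolding sum.distrib[symmetric] sum_subtractf[symmetric]
      by (intro sum.cong refl ring)
    also have "(\<Sum>k\<in>UNIV. ?d i k * (real (n i) * (?d k j * (1 / real (n k))))) = ?d i j"
      unfolding delta using nz[of i] by simp
    also have "(\<Sum>k\<in>UNIV. ?d i k * (real (n i) * (b $ k / real (n k)) * (b $ j / real (n j)) / ?g)) = b $ i * (b $ j / real (n j)) / ?g"
      unfolding delta using nz[of i] by simp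
    also have "(\<Sum>k\<in>UNIV. ?d k j * (b $ i * b $ k * (1 / real (n k)))) = b $ i * (b $ j / real (n j))"
      unfolding delta by simp
    also have "(\<Sum>k\<in>UNIV. b $ i * (b $ j / real (n j)) / ?g * (b $ k * (b $ k / real (n k)))) = b $ i * (b $ j / real (n j)) / ?g * (?g - 1)"
      unfolding sum_distrib_left[symmetric] sb ..
    also have "?d i j - b $ i * (b $ j / real (n j)) / ?g + b $ i * (b $ j / real (n j)) - b $ i * (b $ j / real (n j)) / ?g * (?g - 1) = ?d i j"
    proof -
      have "x / G + x / G * (G - 1) = x" if "G > 0" for x G :: real using that by (simp add: field_simps)
      from this[OF g, of "b $ i * (b $ j / real (n j))"] show ?thesis by simp
    qed
    finally show ?thesis by (simp add: mat_def)
  qed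
  then show "Dinv_bb n b ** ?C = mat 1" by (simp only: vec_eq_iff) simp
qed

text \<open>For \<open>b = beta\<close> the weights \<open>weight n 1 (- b)\<close> produce \<open>r\<close>, and the weights
  \<open>weight n \<rho> (u - \<rho> *\<^sub>R b)\<close> produce \<open>\<Sum>i. u\<^sub>i etatil\<^sub>i\<close>.\<close>

lemma orthogonal_weight:
  assumes n: "\<And>i. n i \<ge> 1" and \<rho>: "\<rho> = u \<bullet> (Dmat n *v b) / (1 + bDb n b)"
  shows "wdot n (weight n 1 (- b)) (weight n 1 (- b)) = 1 + bDb n b"
    and "wdot n (weight n 1 (- b)) (weight n \<rho> (u - \<rho> *\<^sub>R b)) = 0"
    and "wdot n (weight n \<rho> (u - \<rho> *\<^sub>R b)) (weight n \<rho> (u - \<rho> *\<^sub>R b)) = u \<bullet> (matrix_inv (Dinv_bb n b) *v u)"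
proof -
  let ?g = "1 + bDb n b"
  have g: "?g > 0" using Dmat_psd[of b n] by (simp add: bDb_Dmat)
  have wd: "wdot n (weight n c0 c) (weight n d0 d) = c0 * d0 + c \<bullet> (Dmat n *v d)" for c0 c d0 d
    unfolding wdot_weight[OF n] inner_Dmat ..
  have sym: "b \<bullet> (Dmat n *v u) = u \<bullet> (Dmat n *v b)" using inner_matrix_sym[OF Dmat_sym, of b n u] by (simp add: inner_commute)
  \<comment> \<open>This identity is the reason for the choice of \<open>\<rho>\<close>: it makes
    the second mixture orthogonal to the residual.\<close>
  have \<rho>g: "\<rho> * ?g = u \<bullet> (Dmat n *v b)" using g by (simp add: \<rho>)
  have mneg: "Dmat n *v (- b) = - (Dmat n *v b)" by (simp add: vec_eq_iff Dmat_mult)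
  show "wdot n (weight n 1 (- b)) (weight n 1 (- b)) = ?g"
    unfolding wd by (simp add: bDb_Dmat mneg)
  show "wdot n (weight n 1 (- b)) (weight n \<rho> (u - \<rho> *\<^sub>R b)) = 0"
    unfolding wd using \<rho>g sym 
    by (simp add: matrix_vector_mult_diff_distrib matrix_vector_mult_scaleR inner_diff_right bDb_Dmat algebra_simps)
  have 1: "wdot n (weight n \<rho> (u - \<rho> *\<^sub>R b)) (weight n \<rho> (u - \<rho> *\<^sub>R b)) = \<rho> * (\<rho> * ?g) + u \<bullet> (Dmat n *v u) - 2 * \<rho> * (u \<bullet> (Dmat n *v b))"
    unfolding wd using sym 
    by (simp add: matrix_vector_mult_diff_distrib matrix_vector_mult_scaleR inner_diff_right inner_diff_left bDb_Dmat algebra_simps)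
  have 2: "u \<bullet> (matrix_inv (Dinv_bb n b) *v u) = u \<bullet> (Dmat n *v u) - (u \<bullet> (Dmat n *v b)) * (u \<bullet> (Dmat n *v b)) / ?g"
  proof -
    have "u \<bullet> (matrix_inv (Dinv_bb n b) *v u) = (\<Sum>i\<in>UNIV. \<Sum>j\<in>UNIV. u $ i * Dmat n $ i $ j * u $ j 
      - (u $ i * (b $ i / real (n i))) * (u $ j * (b $ j / real (n j))) / ?g)"
      unfolding matrix_inv_Dinv_bb[OF n] inner_matrix_eq_sum by (intro sum.cong refl) (simp add: algebra_simps)
    also have "\<dots> = u \<bullet> (Dmat n *v u) - (\<Sum>i\<in>UNIV. u $ i * (b $ i / real (n i))) * (\<Sum>j\<in>UNIV. u $ j * (b $ j / real (n j))) / ?g"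
      by (simp only: sum_subtractf inner_matrix_eq_sum sum_product sum_divide_distrib)
    finally show ?thesis by (simp add: inner_Dmat)
  qed
  show "wdot n (weight n \<rho> (u - \<rho> *\<^sub>R b)) (weight n \<rho> (u - \<rho> *\<^sub>R b)) = u \<bullet> (matrix_inv (Dinv_bb n b) *v u)"
    unfolding 1 2 \<rho>g by (simp add: \<rho>)
qed

lemma gram_inner:
  "x \<bullet> (gram N X A *v x) = bform N A (\<lambda>a. \<Sum>i\<in>UNIV. x $ i * X i a) (\<lambda>a. \<Sum>i\<in>UNIV. x $ i * X i a) / real N"
  unfolding inner_matrix_eq_sum bform_sum_left bform_sum_right bform_scale_left bform_scale_right
  by (simp add: gram_def sum_divide_distrib sum_distrib_left mult_ac)

text \<open>Centring at \<open>beta\<close> makes the residual affine in \<open>b - beta\<close>,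
  and dividing by \<open>N\<close> brings the criterion into the form of \<open>quotient_min\<close>
  with coefficients that have limits; the positive factor \<open>N\<close> does not affect
  minimisers.\<close>

lemma objective_expand:
  fixes beta b :: "real^'p::finite"
  assumes W: "sym_on N (minv N (sighat m Z lam \<omega>))" and N: "N > 0"
    and res: "\<And>a. a < N \<Longrightarrow> Y \<omega> a - (\<Sum>i\<in>UNIV. Xt \<omega> i a * b $ i) = r a - (\<Sum>i\<in>UNIV. (b - beta) $ i * xt i a)"
  shows "objective N m lam n Y Xt Z \<omega> b = real N * 
    ((bform N (minv N (sighat m Z lam \<omega>)) r r / real N 
      - 2 * ((b - beta) \<bullet> (\<chi> i. bform N (minv N (sighat m Z lam \<omega>)) (xt i) r / real N))
      + (b - beta) \<bullet> (gram N xt (minv N (sighat m Z lam \<omega>)) *v (b - beta))) / (1 + b \<bullet> (Dmat n *v b)))"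
proof -
  let ?W = "minv N (sighat m Z lam \<omega>)"
  let ?e = "\<lambda>a. \<Sum>i\<in>UNIV. (b - beta) $ i * xt i a"
  have "bform N ?W (\<lambda>a. Y \<omega> a - (\<Sum>i\<in>UNIV. Xt \<omega> i a * b $ i)) (\<lambda>a. Y \<omega> a - (\<Sum>i\<in>UNIV. Xt \<omega> i a * b $ i))
    = bform N ?W (\<lambda>a. r a - ?e a) (\<lambda>a. r a - ?e a)"
    by (rule bform_cong) (use res in auto)
  also have "\<dots> = bform N ?W r r - 2 * bform N ?W ?e r + bform N ?W ?e ?e"
    unfolding bform_diff_left bform_diff_right bform_sym_on[OF W, of r ?e] by simp
  also have "bform N ?W ?e r = real N * ((b - beta) \<bullet> (\<chi> i. bform N ?W (xt i) r / real N))"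
    unfolding bform_sum_left bform_scale_left using N by (simp add: inner_vec_def sum_distrib_left)
  also have "bform N ?W ?e ?e = real N * ((b - beta) \<bullet> (gram N xt ?W *v (b - beta)))"
    unfolding gram_inner using N by simp
  finally show ?thesis
    using N unfolding objective_def Let_def bDb_Dmat by (simp add: algebra_simps)
qed

text \<open>A vanishing factor times a tight sequence: the norm of \<open>Y\<close> exceeds
  \<open>L\<close> only on a small event, and off another small event the factor is below
  \<open>d / L\<close>.\<close>

lemma tight_mult_tendsto_0:
  fixes Y :: "nat \<Rightarrow> 'a \<Rightarrow> real^'p::finite" and G :: "'b \<Rightarrow> real^'p"
  assumes ps: "\<And>t. prob_space (M t)" "prob_space Q" and cd: "conv_distr M Y Q G" and G: "G \<in> borel_measurable Q"
    and \<eta>: "(\<eta> \<longlongrightarrow> (0::real)) (prob_filter M)"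
  shows "((\<lambda>x. \<eta> x * norm (Y (fst x) (snd x))) \<longlongrightarrow> 0) (prob_filter M)"
proof (rule tendstoI)
  fix d :: real assume d: "d > 0"
  note [measurable] = cd[unfolded conv_distr_def, THEN conjunct1, rule_format]
  have "eventually (\<lambda>x. \<bar>\<eta> x * norm (Y (fst x) (snd x))\<bar> < d) (prob_filter M)"
    unfolding eventually_prob_filter
  proof (intro allI impI)
    fix e :: real assume e: "e > 0"
    then obtain L where L: "L > 0" "\<forall>\<^sub>F t in sequentially. measure (M t) {\<omega>\<in>space (M t). \<not> norm (Y t \<omega>) \<le> L} < e/2"
      using conv_distr_tight[OF ps cd G, of "e/2"] by auto
    have "\<forall>\<^sub>F x in prob_filter M. dist (\<eta> x) 0 < d / L" using d L by (intro tendstoD[OF \<eta>]) simp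
    then have "\<forall>\<^sub>F t in sequentially. \<exists>B\<in>sets (M t). emeasure (M t) B \<le> ennreal (e/2) \<and> (\<forall>\<omega>\<in>space (M t) - B. dist (\<eta> (t, \<omega>)) 0 < d / L)"
      unfolding eventually_prob_filter using e by (elim allE[of _ "e/2"]) simp
    with L(2) show "\<forall>\<^sub>F t in sequentially. \<exists>B\<in>sets (M t). emeasure (M t) B \<le> ennreal e \<and>
        (\<forall>\<omega>\<in>space (M t) - B. \<bar>\<eta> (t, \<omega>) * norm (Y (fst (t, \<omega>)) (snd (t, \<omega>)))\<bar> < d)"
    proof eventually_elim
      case (elim t)
      interpret prob_space "M t" by (rule ps)
      define C where "C = {\<omega>\<in>space (M t). \<not> norm (Y t \<omega>) \<le> L}"
      have C: "C \<in> sets (M t)" unfolding C_def by measurable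
      have Ce: "emeasure (M t) C \<le> ennreal (e/2)" using elim(1) by (simp add: C_def emeasure_eq_measure ennreal_leI)
      obtain B where B: "B\<in>sets (M t)" "emeasure (M t) B \<le> ennreal (e/2)" "\<And>\<omega>. \<omega>\<in>space (M t) - B \<Longrightarrow> dist (\<eta> (t, \<omega>)) 0 < d / L"
        using elim(2) by blast
      have "emeasure (M t) (B \<union> C) \<le> emeasure (M t) B + emeasure (M t) C"
        by (rule emeasure_subadditive) (use B C in auto)
      also have "\<dots> \<le> ennreal (e/2) + ennreal (e/2)" by (intro add_mono B Ce)
      also have "\<dots> = ennreal e" using e by (subst ennreal_plus[symmetric]) auto
      finally have BC: "emeasure (M t) (B \<union> C) \<le> ennreal e" .
      have "\<bar>\<eta> (t, \<omega>) * norm (Y t \<omega>)\<bar> < d" if w: "\<omega> \<in> space (M t) - (B \<union> C)" for \<omega>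
      proof -
        have "norm (Y t \<omega>) \<le> L" using w by (auto simp: C_def)
        then have "\<bar>\<eta> (t, \<omega>)\<bar> * norm (Y t \<omega>) \<le> \<bar>\<eta> (t, \<omega>)\<bar> * L" by (intro mult_left_mono) auto
        also have "\<bar>\<eta> (t, \<omega>)\<bar> < d / L" using B(3)[of \<omega>] w by simp
        then have "\<bar>\<eta> (t, \<omega>)\<bar> * L < d" using L(1) by (simp add: pos_less_divide_eq)
        finally show ?thesis by (simp add: abs_mult)
      qed
      then show ?case using BC B(1) C by (intro bexI[of _ "B \<union> C"]) auto
    qed
  qed
  then show "\<forall>\<^sub>F x in prob_filter M. dist (\<eta> x * norm (Y (fst x) (snd x))) 0 < d" by simp
qed

text \<open>Consistency comes before linearisation: the error term contains the norm of
  \<open>bh - beta\<close> and the minimal value \<open>J\<close>, whose limits are available once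
  \<open>bh\<close> is known to approach \<open>beta\<close>. The filter is arbitrary because the
  estimates are deterministic for each \<open>x\<close>.\<close>

lemma minimizer_linearisation:
  fixes A :: "'x \<Rightarrow> real^'p::finite^'p" and s bh :: "'x \<Rightarrow> real^'p" and f :: "'x \<Rightarrow> real"
  assumes sym: "transpose \<Delta> = \<Delta>" and psd: "\<And>x. x \<bullet> (\<Delta> *v x) \<ge> 0" and inv: "invertible \<Delta>"
    and D: "transpose D = D" "\<And>v. v \<bullet> (D *v v) \<ge> 0" "\<And>v. v \<bullet> (D *v v) \<le> (norm v)\<^sup>2"
    and g: "g = 1 + beta \<bullet> (D *v beta)"
    and lA: "(A \<longlongrightarrow> \<Delta> + kap *\<^sub>R D) F" and ls: "(s \<longlongrightarrow> - (kap *\<^sub>R (D *v beta))) F" and lf: "(f \<longlongrightarrow> kap * g) F"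
    and qm: "\<forall>\<^sub>F x in F. quotient_min (A x) D (s x) beta (bh x) (f x)"
  obtains \<eta> where "(\<eta> \<longlongrightarrow> (0::real)) F" 
    and "\<forall>\<^sub>F x in F. norm (bh x - beta - matrix_inv \<Delta> *v (s x + (f x / g) *\<^sub>R (D *v beta)))
      \<le> \<eta> x * norm (matrix_inv \<Delta> *v (s x + (f x / g) *\<^sub>R (D *v beta)))"
proof -
  obtain \<alpha> where \<alpha>: "\<alpha> > 0" "\<And>x. \<alpha> * (norm x)\<^sup>2 \<le> x \<bullet> (\<Delta> *v x)"
    using psd_invertible_coercive[OF sym psd inv] by blast
  have g1: "g \<ge> 1" using D(2)[of beta] by (simp add: g)
  define \<delta> where "\<delta> x = bh x - beta" for x
  define \<rho> where "\<rho> x = (2 * g + 3) * \<bar>f x - kap * g\<bar> + norm (s x + kap *\<^sub>R (D *v beta)) + norm (A x - (\<Delta> + kap *\<^sub>R D))" for x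
  have "(\<rho> \<longlongrightarrow> (2 * g + 3) * \<bar>kap * g - kap * g\<bar> + norm (- (kap *\<^sub>R (D *v beta)) + kap *\<^sub>R (D *v beta)) + norm (\<Delta> + kap *\<^sub>R D - (\<Delta> + kap *\<^sub>R D))) F"
    unfolding \<rho>_def by (intro tendsto_intros lA ls lf)
  then have \<rho>: "(\<rho> \<longlongrightarrow> 0) F" by simp
  have b1: "\<forall>\<^sub>F x in F. \<alpha> * (norm (\<delta> x))\<^sup>2 \<le> \<rho> x * (1 + (norm (\<delta> x))\<^sup>2)"
    using qm
  proof eventually_elim
    case (elim x)
    interpret Q: quotient_min "A x" D "s x" beta "bh x" "f x" by fact
    show ?case
      using Q.consistency_bound[OF \<alpha>(2) D(3), of kap] unfolding Q.den_def g[symmetric] Q.\<delta>_def \<delta>_def \<rho>_def .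
  qed
  have "\<forall>\<^sub>F x in F. \<rho> x < \<alpha> / 2" by (rule order_tendstoD(2)[OF \<rho>]) (use \<alpha> in simp)
  \<comment> \<open>When \<open>\<rho> x < \<alpha> / 2\<close>, the term with the squared norm on
    the right is absorbed by the left.\<close>
  with b1 have b2: "\<forall>\<^sub>F x in F. (norm (\<delta> x))\<^sup>2 \<le> 2 / \<alpha> * \<rho> x"
  proof eventually_elim
    case (elim x)
    have "\<rho> x * (norm (\<delta> x))\<^sup>2 \<le> \<alpha> / 2 * (norm (\<delta> x))\<^sup>2" using elim(2) by (intro mult_right_mono) auto
    with elim(1) have "\<alpha> / 2 * (norm (\<delta> x))\<^sup>2 \<le> \<rho> x" by (simp add: algebra_simps)
    then show ?case using \<alpha>(1) by (simp add: field_simps)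
  qed
  have "((\<lambda>x. (norm (\<delta> x))\<^sup>2) \<longlongrightarrow> 0) F"
  proof (rule tendsto_sandwich[of "\<lambda>_. 0" _ _ "\<lambda>x. 2 / \<alpha> * \<rho> x"])
    show "((\<lambda>x. 2 / \<alpha> * \<rho> x) \<longlongrightarrow> 0) F" by (rule tendsto_mult_right_zero[OF \<rho>])
  qed (use b2 in auto)
  from tendsto_real_sqrt[OF this] have nd: "((\<lambda>x. norm (\<delta> x)) \<longlongrightarrow> 0) F" by simp
  then have d0: "(\<delta> \<longlongrightarrow> 0) F" by (rule tendsto_norm_zero_cancel)
  \<comment> \<open>Another name for \<open>bh\<close>, written as \<open>beta + \<delta> x\<close>
    so that its limit is immediate.\<close>
  define bb where "bb x = beta + \<delta> x" for x
  have bb: "(bb \<longlongrightarrow> beta) F" unfolding bb_def using tendsto_add[OF tendsto_const d0, of beta] by simp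
  define J where "J x = (f x - 2 * (\<delta> x \<bullet> s x) + \<delta> x \<bullet> (A x *v \<delta> x)) / (1 + bb x \<bullet> (D *v bb x))" for x
  have lJ: "(J \<longlongrightarrow> kap) F"
  proof -
    have "(J \<longlongrightarrow> (kap * g - 2 * (0 \<bullet> (- (kap *\<^sub>R (D *v beta)))) + 0 \<bullet> ((\<Delta> + kap *\<^sub>R D) *v 0)) / (1 + beta \<bullet> (D *v beta))) F"
      unfolding J_def
      by (intro tendsto_divide tendsto_add tendsto_diff tendsto_mult tendsto_inner tendsto_matrix_vector_mult tendsto_const d0 ls lf lA bb)
        (use g1 g in simp)
    then show ?thesis using g1 unfolding g[symmetric] by simp
  qed
  define err where "err x = norm (\<Delta> - A x + J x *\<^sub>R D) + (2 * norm (\<delta> x) + norm (\<delta> x) * (norm (A x) + \<bar>f x / g\<bar> * norm D)) * norm (D *v beta)" for x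
  have "(err \<longlongrightarrow> norm (\<Delta> - (\<Delta> + kap *\<^sub>R D) + kap *\<^sub>R D) + (2 * 0 + 0 * (norm (\<Delta> + kap *\<^sub>R D) + \<bar>kap * g / g\<bar> * norm D)) * norm (D *v beta)) F"
    unfolding err_def by (intro tendsto_intros lA lJ nd lf) (use g1 in simp)
  then have lerr: "(err \<longlongrightarrow> 0) F" by simp
  define \<eta> where "\<eta> x = 2 * norm (matrix_inv \<Delta>) * err x * (1 + norm \<Delta>)" for x
  have "(\<eta> \<longlongrightarrow> 2 * norm (matrix_inv \<Delta>) * 0 * (1 + norm \<Delta>)) F" unfolding \<eta>_def by (intro tendsto_intros lerr)
  then have l\<eta>: "(\<eta> \<longlongrightarrow> 0) F" by simp
  have "((\<lambda>x. norm (matrix_inv \<Delta>) * err x) \<longlongrightarrow> 0) F" by (rule tendsto_mult_right_zero[OF lerr])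
  then have "\<forall>\<^sub>F x in F. norm (matrix_inv \<Delta>) * err x < 1/2" by (rule order_tendstoD(2)) simp
  with qm have "\<forall>\<^sub>F x in F. norm (bh x - beta - matrix_inv \<Delta> *v (s x + (f x / g) *\<^sub>R (D *v beta)))
      \<le> \<eta> x * norm (matrix_inv \<Delta> *v (s x + (f x / g) *\<^sub>R (D *v beta)))"
  proof eventually_elim
    case (elim x)
    interpret Q: quotient_min "A x" D "s x" beta "bh x" "f x" by fact
    have d: "Q.\<delta> = \<delta> x" by (simp add: Q.\<delta>_def \<delta>_def)
    have j0: "Q.J0 = f x / g" by (simp add: Q.J0_def Q.den_def g)
    have j: "Q.J = J x" by (simp add: Q.J_def Q.num_def Q.den_def J_def bb_def \<delta>_def)
    have e: "Q.err \<Delta> = err x" by (simp add: Q.err_def err_def d j0 j)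
    have s0: "Q.S0 = s x + (f x / g) *\<^sub>R (D *v beta)" by (simp add: Q.S0_def j0)
    show ?case
      using Q.solved_bound[OF inv] elim(2) unfolding e s0 d by (simp add: \<eta>_def \<delta>_def)
  qed
  with l\<eta> show ?thesis by (rule that)
qed

section \<open>Asymptotic normality of the estimator\<close>

theorem theorem1:
  fixes n :: "'p::finite \<Rightarrow> nat"
    and beta :: "real^'p"
    and NN mm :: "nat \<Rightarrow> nat"
    and c :: real
    and X :: "nat \<Rightarrow> 'p \<Rightarrow> nat \<Rightarrow> real"
    and Sig :: "nat \<Rightarrow> nat \<Rightarrow> nat \<Rightarrow> real"
    and M :: "nat \<Rightarrow> 'a measure"
    and eps :: "nat \<Rightarrow> 'a \<Rightarrow> nat \<Rightarrow> real"
    and eta :: "nat \<Rightarrow> 'p \<Rightarrow> nat \<Rightarrow> 'a \<Rightarrow> nat \<Rightarrow> real"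
    and Z :: "nat \<Rightarrow> nat \<Rightarrow> 'a \<Rightarrow> nat \<Rightarrow> real"
    and Delta1 Delta2 :: "real \<Rightarrow> real^'p^'p"
    and K :: "real \<Rightarrow> real"
    and lam :: real
    and bhat :: "nat \<Rightarrow> 'a \<Rightarrow> real^'p"
  assumes n_pos: "\<forall>i. n i \<ge> 1"
    and N_lim: "filterlim NN at_top sequentially"
    and m_lim: "filterlim mm at_top sequentially"
    and c_pos: "0 < c"
    and ratio: "(\<lambda>t. real (NN t) / real (mm t)) \<longlonglongrightarrow> c"
    and Sig_pd: "\<forall>t. sym_pd (NN t) (Sig t)"
    and prob: "\<forall>t. prob_space (M t)"
    and indep: "\<forall>t. prob_space.indep_vars (M t) (\<lambda>_. Pi\<^sub>M {..<NN t} (\<lambda>_. borel))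
                    (\<lambda>l \<omega>. restrict (noise (eps t) (eta t) (Z t) l \<omega>) {..<NN t})
                    (labels n (mm t))"
    and gauss: "\<forall>t. \<forall>l\<in>labels n (mm t). gauss_vec (M t) (NN t) (Sig t) (noise (eps t) (eta t) (Z t) l)"
    and A1: "\<exists>al au. 0 < al \<and> al < au
               \<and> ereal al < Liminf sequentially (\<lambda>t. ereal (lmin (NN t) (Sig t)))
               \<and> Limsup sequentially (\<lambda>t. ereal (lmax (NN t) (Sig t))) < ereal au"
    and A2: "\<exists>L. (\<lambda>t. gram (NN t) (X t) idm) \<longlonglongrightarrow> L \<and> pd_p L"
    and A3: "\<forall>l>0. conv_prob M (\<lambda>t \<omega>. gram (NN t) (X t) (minv (NN t) (sighat (mm t) (Z t) l \<omega>))) (Delta1 l)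
                  \<and> invertible (Delta1 l)"
    and A4: "\<forall>l>0. conv_prob M (\<lambda>t \<omega>. let Si = minv (NN t) (sighat (mm t) (Z t) l \<omega>) in
                      gram (NN t) (X t) (mmul (NN t) (mmul (NN t) Si (Sig t)) Si)) (Delta2 l)
                  \<and> invertible (Delta2 l)"
    and A5: "\<forall>l>0. \<exists>kap>0. conv_prob M (\<lambda>t \<omega>.
                      mtrace (NN t) (mmul (NN t) (minv (NN t) (sighat (mm t) (Z t) l \<omega>)) (Sig t)) / real (NN t)) kap"
    and A6: "\<forall>l>0. conv_prob M (\<lambda>t \<omega>. let Si = minv (NN t) (sighat (mm t) (Z t) l \<omega>) in
                      mtrace (NN t) (mmul (NN t) (mmul (NN t) (mmul (NN t) Si (Sig t)) Si) (Sig t)) / real (NN t)) (K l)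
                  \<and> K l > 0"
    and lam_pos: "0 < lam"
    and bhat_meas: "\<forall>t. bhat t \<in> borel_measurable (M t)"
    and bhat_min: "eventually (\<lambda>t. AE \<omega> in M t. \<forall>b.
                      objective (NN t) (mm t) lam n (resp (X t) beta (eps t)) (xtil (X t) n (eta t)) (Z t) \<omega> (bhat t \<omega>)
                      \<le> objective (NN t) (mm t) lam n (resp (X t) beta (eps t)) (xtil (X t) n (eta t)) (Z t) \<omega> b)
                   sequentially"
  shows "\<exists>(Q :: (real^'p) measure) G.
           gauss_p Q G ((1 + bDb n beta) *\<^sub>R
              (matrix_inv (Delta1 lam) ** (Delta2 lam + K lam *\<^sub>R matrix_inv (Dinv_bb n beta)) ** matrix_inv (Delta1 lam)))
         \<and> conv_distr M (\<lambda>t \<omega>. sqrt (real (NN t)) *\<^sub>R (bhat t \<omega> - beta)) Q G"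
proof -
  interpret M: prob_space "M t" for t using prob by blast
  have n1: "n i \<ge> 1" for i using n_pos by blast
  define nz where "nz t = noise (eps t) (eta t) (Z t)" for t
  have nm: "noise_model (M t) (NN t) (mm t) n (Sig t) (nz t) lam" for t
    unfolding noise_model_def noise_model_axioms_def nz_def
    using prob Sig_pd indep gauss lam_pos by (auto intro: prob_space.gauss_vec_imp_gauss_lin)
  interpret T: noise_model "M t" "NN t" "mm t" n "Sig t" "nz t" lam for t by (rule nm)
  have nz_simps: "nz t Eps \<omega> = eps t \<omega>" "nz t (Eta i k) \<omega> = eta t i k \<omega>" "nz t (Zl j) \<omega> = Z t j \<omega>" for t \<omega> i j k
    by (simp_all add: nz_def noise_def)
  define W where "W t \<omega> = minv (NN t) (sighat (mm t) (Z t) lam \<omega>)" for t \<omega>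
  \<comment> \<open>The two matrices are inverses of matrices with the same entries below
    \<open>N\<close>, and \<open>minv\<close> sees nothing else.\<close>
  have W: "T.Wm t \<omega> = W t \<omega>" for t \<omega>
    unfolding T.Wm_def zinv_def W_def
    by (rule minv_cong) (auto simp: zcov_def sighat_def scov_def T.zb_def nz_simps z_labels_def intro!: sum.cong)
  have sand: "T.zsand t (T.zb t \<omega>) = mmul (NN t) (mmul (NN t) (W t \<omega>) (Sig t)) (W t \<omega>)" for t \<omega>
    unfolding T.zsand_def W[symmetric] T.Wm_def ..
  have Wsym: "sym_on (NN t) (W t \<omega>)" and Wpsd: "bform (NN t) (W t \<omega>) x x \<ge> 0" for t \<omega> x
    unfolding W[symmetric] T.Wm_def by (rule T.sym_pd_zinv)+
  have Wm: "(\<lambda>\<omega>. W t \<omega> a b) \<in> borel_measurable (M t)" for t a b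
    unfolding W[symmetric] by (rule T.Wm_measurable)
  let ?F = "prob_filter M"
  have Fbot: "?F \<noteq> bot" by (rule prob_filter_neq_bot) (use prob in blast)

  have l3: "((\<lambda>x. gram (NN (fst x)) (X (fst x)) (W (fst x) (snd x))) \<longlongrightarrow> Delta1 lam) ?F"
  proof (rule tendsto_prob_filterI)
    show "conv_prob M (\<lambda>t \<omega>. gram (NN t) (X t) (W t \<omega>)) (Delta1 lam)" using A3 lam_pos unfolding W_def by blast
    show "(\<lambda>\<omega>. gram (NN t) (X t) (W t \<omega>)) \<in> borel_measurable (M t)" for t
      unfolding gram_def
      by (intro vec_measurableI) (auto intro!: bform_measurable borel_measurable_divide Wm)
  qed (use prob in blast)
  have l4: "((\<lambda>x. gram (NN (fst x)) (X (fst x)) (T.zsand (fst x) (T.zb (fst x) (snd x)))) \<longlongrightarrow> Delta2 lam) ?F"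
    unfolding sand
  proof (rule tendsto_prob_filterI)
    show "conv_prob M (\<lambda>t \<omega>. gram (NN t) (X t) (mmul (NN t) (mmul (NN t) (W t \<omega>) (Sig t)) (W t \<omega>))) (Delta2 lam)"
      using A4 lam_pos unfolding W_def Let_def by blast
    show "(\<lambda>\<omega>. gram (NN t) (X t) (mmul (NN t) (mmul (NN t) (W t \<omega>) (Sig t)) (W t \<omega>))) \<in> borel_measurable (M t)" for t
      unfolding gram_def
      by (intro vec_measurableI) (auto intro!: bform_measurable borel_measurable_divide mmul_measurable Wm)
  qed (use prob in blast)
  obtain kap where "conv_prob M (\<lambda>t \<omega>. mtrace (NN t) (mmul (NN t) (W t \<omega>) (Sig t)) / real (NN t)) kap"
    using A5 lam_pos unfolding W_def by blast
  then have l5: "((\<lambda>x. mtrace (NN (fst x)) (mmul (NN (fst x)) (W (fst x) (snd x)) (Sig (fst x))) / real (NN (fst x))) \<longlongrightarrow> kap) ?F"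
    by (rule tendsto_prob_filterI) (use prob in \<open>auto intro!: mtrace_measurable mmul_measurable borel_measurable_divide Wm\<close>)
  have l6: "((\<lambda>x. mtrace (NN (fst x)) (mmul (NN (fst x)) (T.zsand (fst x) (T.zb (fst x) (snd x))) (Sig (fst x))) / real (NN (fst x))) \<longlongrightarrow> K lam) ?F"
    unfolding sand
  proof (rule tendsto_prob_filterI)
    show "conv_prob M (\<lambda>t \<omega>. mtrace (NN t) (mmul (NN t) (mmul (NN t) (mmul (NN t) (W t \<omega>) (Sig t)) (W t \<omega>)) (Sig t)) / real (NN t)) (K lam)"
      using A6 lam_pos unfolding W_def Let_def by blast
  qed (use prob in \<open>auto intro!: mtrace_measurable mmul_measurable borel_measurable_divide Wm\<close>)
  have K_pos: "K lam > 0" using A6 lam_pos by blast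
  have inv1: "invertible (Delta1 lam)" using A3 lam_pos by blast

  obtain au where au: "au > 0" "Limsup sequentially (\<lambda>t. ereal (lmax (NN t) (Sig t))) < ereal au"
    using A1 by (meson order_less_trans)
  \<comment> \<open>The bound on the eigenvalues becomes a bound on the quadratic form through the
    Rayleigh quotient.\<close>
  have Sb: "\<forall>\<^sub>F t in sequentially. \<forall>c. bform (NN t) (Sig t) c c \<le> au * dot (NN t) c c"
    using Limsup_lessD[OF au(2)]
  proof eventually_elim
    case (elim t)
    show ?case
    proof
      fix c
      have "bform (NN t) (Sig t) c c \<le> lmax (NN t) (Sig t) * dot (NN t) c c" by (rule bform_le_lmax[OF T.Sig_sym])
      also have "\<dots> \<le> au * dot (NN t) c c" using elim by (intro mult_right_mono dot_self_nonneg) simp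
      finally show "bform (NN t) (Sig t) c c \<le> au * dot (NN t) c c" .
    qed
  qed
  interpret NS: noise_seq M NN mm n Sig nz lam au kap "K lam"
    by unfold_locales (use nm N_lim Sb au(1) l5 l6 in \<open>auto simp: W\<close>)

  define D where "D = Dmat n"
  define g where "g = 1 + bDb n beta"
  have gD: "g = 1 + beta \<bullet> (D *v beta)" by (simp add: g_def D_def bDb_Dmat)
  have g_pos: "g > 0" using Dmat_psd[of beta n] by (simp add: gD D_def)
  \<comment> \<open>\<open>h\<close> is the averaged noise of one regressor, picked out by a unit
    weight; \<open>xt\<close> below is thus the observed regressor.\<close>
  define h where "h t i = T.mx t (weight n 0 (axis i 1))" for t and i :: 'p
  define r where "r t = T.mx t (weight n 1 (- beta))" for t
  define xt where "xt t \<omega> i a = X t i a + h t i \<omega> a" for t \<omega> and i :: 'p and a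
  define A where "A t \<omega> = gram (NN t) (xt t \<omega>) (W t \<omega>)" for t \<omega>
  define s where "s t \<omega> = (\<chi> i. bform (NN t) (W t \<omega>) (xt t \<omega> i) (r t \<omega>) / real (NN t))" for t \<omega>
  define f where "f t \<omega> = bform (NN t) (W t \<omega>) (r t \<omega>) (r t \<omega>) / real (NN t)" for t \<omega>

  have Xlin: "((\<lambda>x. bform (NN (fst x)) (W (fst x) (snd x)) (X (fst x) i) (T.mx (fst x) w (snd x)) / real (NN (fst x))) \<longlongrightarrow> 0) ?F" for i w
  proof -
    have "((\<lambda>x. bform (NN (fst x)) (T.zsand (fst x) (T.zb (fst x) (snd x))) (X (fst x) i) (X (fst x) i) / real (NN (fst x))) \<longlongrightarrow> Delta2 lam $ i $ i) ?F"
      using tendsto_vec_nth[OF tendsto_vec_nth[OF l4, of i], of i] by (simp add: gram_def)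
    from NS.noise_linear_limit[where p = "\<lambda>t. X t i", OF this] show ?thesis unfolding W .
  qed
  have bil: "((\<lambda>x. bform (NN (fst x)) (W (fst x) (snd x)) (T.mx (fst x) w (snd x)) (T.mx (fst x) w' (snd x)) / real (NN (fst x))) \<longlongrightarrow> wdot n w w' * kap) ?F" for w w'
    using NS.noise_bilinear_limit[of w w'] unfolding W .
  have Xlin': "((\<lambda>x. bform (NN (fst x)) (W (fst x) (snd x)) (T.mx (fst x) w (snd x)) (X (fst x) i) / real (NN (fst x))) \<longlongrightarrow> 0) ?F" for i w
    using Xlin[of i w] by (simp add: bform_sym_on[OF Wsym, of _ _ "T.mx _ w _" "X _ i"])
  have wdi: "wdot n (weight n 0 (axis i 1)) (weight n c0 c) = c $ i / real (n i)" for i :: 'p and c0 c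
  proof -
    have "axis i 1 $ j * c $ j / real (n j) = (if j = i then c $ j / real (n j) else 0)" for j by (simp add: axis_def)
    then show ?thesis unfolding wdot_weight[OF n1] by simp
  qed
  \<comment> \<open>The cross terms between \<open>X\<close> and the noise vanish; the noise against
    itself leaves \<open>kap D\<close>, the effect of measurement error on the Gram matrix.\<close>
  have lA: "((\<lambda>x. A (fst x) (snd x)) \<longlongrightarrow> Delta1 lam + kap *\<^sub>R D) ?F"
  proof (rule tendsto_matrixI)
    fix i j
    have "((\<lambda>x. gram (NN (fst x)) (X (fst x)) (W (fst x) (snd x)) $ i $ j
       + bform (NN (fst x)) (W (fst x) (snd x)) (X (fst x) i) (h (fst x) j (snd x)) / real (NN (fst x))
       + bform (NN (fst x)) (W (fst x) (snd x)) (h (fst x) i (snd x)) (X (fst x) j) / real (NN (fst x))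
       + bform (NN (fst x)) (W (fst x) (snd x)) (h (fst x) i (snd x)) (h (fst x) j (snd x)) / real (NN (fst x)))
      \<longlongrightarrow> Delta1 lam $ i $ j + 0 + 0 + wdot n (weight n 0 (axis i 1)) (weight n 0 (axis j 1)) * kap) ?F"
      unfolding h_def by (intro tendsto_add tendsto_vec_nth l3 Xlin Xlin' bil)
    also have "(\<lambda>x. gram (NN (fst x)) (X (fst x)) (W (fst x) (snd x)) $ i $ j
       + bform (NN (fst x)) (W (fst x) (snd x)) (X (fst x) i) (h (fst x) j (snd x)) / real (NN (fst x))
       + bform (NN (fst x)) (W (fst x) (snd x)) (h (fst x) i (snd x)) (X (fst x) j) / real (NN (fst x))
       + bform (NN (fst x)) (W (fst x) (snd x)) (h (fst x) i (snd x)) (h (fst x) j (snd x)) / real (NN (fst x)))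
      = (\<lambda>x. A (fst x) (snd x) $ i $ j)"
      unfolding A_def gram_def xt_def by (simp add: bform_add_left bform_add_right add_divide_distrib add.assoc)
    also have "Delta1 lam $ i $ j + 0 + 0 + wdot n (weight n 0 (axis i 1)) (weight n 0 (axis j 1)) * kap = (Delta1 lam + kap *\<^sub>R D) $ i $ j"
      unfolding wdi by (auto simp: D_def Dmat_def axis_def)
    finally show "((\<lambda>x. A (fst x) (snd x) $ i $ j) \<longlongrightarrow> (Delta1 lam + kap *\<^sub>R D) $ i $ j) ?F" .
  qed
  \<comment> \<open>The limit is in general not 0: the residual contains the regressor noise with
    weight \<open>- beta\<close>, which is correlated with the observed regressors.\<close>
  have ls: "((\<lambda>x. s (fst x) (snd x)) \<longlongrightarrow> - (kap *\<^sub>R (D *v beta))) ?F"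
  proof (rule vec_tendstoI)
    fix i
    have "((\<lambda>x. bform (NN (fst x)) (W (fst x) (snd x)) (X (fst x) i) (r (fst x) (snd x)) / real (NN (fst x))
       + bform (NN (fst x)) (W (fst x) (snd x)) (h (fst x) i (snd x)) (r (fst x) (snd x)) / real (NN (fst x)))
      \<longlongrightarrow> 0 + wdot n (weight n 0 (axis i 1)) (weight n 1 (- beta)) * kap) ?F"
      unfolding h_def r_def by (intro tendsto_add Xlin bil)
    then show "((\<lambda>x. s (fst x) (snd x) $ i) \<longlongrightarrow> (- (kap *\<^sub>R (D *v beta))) $ i) ?F"
      unfolding s_def xt_def wdi by (simp add: bform_add_left add_divide_distrib D_def Dmat_mult mult.commute)
  qed
  have wrr: "wdot n (weight n 1 (- beta)) (weight n 1 (- beta)) = g"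
    unfolding g_def by (rule orthogonal_weight(1)[OF n1 refl])
  have lf: "((\<lambda>x. f (fst x) (snd x)) \<longlongrightarrow> kap * g) ?F"
    using bil[of "weight n 1 (- beta)" "weight n 1 (- beta)"] unfolding wrr f_def r_def by (simp add: mult.commute)

  \<comment> \<open>Inherited from the random Gram matrices, because limits along the nontrivial
    filter are unique.\<close>
  have Delta1_sym: "transpose (Delta1 lam) = Delta1 lam"
  proof -
    have "Delta1 lam $ j $ i = Delta1 lam $ i $ j" for i j
    proof (rule tendsto_unique[OF Fbot])
      show "((\<lambda>x. gram (NN (fst x)) (X (fst x)) (W (fst x) (snd x)) $ i $ j) \<longlongrightarrow> Delta1 lam $ i $ j) ?F"
        by (intro tendsto_vec_nth l3)
      have "gram (NN t) (X t) (W t \<omega>) $ i $ j = gram (NN t) (X t) (W t \<omega>) $ j $ i" for t \<omega>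
        by (simp add: gram_def bform_sym_on[OF Wsym, of _ _ "X t i"])
      then show "((\<lambda>x. gram (NN (fst x)) (X (fst x)) (W (fst x) (snd x)) $ i $ j) \<longlongrightarrow> Delta1 lam $ j $ i) ?F"
        using tendsto_vec_nth[OF tendsto_vec_nth[OF l3, of j], of i] by simp
    qed
    then show ?thesis by (simp add: transpose_def vec_eq_iff)
  qed
  have Delta2_sym: "transpose (Delta2 lam) = Delta2 lam"
  proof -
    have "Delta2 lam $ j $ i = Delta2 lam $ i $ j" for i j
    proof (rule tendsto_unique[OF Fbot])
      show "((\<lambda>x. gram (NN (fst x)) (X (fst x)) (T.zsand (fst x) (T.zb (fst x) (snd x))) $ i $ j) \<longlongrightarrow> Delta2 lam $ i $ j) ?F"
        by (intro tendsto_vec_nth l4)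
      have "gram (NN t) (X t) (T.zsand t z) $ i $ j = gram (NN t) (X t) (T.zsand t z) $ j $ i" for t z
        by (simp add: gram_def bform_sym_on[OF T.zsand_sym, of _ _ "X t i"])
      then show "((\<lambda>x. gram (NN (fst x)) (X (fst x)) (T.zsand (fst x) (T.zb (fst x) (snd x))) $ i $ j) \<longlongrightarrow> Delta2 lam $ j $ i) ?F"
        using tendsto_vec_nth[OF tendsto_vec_nth[OF l4, of j], of i] by simp
    qed
    then show ?thesis by (simp add: transpose_def vec_eq_iff)
  qed
  have Delta1_psd: "x \<bullet> (Delta1 lam *v x) \<ge> 0" for x
  proof (rule tendsto_lowerbound[OF _ _ Fbot])
    show "((\<lambda>y. x \<bullet> (gram (NN (fst y)) (X (fst y)) (W (fst y) (snd y)) *v x)) \<longlongrightarrow> x \<bullet> (Delta1 lam *v x)) ?F"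
      by (intro tendsto_inner tendsto_matrix_vector_mult l3 tendsto_const)
    show "\<forall>\<^sub>F y in ?F. 0 \<le> x \<bullet> (gram (NN (fst y)) (X (fst y)) (W (fst y) (snd y)) *v x)"
      unfolding gram_inner by (intro always_eventually allI divide_nonneg_nonneg Wpsd) simp
  qed
  have l4u: "((\<lambda>x. bform (NN (fst x)) (T.zsand (fst x) (T.zb (fst x) (snd x))) (\<lambda>a. \<Sum>i\<in>UNIV. u $ i * X (fst x) i a) (\<lambda>a. \<Sum>i\<in>UNIV. u $ i * X (fst x) i a) / real (NN (fst x))) \<longlongrightarrow> u \<bullet> (Delta2 lam *v u)) ?F" for u
    unfolding gram_inner[symmetric] by (intro tendsto_inner tendsto_matrix_vector_mult l4 tendsto_const)
  have Delta2_psd: "x \<bullet> (Delta2 lam *v x) \<ge> 0" for x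
    by (rule tendsto_lowerbound[OF l4u[of x] _ Fbot]) (intro always_eventually allI divide_nonneg_nonneg T.zsand_nonneg, simp)

  have qm: "\<forall>\<^sub>F x in ?F. quotient_min (A (fst x) (snd x)) D (s (fst x) (snd x)) beta (bhat (fst x) (snd x)) (f (fst x) (snd x))"
  proof -
    have "\<forall>\<^sub>F t in sequentially. 0 < NN t" using N_lim by (rule eventually_compose_filterlim[OF eventually_gt_at_top])
    with bhat_min have "\<forall>\<^sub>F t in sequentially. AE \<omega> in M t. quotient_min (A t \<omega>) D (s t \<omega>) beta (bhat t \<omega>) (f t \<omega>)"
    proof eventually_elim
      case (elim t)
      have N: "NN t > 0" by (fact elim(2))
      from elim(1) show ?case
      proof eventually_elim
        case (elim \<omega>)
        have res: "resp (X t) beta (eps t) \<omega> a - (\<Sum>i\<in>UNIV. xtil (X t) n (eta t) \<omega> i a * b $ i) = r t \<omega> a - (\<Sum>i\<in>UNIV. (b - beta) $ i * xt t \<omega> i a)"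
          if a: "a < NN t" for a b
        proof -
          have y: "T.yb t \<omega> Eps a = eps t \<omega> a" "k < n i \<Longrightarrow> T.yb t \<omega> (Eta i k) a = eta t i k \<omega> a" for i k
            using a by (force simp: T.yb_def nz_simps xy_labels_def)+
          define e where "e i = (\<Sum>k<n i. eta t i k \<omega> a) / real (n i)" for i
          have ye: "(\<Sum>k<n i. T.yb t \<omega> (Eta i k) a) / real (n i) = e i" for i
            using y(2) by (simp add: e_def)
          have "(\<Sum>j\<in>UNIV. axis i 1 $ j * e j) = (\<Sum>j\<in>UNIV. if j = i then e j else 0)" for i
            by (intro sum.cong refl) (simp add: axis_def)
          then have he: "h t i \<omega> a = e i" for i
            unfolding h_def T.mx_def mix_weight ye by simp
          have re: "r t \<omega> a = eps t \<omega> a - (\<Sum>i\<in>UNIV. beta $ i * e i)"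
            unfolding r_def T.mx_def mix_weight ye y(1) by (simp add: sum_negf)
          have xe: "xtil (X t) n (eta t) \<omega> i a = X t i a + e i" for i
            using n1[of i] by (simp add: xtil_def e_def sum.distrib add_divide_distrib)
          show ?thesis
            unfolding xe re xt_def he resp_def
            by (simp add: algebra_simps sum.distrib sum_subtractf)
        qed
        have obj: "objective (NN t) (mm t) lam n (resp (X t) beta (eps t)) (xtil (X t) n (eta t)) (Z t) \<omega> b = real (NN t) *
          ((f t \<omega> - 2 * ((b - beta) \<bullet> s t \<omega>) + (b - beta) \<bullet> (A t \<omega> *v (b - beta))) / (1 + b \<bullet> (D *v b)))" for b
          unfolding f_def s_def A_def D_def W_def
          by (rule objective_expand) (use Wsym[of t \<omega>] N res in \<open>simp_all add: W_def\<close>)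
        show ?case
        proof
          show "transpose (A t \<omega>) = A t \<omega>"
            using bform_sym_on[OF Wsym[of t \<omega>]] by (simp add: A_def gram_def transpose_def vec_eq_iff)
          show "(f t \<omega> - 2 * ((bhat t \<omega> - beta) \<bullet> s t \<omega>) + (bhat t \<omega> - beta) \<bullet> (A t \<omega> *v (bhat t \<omega> - beta))) / (1 + bhat t \<omega> \<bullet> (D *v bhat t \<omega>))
             \<le> (f t \<omega> - 2 * ((b - beta) \<bullet> s t \<omega>) + (b - beta) \<bullet> (A t \<omega> *v (b - beta))) / (1 + b \<bullet> (D *v b))" for b
            by (rule mult_left_le_imp_le[OF elim[rule_format, of b, unfolded obj]]) (use N in simp)
        qed (auto simp: D_def Dmat_sym Dmat_psd)
      qed
    qed
    from eventually_prob_filter_AE[where P = "\<lambda>x. quotient_min (A (fst x) (snd x)) D (s (fst x) (snd x)) beta (bhat (fst x) (snd x)) (f (fst x) (snd x))", unfolded fst_conv snd_conv, OF this]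
    show ?thesis .
  qed
  define P where "P = matrix_inv (Delta1 lam)"
  define S where "S t \<omega> = s t \<omega> + (f t \<omega> / g) *\<^sub>R (D *v beta)" for t \<omega>
  obtain \<eta> where \<eta>: "(\<eta> \<longlongrightarrow> (0::real)) ?F" 
    "\<forall>\<^sub>F x in ?F. norm (bhat (fst x) (snd x) - beta - P *v S (fst x) (snd x)) \<le> \<eta> x * norm (P *v S (fst x) (snd x))"
  proof (rule minimizer_linearisation[OF Delta1_sym Delta1_psd inv1 _ _ _ gD lA ls lf qm])
    show "transpose D = D" "v \<bullet> (D *v v) \<ge> 0" "v \<bullet> (D *v v) \<le> (norm v)\<^sup>2" for v
      unfolding D_def by (rule Dmat_sym Dmat_psd Dmat_le[OF n1])+
  qed (rule that, assumption, simp only: P_def S_def)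

  define V where "V = Delta2 lam + K lam *\<^sub>R matrix_inv (Dinv_bb n beta)"
  define Xi where "Xi = g *\<^sub>R (P ** V ** P)"
  have Psym: "transpose P = P"
  proof -
    have "transpose (P ** Delta1 lam) = mat 1" unfolding P_def matrix_inv_invertible(2)[OF inv1] by (simp add: transpose_mat)
    then have "Delta1 lam ** transpose P = mat 1" by (simp add: matrix_transpose_mul Delta1_sym)
    then show ?thesis unfolding P_def using matrix_inv_eqI by metis
  qed
  have Csym: "transpose (matrix_inv (Dinv_bb n beta)) = matrix_inv (Dinv_bb n beta)"
    unfolding matrix_inv_Dinv_bb[OF n1] by (simp add: transpose_def vec_eq_iff Dmat_def mult.commute)
  have Vsym: "transpose V = V"
    using Delta2_sym Csym by (simp add: V_def transpose_def vec_eq_iff)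
  have Xi_form: "a \<bullet> (Xi *v a) = g * ((P *v a) \<bullet> (V *v (P *v a)))" for a
    unfolding Xi_def scaleR_matrix_vector_assoc[symmetric] matrix_vector_mul_assoc[symmetric]
    using inner_matrix_sym[OF Psym] by simp
  have V_form: "u \<bullet> (V *v u) = u \<bullet> (Delta2 lam *v u) + K lam * (u \<bullet> (matrix_inv (Dinv_bb n beta) *v u))" for u
    by (simp add: V_def matrix_vector_mult_add_rdistrib scaleR_matrix_vector_assoc[symmetric] inner_add_right)
  have V_psd: "u \<bullet> (V *v u) \<ge> 0" for u
  proof -
    have "u \<bullet> (matrix_inv (Dinv_bb n beta) *v u) \<ge> 0"
      unfolding orthogonal_weight(3)[OF n1 refl, symmetric] wdot_def by (intro sum_nonneg) auto
    then show ?thesis unfolding V_form using Delta2_psd K_pos by simp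
  qed
  have Xi_sym: "transpose Xi = Xi"
  proof -
    have "transpose (P ** V ** P) = P ** V ** P"
      by (simp add: matrix_transpose_mul Psym Vsym matrix_mul_assoc)
    then show ?thesis by (simp add: Xi_def transpose_scalar)
  qed
  obtain Q :: "(real^'p) measure" and G where Q: "prob_space Q" "G \<in> borel_measurable Q"
    and G: "\<And>a. gaussian Q (\<lambda>\<omega>. a \<bullet> G \<omega>) (a \<bullet> (Xi *v a))"
    using gaussian_vector_exists[OF Xi_sym] Xi_form V_psd g_pos by (metis mult_nonneg_nonneg less_imp_le)

  \<comment> \<open>The leading term \<open>sqrt N Delta1\<^sup>-\<^sup>1 S\<close>; its limit law
    is found through characteristic functions, and the estimator is compared with it
    afterwards.\<close>
  define Y where "Y t \<omega> = P *v (sqrt (real (NN t)) *\<^sub>R S t \<omega>)" for t \<omega>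
  have hm: "(\<lambda>\<omega>. h t i \<omega> a) \<in> borel_measurable (M t)" and rm: "(\<lambda>\<omega>. r t \<omega> a) \<in> borel_measurable (M t)" if "a < NN t" for t i a
    unfolding h_def r_def by (rule T.mx_measurable[OF that])+
  have fm: "f t \<in> borel_measurable (M t)" for t
    unfolding f_def by (intro borel_measurable_divide bform_measurable Wm rm borel_measurable_const)
  have sm: "(\<lambda>\<omega>. s t \<omega> $ i) \<in> borel_measurable (M t)" for t i
    unfolding s_def xt_def vec_lambda_beta by (intro borel_measurable_divide borel_measurable_add bform_measurable Wm hm rm borel_measurable_const)
  have Ym: "Y t \<in> borel_measurable (M t)" for t
  proof (rule vec_measurableI)
    fix i
    have "(\<lambda>\<omega>. Y t \<omega> $ i) = (\<lambda>\<omega>. \<Sum>j\<in>UNIV. P $ i $ j * (sqrt (real (NN t)) * (s t \<omega> $ j + f t \<omega> / g * (D *v beta) $ j)))"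
      by (simp add: Y_def S_def matrix_vector_mult_def)
    also have "\<dots> \<in> borel_measurable (M t)"
      by (intro borel_measurable_sum borel_measurable_times borel_measurable_add borel_measurable_divide borel_measurable_const sm fm)
    finally show "(\<lambda>\<omega>. Y t \<omega> $ i) \<in> borel_measurable (M t)" .
  qed
  have conv_Y: "conv_distr M Y Q G"
  proof (rule multivariate_levy_continuity[OF _ Q(1) Ym Q(2)])
    show "prob_space (M t)" for t by unfold_locales
    fix a :: "real^'p"
    define u where "u = P *v a"
    define \<rho> where "\<rho> = u \<bullet> (D *v beta) / g"
    let ?wr = "weight n 1 (- beta)" and ?w' = "weight n \<rho> (u - \<rho> *\<^sub>R beta)"
    let ?p = "\<lambda>t a. \<Sum>i\<in>UNIV. u $ i * X t i a"
    note ow = orthogonal_weight[OF n1 \<rho>_def[unfolded D_def g_def]]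
    have w': "?w' l = \<rho> * ?wr l + (\<Sum>i\<in>UNIV. u $ i * weight n 0 (axis i 1) l)" for l
    proof (cases l)
      case (Eta i k)
      have "(\<Sum>j\<in>UNIV. u $ j * weight n 0 (axis j 1) l) = (\<Sum>j\<in>UNIV. if j = i then u $ j / real (n j) else 0)"
        using Eta by (intro sum.cong refl) (auto simp: weight_def axis_def)
      then show ?thesis using Eta by (simp add: weight_def diff_divide_distrib)
    qed (auto simp: weight_def)
    have mx': "T.mx t ?w' \<omega> b = \<rho> * r t \<omega> b + (\<Sum>i\<in>UNIV. u $ i * h t i \<omega> b)" for t \<omega> b
    proof -
      have "T.mx t ?w' \<omega> b = (\<Sum>l\<in>xy_labels n. \<rho> * (?wr l * T.yb t \<omega> l b) + (\<Sum>i\<in>UNIV. u $ i * (weight n 0 (axis i 1) l * T.yb t \<omega> l b)))"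
        unfolding T.mx_def mix_def w' by (intro sum.cong refl) (simp add: distrib_right sum_distrib_right mult.assoc)
      also have "\<dots> = \<rho> * r t \<omega> b + (\<Sum>i\<in>UNIV. u $ i * h t i \<omega> b)"
        unfolding sum.distrib r_def h_def T.mx_def mix_def sum_distrib_left by (subst sum.swap) (rule refl)
      finally show ?thesis .
    qed
    \<comment> \<open>The summand \<open>(f / g) D beta\<close> of \<open>S\<close> contributes
      \<open>\<rho>\<close> times the quadratic form at \<open>r\<close>. Absorbed into the second
      argument, it replaces the averaged noise by the mixture \<open>?w'\<close>, and the quadratic
      part of the score becomes bilinear in two independent vectors.\<close>
    have aY: "a \<bullet> Y t \<omega> = 1 / sqrt (real (NN t)) * (bform (NN t) (T.Wm t \<omega>) (?p t) (T.mx t ?wr \<omega>) + bform (NN t) (T.Wm t \<omega>) (T.mx t ?wr \<omega>) (T.mx t ?w' \<omega>))" for t \<omega>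
    proof -
      let ?B = "bform (NN t) (W t \<omega>)"
      have "a \<bullet> Y t \<omega> = sqrt (real (NN t)) * (u \<bullet> S t \<omega>)"
        unfolding Y_def u_def inner_matrix_sym[OF Psym] by simp
      also have "u \<bullet> S t \<omega> = ((\<Sum>i\<in>UNIV. u $ i * ?B (xt t \<omega> i) (r t \<omega>)) + \<rho> * ?B (r t \<omega>) (r t \<omega>)) / real (NN t)"
        unfolding S_def inner_add_right s_def f_def \<rho>_def
        by (simp add: inner_vec_def[of u "vec_lambda _"] sum_divide_distrib add_divide_distrib mult.commute)
      also have "(\<Sum>i\<in>UNIV. u $ i * ?B (xt t \<omega> i) (r t \<omega>)) = ?B (?p t) (r t \<omega>) + ?B (\<lambda>b. \<Sum>i\<in>UNIV. u $ i * h t i \<omega> b) (r t \<omega>)"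
        unfolding xt_def bform_sum_left bform_scale_left bform_add_left by (simp add: distrib_left sum.distrib)
      also have "\<dots> + \<rho> * ?B (r t \<omega>) (r t \<omega>) = ?B (?p t) (r t \<omega>) + ?B (T.mx t ?w' \<omega>) (r t \<omega>)"
        unfolding mx' bform_add_left bform_scale_left by simp
      also have "?B (T.mx t ?w' \<omega>) (r t \<omega>) = ?B (r t \<omega>) (T.mx t ?w' \<omega>)" by (rule bform_sym_on[OF Wsym])
      also have "sqrt (real (NN t)) * ((?B (?p t) (r t \<omega>) + ?B (r t \<omega>) (T.mx t ?w' \<omega>)) / real (NN t))
          = 1 / sqrt (real (NN t)) * (?B (?p t) (r t \<omega>) + ?B (r t \<omega>) (T.mx t ?w' \<omega>))"
      proof -
        have 1: "sqrt (real (NN t)) * (B / real (NN t)) = sqrt (real (NN t)) / real (NN t) * B" for B by simp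
        \<comment> \<open>Holds for \<open>NN t = 0\<close> as well, where both quotients are
          0.\<close>
        have 2: "sqrt (real (NN t)) / real (NN t) = 1 / sqrt (real (NN t))"
          by (simp add: sqrt_divide_self_eq inverse_eq_divide)
        show ?thesis by (simp only: 1 2)
      qed
      finally show ?thesis unfolding W r_def .
    qed
    have "(\<lambda>t. \<integral>\<omega>. iexp (a \<bullet> Y t \<omega>) \<partial>M t) \<longlonglongrightarrow> complex_of_real (exp (- (wdot n ?wr ?wr * (u \<bullet> (Delta2 lam *v u) + wdot n ?w' ?w' * K lam)) / 2))"
      unfolding aY by (rule NS.score_char_limit[OF ow(2) l4u])
    also have "wdot n ?wr ?wr * (u \<bullet> (Delta2 lam *v u) + wdot n ?w' ?w' * K lam) = a \<bullet> (Xi *v a)"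
      unfolding ow(1,3) Xi_form V_form u_def[symmetric] g_def by (simp add: mult.commute)
    also have "complex_of_real (exp (- (a \<bullet> (Xi *v a)) / 2)) = (\<integral>\<omega>. iexp (a \<bullet> G \<omega>) \<partial>Q)"
      by (rule gaussian_char1[OF G, symmetric])
    finally show "(\<lambda>t. \<integral>\<omega>. iexp (a \<bullet> Y t \<omega>) \<partial>M t) \<longlonglongrightarrow> (\<integral>\<omega>. iexp (a \<bullet> G \<omega>) \<partial>Q)" .
  qed
  have "conv_distr M (\<lambda>t \<omega>. sqrt (real (NN t)) *\<^sub>R (bhat t \<omega> - beta)) Q G"
  proof (rule conv_distr_slutsky[OF _ Q(1) conv_Y Q(2)])
    show "prob_space (M t)" for t by unfold_locales
    show "(\<lambda>\<omega>. sqrt (real (NN t)) *\<^sub>R (bhat t \<omega> - beta)) \<in> borel_measurable (M t)" for t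
      by (intro borel_measurable_scaleR borel_measurable_diff borel_measurable_const bhat_meas[rule_format])
    have lim: "((\<lambda>x. \<eta> x * norm (Y (fst x) (snd x))) \<longlongrightarrow> 0) ?F"
      by (rule tight_mult_tendsto_0[OF _ Q(1) conv_Y Q(2) \<eta>(1)]) unfold_locales
    show "((\<lambda>x. sqrt (real (NN (fst x))) *\<^sub>R (bhat (fst x) (snd x) - beta) - Y (fst x) (snd x)) \<longlongrightarrow> 0) ?F"
    proof (rule Lim_null_comparison[OF _ lim])
      \<comment> \<open>The remainder bound is relative, so the factor \<open>sqrt N\<close> passes
        to both sides and produces the norm of \<open>Y\<close>, which is tight.\<close>
      show "\<forall>\<^sub>F x in ?F. norm (sqrt (real (NN (fst x))) *\<^sub>R (bhat (fst x) (snd x) - beta) - Y (fst x) (snd x)) \<le> \<eta> x * norm (Y (fst x) (snd x))"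
        using \<eta>(2)
      proof eventually_elim
        case (elim x)
        let ?s = "sqrt (real (NN (fst x)))"
        have Yx: "Y (fst x) (snd x) = ?s *\<^sub>R (P *v S (fst x) (snd x))" by (simp add: Y_def matrix_vector_mult_scaleR)
        have "norm (?s *\<^sub>R (bhat (fst x) (snd x) - beta) - Y (fst x) (snd x)) = ?s * norm (bhat (fst x) (snd x) - beta - P *v S (fst x) (snd x))"
          unfolding Yx scaleR_diff_right[symmetric] by simp
        also have "\<dots> \<le> ?s * (\<eta> x * norm (P *v S (fst x) (snd x)))" by (intro mult_left_mono elim) simp
        finally show ?case unfolding Yx by (simp add: mult_ac)
      qed
    qed
  qed
  moreover have "gauss_p Q G Xi" by (rule gauss_p_if_gaussian[OF Q G])
  ultimately show ?thesis unfolding Xi_def V_def P_def g_def by blast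
qed

end
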